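(* Let $(X,M,Y)$ be a random element of $\mathbb{R}^d\times\{0,1\}^d\times\{-1,1\}$. Write $p_m=\mathbb{P}(M=m)$ and $\pi_{m,k}=\mathbb{P}(Y=k,M=m)$. Assume that for every $m\in\{0,1\}^d$ with $p_m>0$ and every $k\in\{-1,1\}$, $X_{\mathrm{obs}(m)}|(M=m,Y=k)\sim\mathcal{N}(\mu_{m,k},\Sigma_m)$ with $\Sigma_m$ symmetric positive definite, and that the classes are balanced on each missing pattern: $\pi_{m,1}=\pi_{m,-1}$. Let $n\ge1$ and $\tau\ge\sqrt{d/n}$. Then the plug-in pattern-by-pattern classifier $\widetilde h$ built with known $\Sigma_m$ and thresholded mean estimates $\widetilde\mu_{m,k}$ with threshold $\tau$ (see context) satisfies $$\mathcal{R}_{\mathrm{mis}}(\widetilde h)-\mathcal{R}_{\mathrm{mis}}(h^\star)\le\sum_{m\in\{0,1\}^d}\left(\frac{4}{\sqrt{2\pi}}+\frac{8}{\sqrt\pi}\frac{\|\mu_m\|}{\sqrt{\lambda_{\min}(\Sigma_m)}}\right)(\tau\wedge p_m)+\sum_{m\in\{0,1\}^d:\, p_m\ge\tau}\frac{\sqrt2\,\|\mu_m\|}{\sqrt{\pi\lambda_{\min}(\Sigma_m)}}\,p_m(1-p_m)^{n/2}.$$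
   Context: $M_j=1$ means that $X_j$ is missing; $\mathrm{obs}(m)=\{j:m_j=0\}$; $X_{\mathrm{obs}(m)}$ is the corresponding subvector; $Z=(X_{\mathrm{obs}(M)},M)$; $a\wedge b=\min(a,b)$; $\lambda_{\min}$ is the smallest eigenvalue; $\mathrm{sign}(x)=1$ if $x\ge0$, $-1$ otherwise. $\|\mu_m\|=\max_{k\in\{-1,1\}}\|\mu_{m,k}\|$ (Euclidean norm). Terms with $p_m=0$ are read as $0$, and for $\mathrm{obs}(m)=\emptyset$ the ratio $\|\mu_m\|/\sqrt{\lambda_{\min}(\Sigma_m)}$ is read as $0$. $\mathcal{D}_n=\{(X_{i,\mathrm{obs}(M_i)},M_i,Y_i)\}_{i=1}^n$ is an i.i.d. sample distributed as $(X_{\mathrm{obs}(M)},M,Y)$, independent of the test point. Let $N_{m,k}=\sum_{i=1}^n\mathbf{1}_{M_i=m}\mathbf{1}_{Y_i=k}$, $$\widehat\mu_{m,k}=\frac{\sum_{i=1}^nX_{i,\mathrm{obs}(m)}\mathbf{1}_{Y_i=k}\mathbf{1}_{M_i=m}}{N_{m,k}}\quad(0/0=0),\qquad\widetilde\mu_{m,k}=\widehat\mu_{m,k}\mathbf{1}_{N_{m,k}/n>\tau}.$$ The classifier is $\widetilde h(Z)=\sum_m\widetilde h_m(X_{\mathrm{obs}(m)})\mathbf{1}_{M=m}$ with $$\widetilde h_m(x)=\mathrm{sign}\Big((\widetilde\mu_{m,1}-\widetilde\mu_{m,-1})^\top\Sigma_m^{-1}\Big(x-\frac{\widetilde\mu_{m,1}+\widetilde\mu_{m,-1}}{2}\Big)\Big).$$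 $\mathcal{R}_{\mathrm{mis}}(h)=\mathbb{P}(Y\ne h(Z))$ (over the sample and the test point for $\widetilde h$), and $h^\star(Z)=\mathrm{sign}(\mathbb{E}[Y|Z])$ is the Bayes predictor. *)

theory Defs
  imports "HOL-Probability.Probability"
begin

text \<open>
  Vectors and matrices over an index set \<open>S\<close> (later \<open>S = obs m\<close>) are functions of which only the
  values on \<open>S\<close> matter. A subvector of a random vector is rendered by \<^const>\<open>restrict\<close>.
\<close>

definition bilin_on :: "'d set \<Rightarrow> ('d \<Rightarrow> real) \<Rightarrow> ('d \<Rightarrow> 'd \<Rightarrow> real) \<Rightarrow> ('d \<Rightarrow> real) \<Rightarrow> real" where
  "bilin_on S u A v = (\<Sum>i\<in>S. \<Sum>j\<in>S. u i * A i j * v j)"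

definition sym_pos_def_on :: "'d set \<Rightarrow> ('d \<Rightarrow> 'd \<Rightarrow> real) \<Rightarrow> bool" where
  "sym_pos_def_on S A \<longleftrightarrow>
     (\<forall>i\<in>S. \<forall>j\<in>S. A i j = A j i) \<and>
     (\<forall>v. (\<exists>i\<in>S. v i \<noteq> 0) \<longrightarrow> bilin_on S v A v > 0)"

text \<open>The analogue of \<^const>\<open>matrix_inv\<close> for an \<open>S \<times> S\<close> matrix; only its entries in \<open>S \<times> S\<close> are specified.\<close>

definition inv_on :: "'d set \<Rightarrow> ('d \<Rightarrow> 'd \<Rightarrow> real) \<Rightarrow> ('d \<Rightarrow> 'd \<Rightarrow> real)" where
  "inv_on S A = (SOME B. \<forall>i\<in>S. \<forall>j\<in>S.
     (\<Sum>l\<in>S. A i l * B l j) = of_bool (i = j) \<and> (\<Sum>l\<in>S. B i l * A l j) = of_bool (i = j))"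

definition eigenvalue_on :: "'d set \<Rightarrow> ('d \<Rightarrow> 'd \<Rightarrow> real) \<Rightarrow> real \<Rightarrow> bool" where
  "eigenvalue_on S A l \<longleftrightarrow>
     (\<exists>v. (\<exists>i\<in>S. v i \<noteq> 0) \<and> (\<forall>i\<in>S. (\<Sum>j\<in>S. A i j * v j) = l * v i))"

definition lambda_min_on :: "'d set \<Rightarrow> ('d \<Rightarrow> 'd \<Rightarrow> real) \<Rightarrow> real" where
  "lambda_min_on S A = (LEAST l. eigenvalue_on S A l)"

text \<open>
  \<open>N\<close> is the Gaussian law \<open>\<N>(\<mu>, \<Sigma>)\<close> on \<open>\<real>\<^sup>S\<close>, defined as the law of \<open>\<mu> + A \<xi>\<close> where \<open>\<xi>\<close> has
  independent standard normal coordinates and \<open>A A\<^sup>T = \<Sigma>\<close>. This law does not depend on the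
  choice of the square matrix \<open>A\<close>.
\<close>

definition is_gaussian_on ::
  "'d set \<Rightarrow> ('d \<Rightarrow> real) \<Rightarrow> ('d \<Rightarrow> 'd \<Rightarrow> real) \<Rightarrow> ('d \<Rightarrow> real) measure \<Rightarrow> bool" where
  "is_gaussian_on S \<mu> cov N \<longleftrightarrow>
     (\<exists>A. (\<forall>i\<in>S. \<forall>j\<in>S. (\<Sum>l\<in>S. A i l * A j l) = cov i j) \<and>
       N = distr (\<Pi>\<^sub>M l\<in>S. density lborel (\<lambda>x. ennreal (std_normal_density x))) (\<Pi>\<^sub>M i\<in>S. borel)
             (\<lambda>\<xi>. \<lambda>i\<in>S. \<mu> i + (\<Sum>l\<in>S. A i l * \<xi> l)))"

text \<open>A mask \<open>m \<in> {0,1}\<^sup>d\<close> has type \<open>bool ^ 'd\<close>; \<open>m $ j\<close> (that is, \<open>m\<^sub>j = 1\<close>) means that coordinate \<open>j\<close> is missing.\<close>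

definition obs :: "bool ^ 'd \<Rightarrow> 'd::finite set" where
  "obs m = {j. \<not> m $ j}"

definition subvec :: "real ^ 'd \<Rightarrow> 'd set \<Rightarrow> ('d::finite \<Rightarrow> real)" where
  "subvec x S = restrict (\<lambda>j. x $ j) S"

text \<open>
  An observation \<open>Z = (X\<^bsub>obs(M)\<^esub>, M)\<close>. Missing coordinates carry the constant dummy value of
  \<^const>\<open>restrict\<close>, so \<open>obs_space\<close> induces on observations the \<open>\<sigma>\<close>-algebra of the disjoint
  union of the spaces \<open>\<real>\<^bsup>obs(m)\<^esup>\<close> over all masks \<open>m\<close>.
\<close>

type_synonym 'd observation = "('d \<Rightarrow> real) \<times> (bool ^ 'd)"

definition observe :: "real ^ 'd \<Rightarrow> bool ^ 'd \<Rightarrow> 'd::finite observation" where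
  "observe x m = (subvec x (obs m), m)"

definition obs_space :: "'d::finite observation measure" where
  "obs_space = (\<Pi>\<^sub>M j\<in>UNIV. borel) \<Otimes>\<^sub>M count_space UNIV"

definition labelled_space :: "('d::finite observation \<times> real) measure" where
  "labelled_space = obs_space \<Otimes>\<^sub>M borel"

definition sign_pm :: "real \<Rightarrow> real" where
  "sign_pm x = (if x \<ge> 0 then 1 else -1)"

text \<open>A sample of size \<open>n\<close> is the restriction of a sequence \<open>D\<close> of labelled observations to \<open>{1..n}\<close>.\<close>

definition count_mk :: "nat \<Rightarrow> (nat \<Rightarrow> 'd::finite observation \<times> real) \<Rightarrow> bool ^ 'd \<Rightarrow> real \<Rightarrow> nat" where
  "count_mk n D m k = (\<Sum>i=1..n. of_bool (snd (fst (D i)) = m) * of_bool (snd (D i) = k))"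

definition mu_hat ::
  "nat \<Rightarrow> (nat \<Rightarrow> 'd::finite observation \<times> real) \<Rightarrow> bool ^ 'd \<Rightarrow> real \<Rightarrow> 'd \<Rightarrow> real" where
  "mu_hat n D m k j =
     (\<Sum>i=1..n. fst (fst (D i)) j * of_bool (snd (D i) = k) * of_bool (snd (fst (D i)) = m))
       / real (count_mk n D m k)"

definition mu_tilde ::
  "nat \<Rightarrow> real \<Rightarrow> (nat \<Rightarrow> 'd::finite observation \<times> real) \<Rightarrow> bool ^ 'd \<Rightarrow> real \<Rightarrow> 'd \<Rightarrow> real" where
  "mu_tilde n \<tau> D m k j = mu_hat n D m k j * of_bool (real (count_mk n D m k) / real n > \<tau>)"

definition h_tilde_pattern ::
  "nat \<Rightarrow> real \<Rightarrow> (bool ^ 'd \<Rightarrow> 'd \<Rightarrow> 'd \<Rightarrow> real) \<Rightarrow> (nat \<Rightarrow> 'd::finite observation \<times> real)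
     \<Rightarrow> bool ^ 'd \<Rightarrow> ('d \<Rightarrow> real) \<Rightarrow> real" where
  "h_tilde_pattern n \<tau> cov D m x = sign_pm (bilin_on (obs m)
     (\<lambda>i. mu_tilde n \<tau> D m 1 i - mu_tilde n \<tau> D m (-1) i)
     (inv_on (obs m) (cov m))
     (\<lambda>j. x j - (mu_tilde n \<tau> D m 1 j + mu_tilde n \<tau> D m (-1) j) / 2))"

definition h_tilde ::
  "nat \<Rightarrow> real \<Rightarrow> (bool ^ 'd \<Rightarrow> 'd \<Rightarrow> 'd \<Rightarrow> real) \<Rightarrow> (nat \<Rightarrow> 'd::finite observation \<times> real)
     \<Rightarrow> 'd observation \<Rightarrow> real" where
  "h_tilde n \<tau> cov D z = (\<Sum>m\<in>UNIV. h_tilde_pattern n \<tau> cov D m (fst z) * of_bool (snd z = m))"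

text \<open>
  The Bayes prediction \<open>sign (E[Y | Z])\<close> as a random variable; its misclassification risk does
  not depend on the version of the conditional expectation.
\<close>

definition h_star :: "'o measure \<Rightarrow> ('o \<Rightarrow> 'd::finite observation) \<Rightarrow> ('o \<Rightarrow> real) \<Rightarrow> 'o \<Rightarrow> real" where
  "h_star P Z Y \<omega> = sign_pm (real_cond_exp P (vimage_algebra (space P) Z obs_space) Y \<omega>)"

text \<open>Risk of a prediction \<open>H\<close>, given as a random variable on the same space as the label \<open>Y\<close>.\<close>

definition risk_mis :: "'o measure \<Rightarrow> ('o \<Rightarrow> real) \<Rightarrow> ('o \<Rightarrow> real) \<Rightarrow> real" where
  "risk_mis P Y H = \<P>(\<omega> in P. Y \<omega> \<noteq> H \<omega>)"

text \<open>\<open>mu_norm\<close> is \<open>0\<close> when \<open>obs m = {}\<close>, so quotients of it by \<open>sqrt (lambda_min_on \<dots>)\<close> are then \<open>0\<close> too.\<close>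

definition mu_norm :: "(bool ^ 'd \<Rightarrow> real \<Rightarrow> 'd::finite \<Rightarrow> real) \<Rightarrow> bool ^ 'd \<Rightarrow> real" where
  "mu_norm \<mu> m = Max ((\<lambda>k. L2_set (\<mu> m k) (obs m)) ` {-1, 1})"

end

theory Submission
  imports Defs
begin

text \<open>
  Fix a mask \<open>m\<close> with \<open>p\<^sub>m > 0\<close> and a square root \<open>A A\<^sup>T = \<Sigma>\<^sub>m\<close>. The inverse of \<open>A\<close> (\<open>whiten\<close>) turns
  the two conditional laws into standard Gaussians around two centres \<open>\<alpha>\<close>, \<open>\<beta>\<close>, and turns the form
  of the inverse of \<open>\<Sigma>\<^sub>m\<close> into the ordinary inner product. Since the law does not depend on the choice of the
  root, one root serves both classes; this is rotation invariance of the standard Gaussian.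
  Let \<open>\<Phi>\<close> be the standard normal distribution function. The excess risk on the mask is found by
  comparing two bounds.

  \<^item> No predictor based on the observation beats the likelihood ratio test, so with balanced
    classes every such predictor has an error on the mask of at least \<open>p\<^sub>m \<Phi>(-|\<alpha> - \<beta>|/2)\<close>. This is the Neyman-Pearson argument of
    \<open>std_gauss_testing\<close> and applies to the Bayes predictor (\<open>bayes_risk_ge_overlap\<close>).
  \<^item> The discriminant rule with centres \<open>a\<close>, \<open>b\<close> in place of \<open>\<alpha>\<close>, \<open>\<beta>\<close> errs with probability at most
    \<open>p\<^sub>m \<Phi>(-|\<alpha> - \<beta>|/2) + p\<^sub>m (|a - \<alpha>| + |b - \<beta>|)/\<surd>(2\<pi>)\<close>: each of its two errors is the mass of a half-space,
    the margins move by at most the estimation errors, and \<open>\<Phi>\<close> is Lipschitz with constant \<open>1/\<surd>(2\<pi>)\<close>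
    (\<open>std_gauss_lda\<close>).

  So the excess risk is at most the sum over \<open>m\<close> of \<open>p\<^sub>m/\<surd>(2\<pi>)\<close> times the mean whitened errors of the
  two estimates. Such an error equals the norm of a mean of \<open>N\<close> centred vectors if \<open>N > n\<tau>\<close>, and the
  norm of the whitened true mean, which is at most \<open>r\<^sub>m = \<parallel>\<mu>\<^sub>m\<parallel>/\<surd>\<lambda>\<close>, otherwise; here \<open>\<lambda>\<close> is the least
  eigenvalue of \<open>\<Sigma>\<^sub>m\<close> and \<open>N\<close> the number of
  sample points with the given mask and label, each of which has them with probability \<open>q = p\<^sub>m/2\<close>.
  Everything about \<open>N\<close> follows from leaving one sample point out: if
  \<open>b\<^sub>i\<close> indicates that point \<open>i\<close> is one of them, summing \<open>E(b\<^sub>i/N) = q E(1/(1 + N - b\<^sub>i))\<close> over \<open>i\<close> gives \<open>n q E(1/(1 + N)) \<le> 1\<close>. Hence \<open>q P(N \<le> n\<tau>) \<le> 2 min(\<tau>, p\<^sub>m)\<close>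
  by Markov's inequality, and the mean part has expectation at most \<open>min(\<tau>, p\<^sub>m)/q\<close> by Jensen's inequality,
  both thanks to \<open>\<tau> \<ge> \<surd>(d/n)\<close> (\<open>thresholded_mean_bounds\<close>). Adding up, a mask contributes at most
  \<open>(4 + 8 r\<^sub>m) min(\<tau>, p\<^sub>m)/\<surd>(2\<pi>)\<close>, which is bounded by its term in the theorem.
\<close>

section \<open>The standard Gaussian measure and its rotations\<close>

definition std_gauss_density :: "real ^ 'd::finite \<Rightarrow> real" where
  "std_gauss_density x = (\<Prod>i\<in>UNIV. std_normal_density (x $ i))"

text \<open>
  The observed coordinates vary with the mask. All Gaussian laws below are images of this one measure
  on the full space, so that vectors and matrices of fixed size can be used throughout.
\<close>

definition std_gauss :: "(real ^ 'd::finite) measure" where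
  "std_gauss = density lborel (\<lambda>x. ennreal (std_gauss_density x))"

text \<open>
  Rotation invariance of the Gaussian rests on this form: the density depends on \<open>x\<close> only through its norm.
\<close>

lemma std_gauss_density_norm:
  fixes x :: "real ^ 'd::finite"
  shows "std_gauss_density x = (1 / sqrt (2 * pi)) ^ CARD('d) * exp (- (norm x)\<^sup>2 / 2)"
proof -
  have "(norm x)\<^sup>2 = (\<Sum>i\<in>UNIV. (x $ i)\<^sup>2)"
    by (simp add: norm_vec_def L2_set_def sum_nonneg)
  then show ?thesis
    by (simp add: std_gauss_density_def std_normal_density_def power_divide prod_dividef
        sum_divide_distrib sum_negf flip: exp_sum)
qed

lemma std_gauss_density_measurable [measurable]: "std_gauss_density \<in> borel_measurable borel"
  unfolding std_gauss_density_norm[abs_def] by measurable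

lemma sets_std_gauss [simp, measurable_cong]: "sets std_gauss = sets borel"
  and space_std_gauss [simp]: "space std_gauss = UNIV"
  by (simp_all add: std_gauss_def)

lemma nn_integral_lborel_prod_vec:
  fixes f :: "'d::finite \<Rightarrow> real \<Rightarrow> ennreal"
  assumes [measurable]: "\<And>i. f i \<in> borel_measurable borel"
  shows "(\<integral>\<^sup>+x. (\<Prod>i\<in>UNIV. f i (x $ i)) \<partial>lborel) = (\<Prod>i\<in>UNIV. \<integral>\<^sup>+x. f i x \<partial>lborel)"
proof -
  define F where "F b = f (SOME i. b = axis i 1)" for b :: "real ^ 'd"
  have F: "F (axis i 1) = f i" for i
    by (simp add: F_def axis_eq_axis)
  have Basis: "(Basis :: (real ^ 'd) set) = (\<lambda>i. axis i 1) ` UNIV"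
    by (auto simp: Basis_vec_def)
  have inj: "inj (\<lambda>i::'d. axis i (1::real))"
    by (auto simp: inj_on_def axis_eq_axis)
  have "(\<integral>\<^sup>+x. (\<Prod>b\<in>Basis. F b (x \<bullet> b)) \<partial>(lborel :: (real ^ 'd) measure))
      = (\<Prod>b\<in>(Basis :: (real ^ 'd) set). \<integral>\<^sup>+x. F b x \<partial>lborel)"
    by (rule nn_integral_lborel_prod) (auto simp: F_def)
  then show ?thesis
    unfolding Basis prod.reindex[OF inj] by (simp add: F inner_axis)
qed

lemma nn_integral_lborel_translate:
  fixes f :: "'a::euclidean_space \<Rightarrow> ennreal"
  assumes [measurable]: "f \<in> borel_measurable borel"
  shows "(\<integral>\<^sup>+x. f (c + x) \<partial>lborel) = (\<integral>\<^sup>+x. f x \<partial>lborel)"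
  by (subst (2) lborel_distr_plus[of c, symmetric]) (simp add: nn_integral_distr)

lemma nn_integral_std_gauss:
  fixes f :: "real ^ 'd::finite \<Rightarrow> ennreal"
  assumes [measurable]: "f \<in> borel_measurable borel"
  shows "(\<integral>\<^sup>+x. f x \<partial>std_gauss) = (\<integral>\<^sup>+x. ennreal (std_gauss_density x) * f x \<partial>lborel)"
  unfolding std_gauss_def by (simp add: nn_integral_density)

lemma nn_integral_std_gauss_prod:
  fixes f :: "'d::finite \<Rightarrow> real \<Rightarrow> ennreal"
  assumes [measurable]: "\<And>i. f i \<in> borel_measurable borel"
  shows "(\<integral>\<^sup>+x. (\<Prod>i\<in>UNIV. f i (x $ i)) \<partial>std_gauss)
       = (\<Prod>i\<in>UNIV. \<integral>\<^sup>+x. f i x \<partial>std_normal_distribution)"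
proof -
  have "(\<integral>\<^sup>+x. (\<Prod>i\<in>UNIV. f i (x $ i)) \<partial>std_gauss)
      = (\<integral>\<^sup>+x. (\<Prod>i\<in>UNIV. ennreal (std_normal_density (x $ i)) * f i (x $ i)) \<partial>lborel)"
    by (subst nn_integral_std_gauss)
       (simp_all add: std_gauss_density_def prod.distrib prod_ennreal)
  also have "\<dots> = (\<Prod>i\<in>UNIV. \<integral>\<^sup>+x. ennreal (std_normal_density x) * f i x \<partial>lborel)"
    by (rule nn_integral_lborel_prod_vec) measurable
  finally show ?thesis
    by (simp add: nn_integral_density)
qed

lemma prob_space_std_normal: "prob_space std_normal_distribution"
  by (rule prob_space_normal_density) simp

lemma nn_integral_std_gauss_density:
  "(\<integral>\<^sup>+x. ennreal (std_gauss_density x) \<partial>(lborel :: (real ^ 'd::finite) measure)) = 1"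
proof -
  have "(\<integral>\<^sup>+x. (\<Prod>i\<in>(UNIV :: 'd set). 1) \<partial>(std_gauss :: (real ^ 'd) measure))
      = (\<Prod>i\<in>(UNIV::'d set). \<integral>\<^sup>+x. 1 \<partial>std_normal_distribution)"
    by (rule nn_integral_std_gauss_prod[of "\<lambda>_ _. 1"]) simp
  also have "\<dots> = 1"
    using prob_space.emeasure_space_1[OF prob_space_std_normal] by simp
  finally show ?thesis
    by (simp add: nn_integral_std_gauss del: nn_integral_const)
qed

interpretation std_gauss: prob_space std_gauss
  by standard (simp add: std_gauss_def emeasure_density nn_integral_std_gauss_density)

text \<open>
  This connects \<open>std_gauss\<close> with the product measure in \<open>is_gaussian_on\<close>: coordinates outside \<open>S\<close>
  integrate to \<open>1\<close>.
\<close>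

lemma std_gauss_PiM:
  fixes S :: "'d::finite set"
  shows "(\<Pi>\<^sub>M l\<in>S. std_normal_distribution)
       = distr (std_gauss :: (real ^ 'd) measure) (\<Pi>\<^sub>M l\<in>S. borel) (\<lambda>x. \<lambda>l\<in>S. x $ l)"
proof -
  interpret N: prob_space std_normal_distribution
    by (rule prob_space_std_normal)
  interpret product_sigma_finite "\<lambda>_::'d. std_normal_distribution"
    by standard
  have sets: "sets (\<Pi>\<^sub>M l\<in>S. std_normal_distribution) = sets (\<Pi>\<^sub>M l\<in>S. borel)"
    by (rule sets_PiM_cong) auto
  have "distr (std_gauss :: (real ^ 'd) measure) (\<Pi>\<^sub>M l\<in>S. borel) (\<lambda>x. \<lambda>l\<in>S. x $ l)
      = (\<Pi>\<^sub>M l\<in>S. std_normal_distribution)"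
  proof (rule PiM_eqI)
    fix A :: "'d \<Rightarrow> real set" assume A: "\<And>i. i \<in> S \<Longrightarrow> A i \<in> sets std_normal_distribution"
    define B where "B i = (if i \<in> S then A i else UNIV)" for i
    have [measurable]: "B i \<in> sets borel" for i
      using A by (auto simp: B_def)
    have m: "(\<lambda>x. \<lambda>l\<in>S. x $ l) \<in> measurable std_gauss (\<Pi>\<^sub>M l\<in>S. borel)"
      by measurable
    have P: "Pi\<^sub>E S A \<in> sets (\<Pi>\<^sub>M l\<in>S. borel)"
      using A by (intro sets_PiM_I_finite) auto
    have ind: "indicator ((\<lambda>x. \<lambda>l\<in>S. x $ l) -` Pi\<^sub>E S A) x = (\<Prod>i\<in>UNIV. indicator (B i) (x $ i) :: ennreal)"
      for x :: "real ^ 'd"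
    proof (cases "\<forall>i\<in>S. x $ i \<in> A i")
      case True
      then show ?thesis by (simp add: B_def indicator_def if_distrib prod.neutral cong: if_cong)
    next
      case False
      then show ?thesis by (auto simp: B_def indicator_def intro!: prod_zero[symmetric] bexI)
    qed
    have "emeasure (distr std_gauss (\<Pi>\<^sub>M l\<in>S. borel) (\<lambda>x. \<lambda>l\<in>S. x $ l)) (Pi\<^sub>E S A)
        = emeasure (std_gauss :: (real ^ 'd) measure) ((\<lambda>x. \<lambda>l\<in>S. x $ l) -` Pi\<^sub>E S A)"
      by (subst emeasure_distr[OF m P]) simp
    also have "\<dots> = (\<integral>\<^sup>+x. indicator ((\<lambda>x. \<lambda>l\<in>S. x $ l) -` Pi\<^sub>E S A) x \<partial>(std_gauss :: (real ^ 'd) measure))"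
      using measurable_sets[OF m P] by (subst nn_integral_indicator) auto
    also have "\<dots> = (\<integral>\<^sup>+x. (\<Prod>i\<in>UNIV. indicator (B i) (x $ i)) \<partial>(std_gauss :: (real ^ 'd) measure))"
      unfolding ind ..
    also have "\<dots> = (\<Prod>i\<in>UNIV. \<integral>\<^sup>+x. indicator (B i) x \<partial>std_normal_distribution)"
      by (rule nn_integral_std_gauss_prod) measurable
    also have "\<dots> = (\<Prod>i\<in>UNIV. emeasure std_normal_distribution (B i))"
      by (simp add: nn_integral_indicator)
    also have "\<dots> = (\<Prod>i\<in>S. emeasure std_normal_distribution (A i))"
      using N.emeasure_space_1
      by (intro prod.mono_neutral_cong_right) (auto simp: B_def)
    finally show "emeasure (distr std_gauss (\<Pi>\<^sub>M l\<in>S. borel) (\<lambda>x. \<lambda>l\<in>S. x $ l)) (Pi\<^sub>E S A)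
        = (\<Prod>i\<in>S. emeasure std_normal_distribution (A i))" .
  qed (auto simp: sets)
  then show ?thesis ..
qed

lemma orthogonal_transformation_measurable:
  fixes T :: "real ^ 'd::finite \<Rightarrow> real ^ 'd"
  assumes "orthogonal_transformation T" shows "T \<in> borel_measurable borel"
  by (intro borel_measurable_continuous_onI linear_continuous_on linear_conv_bounded_linear[THEN iffD1]
      orthogonal_transformation_linear assms)

text \<open>
  Translation invariance of Lebesgue measure is enough. Let \<open>g\<close> be the Gaussian density and insert the
  factor \<open>\<integral>g = 1\<close>. After a translation of \<open>y\<close> and an exchange of integrals, the translation of \<open>x\<close> by a
  preimage of \<open>y\<close> moves \<open>y\<close> from the argument of \<open>g\<close> to that of \<open>f\<close>. What is left of \<open>g\<close> is
  \<open>g(-T x) = g(x)\<close>, and integrating \<open>f(T x + y)\<close> over \<open>y\<close> makes the rotation disappear.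
\<close>

lemma nn_integral_lborel_orthogonal:
  fixes f :: "real ^ 'd::finite \<Rightarrow> ennreal"
  assumes T: "orthogonal_transformation (T :: real ^ 'd \<Rightarrow> real ^ 'd)" and [measurable]: "f \<in> borel_measurable borel"
  shows "(\<integral>\<^sup>+x. f (T x) \<partial>lborel) = (\<integral>\<^sup>+x. f x \<partial>lborel)"
proof -
  have lin: "linear T" using T by (rule orthogonal_transformation_linear)
  have [measurable]: "T \<in> borel_measurable borel"
    by (rule orthogonal_transformation_measurable[OF T])
  have surj: "\<exists>x. T x = y" for y
    using orthogonal_transformation_surj[OF T] by (metis surjD)
  define R where "R y = (SOME x. T x = y)" for y
  have R: "T (R y) = y" for y unfolding R_def by (rule someI_ex[OF surj])
  let ?g = "\<lambda>x::real ^ 'd. ennreal (std_gauss_density x)"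
  have g: "?g (- T x) = ?g x" for x
    by (simp add: std_gauss_density_norm orthogonal_transformation_norm[OF T])
  have "(\<integral>\<^sup>+x. f (T x) \<partial>lborel) = (\<integral>\<^sup>+x. f (T x) * (\<integral>\<^sup>+y. ?g y \<partial>lborel) \<partial>lborel)"
    by (simp add: nn_integral_std_gauss_density)
  also have "\<dots> = (\<integral>\<^sup>+x. (\<integral>\<^sup>+y. f (T x) * ?g (- T x + y) \<partial>lborel) \<partial>lborel)"
  proof (intro nn_integral_cong)
    fix x
    have "(\<integral>\<^sup>+y. ?g (- T x + y) \<partial>lborel) = (\<integral>\<^sup>+y. ?g y \<partial>lborel)"
      by (rule nn_integral_lborel_translate) measurable
    moreover have "(\<integral>\<^sup>+y. f (T x) * ?g (- T x + y) \<partial>lborel) = f (T x) * (\<integral>\<^sup>+y. ?g (- T x + y) \<partial>lborel)"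
      by (rule nn_integral_cmult) measurable
    ultimately show "f (T x) * (\<integral>\<^sup>+y. ?g y \<partial>lborel) = (\<integral>\<^sup>+y. f (T x) * ?g (- T x + y) \<partial>lborel)"
      by metis
  qed
  also have "\<dots> = (\<integral>\<^sup>+y. (\<integral>\<^sup>+x. f (T x) * ?g (- T x + y) \<partial>lborel) \<partial>lborel)"
    by (rule lborel_pair.Fubini') measurable
  also have "\<dots> = (\<integral>\<^sup>+y. (\<integral>\<^sup>+x. f (T (R y + x)) * ?g (- T (R y + x) + y) \<partial>lborel) \<partial>lborel)"
    by (subst nn_integral_lborel_translate) simp_all
  also have "\<dots> = (\<integral>\<^sup>+y. (\<integral>\<^sup>+x. f (T x + y) * ?g x \<partial>lborel) \<partial>lborel)"
    by (simp add: linear_add[OF lin] R g add.commute)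
  also have "\<dots> = (\<integral>\<^sup>+x. (\<integral>\<^sup>+y. f (T x + y) * ?g x \<partial>lborel) \<partial>lborel)"
    by (rule lborel_pair.Fubini') measurable
  also have "\<dots> = (\<integral>\<^sup>+x. (\<integral>\<^sup>+y. f y \<partial>lborel) * ?g x \<partial>lborel)"
    by (simp add: nn_integral_multc nn_integral_lborel_translate)
  also have "\<dots> = (\<integral>\<^sup>+y. f y \<partial>lborel)"
    by (simp add: nn_integral_cmult nn_integral_std_gauss_density)
  finally show ?thesis .
qed

lemma std_gauss_orthogonal:
  assumes T: "orthogonal_transformation (T :: real ^ 'd::finite \<Rightarrow> real ^ 'd)"
  shows "distr std_gauss borel T = (std_gauss :: (real ^ 'd::finite) measure)"
proof (rule measure_eqI)
  have [measurable]: "T \<in> borel_measurable borel"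
    by (rule orthogonal_transformation_measurable[OF T])
  fix A assume "A \<in> sets (distr std_gauss borel T)"
  then have [measurable]: "A \<in> sets borel" by simp
  have "emeasure (distr std_gauss borel T) A = (\<integral>\<^sup>+x. indicator A x \<partial>distr std_gauss borel T)"
    by simp
  also have "\<dots> = (\<integral>\<^sup>+x. indicator A (T x) \<partial>std_gauss)"
    by (rule nn_integral_distr) measurable
  also have "\<dots> = (\<integral>\<^sup>+x. ennreal (std_gauss_density (T x)) * indicator A (T x) \<partial>lborel)"
    by (simp add: nn_integral_std_gauss std_gauss_density_norm orthogonal_transformation_norm[OF T])
  also have "\<dots> = (\<integral>\<^sup>+x. ennreal (std_gauss_density x) * indicator A x \<partial>lborel)"
    by (rule nn_integral_lborel_orthogonal[OF T]) measurable
  also have "\<dots> = emeasure std_gauss A"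
    by (simp flip: nn_integral_std_gauss)
  finally show "emeasure (distr std_gauss borel T) A = emeasure std_gauss A" .
qed simp

lemma std_gauss_component: "distr std_gauss borel (\<lambda>x. x $ j) = std_normal_distribution"
proof (rule measure_eqI)
  fix A assume "A \<in> sets (distr (std_gauss :: (real ^ 'a) measure) borel (\<lambda>x. x $ j))"
  then have [measurable]: "A \<in> sets borel" by simp
  define f where "f i x = (if i = j then indicator A x else (1::ennreal))" for i x
  have "emeasure (distr std_gauss borel (\<lambda>x. x $ j)) A = (\<integral>\<^sup>+x. indicator A x \<partial>distr (std_gauss :: (real ^ 'a) measure) borel (\<lambda>x. x $ j))"
    by simp
  also have "\<dots> = (\<integral>\<^sup>+x. indicator A (x $ j) \<partial>(std_gauss :: (real ^ 'a) measure))"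
    by (rule nn_integral_distr) measurable
  also have "\<dots> = (\<integral>\<^sup>+x. (\<Prod>i\<in>UNIV. f i (x $ i)) \<partial>(std_gauss :: (real ^ 'a) measure))"
    by (simp add: f_def)
  also have "\<dots> = (\<Prod>i\<in>UNIV. \<integral>\<^sup>+x. f i x \<partial>std_normal_distribution)"
    by (rule nn_integral_std_gauss_prod) (simp add: f_def)
  also have "\<dots> = (\<Prod>i\<in>UNIV. if i = j then emeasure std_normal_distribution A else 1)"
    using prob_space.emeasure_space_1[OF prob_space_std_normal]
    by (intro prod.cong) (auto simp: f_def)
  finally show "emeasure (distr std_gauss borel (\<lambda>x. x $ j)) A = emeasure std_normal_distribution A"
    by simp
qed simp

text \<open>
  A rotation takes \<open>u\<close> to a coordinate axis, and the coordinates of \<open>std_gauss\<close> are standard normal.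
\<close>

lemma std_gauss_projection:
  fixes u :: "real ^ 'd::finite"
  assumes u: "norm u = 1"
  shows "distr std_gauss borel (\<lambda>x. u \<bullet> x) = std_normal_distribution"
proof -
  fix j :: 'd
  obtain T :: "real ^ 'd \<Rightarrow> real ^ 'd" where T: "orthogonal_transformation T" "T u = axis j 1"
    using orthogonal_transformation_exists_1[of u "axis j 1"] u by auto
  have [measurable]: "T \<in> borel_measurable borel"
    by (rule orthogonal_transformation_measurable[OF T(1)])
  have "u \<bullet> x = T x $ j" for x
    using T by (metis inner_axis inner_commute inner_real_def mult.right_neutral orthogonal_transformation_def)
  then have "distr std_gauss borel (\<lambda>x. u \<bullet> x) = distr (distr std_gauss borel T) borel (\<lambda>x. x $ j)"
    by (subst distr_distr) (auto simp: comp_def cong: distr_cong)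
  then show ?thesis
    by (simp add: std_gauss_orthogonal[OF T(1)] std_gauss_component)
qed

section \<open>Matrices on a set of coordinates and whitening\<close>

text \<open>
  An \<open>S \<times> S\<close> matrix becomes a full square matrix by putting the identity on the remaining coordinates.
  This embedding respects products, transposes and inverses, hence gives access to matrix algebra.
\<close>

definition pad_mat :: "'d set \<Rightarrow> ('d \<Rightarrow> 'd \<Rightarrow> real) \<Rightarrow> real ^ 'd ^ 'd::finite" where
  "pad_mat S A = (\<chi> i j. if i \<in> S \<and> j \<in> S then A i j else of_bool (i = j))"

definition pad_vec :: "'d set \<Rightarrow> ('d \<Rightarrow> real) \<Rightarrow> real ^ 'd::finite" where
  "pad_vec S v = (\<chi> i. if i \<in> S then v i else 0)"

lemma pad_mat_cong:
  "(\<And>i j. i \<in> S \<Longrightarrow> j \<in> S \<Longrightarrow> A i j = B i j) \<Longrightarrow> pad_mat S A = pad_mat S B"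
  by (simp add: pad_mat_def vec_eq_iff)

lemma pad_mat_one: "pad_mat S (\<lambda>i j. of_bool (i = j)) = mat 1"
  by (simp add: pad_mat_def vec_eq_iff mat_def)

lemma pad_mat_mult: "pad_mat S A ** pad_mat S B = pad_mat S (\<lambda>i j. \<Sum>l\<in>S. A i l * B l j)"
proof -
  have "(\<Sum>k\<in>UNIV. (if i \<in> S \<and> k \<in> S then A i k else of_bool (i = k)) *
                   (if k \<in> S \<and> j \<in> S then B k j else of_bool (k = j)))
      = (if i \<in> S \<and> j \<in> S then \<Sum>l\<in>S. A i l * B l j else of_bool (i = j))" for i j
  proof (cases "i \<in> S \<and> j \<in> S")
    case True
    then have "(\<Sum>k\<in>UNIV. (if i \<in> S \<and> k \<in> S then A i k else of_bool (i = k)) *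
                   (if k \<in> S \<and> j \<in> S then B k j else of_bool (k = j))) = (\<Sum>l\<in>S. A i l * B l j)"
      by (intro sum.mono_neutral_cong_right) auto
    with True show ?thesis by simp
  next
    case False
    have "(\<Sum>k\<in>UNIV. (if i \<in> S \<and> k \<in> S then A i k else of_bool (i = k)) *
                   (if k \<in> S \<and> j \<in> S then B k j else of_bool (k = j)))
        = (\<Sum>k\<in>UNIV. if k = j then of_bool (i = j) else 0)"
      if "j \<notin> S" using that by (intro sum.cong) auto
    moreover have "(\<Sum>k\<in>UNIV. (if i \<in> S \<and> k \<in> S then A i k else of_bool (i = k)) *
                   (if k \<in> S \<and> j \<in> S then B k j else of_bool (k = j)))
        = (\<Sum>k\<in>UNIV. if k = i then of_bool (i = j) else 0)"
      if "i \<notin> S" using that by (intro sum.cong) auto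
    ultimately show ?thesis using False by auto
  qed
  then show ?thesis
    by (simp add: pad_mat_def matrix_matrix_mult_def vec_eq_iff)
qed

lemma transpose_pad_mat: "transpose (pad_mat S A) = pad_mat S (\<lambda>i j. A j i)"
  by (auto simp: pad_mat_def transpose_def vec_eq_iff)

lemma pad_mat_mult_component:
  "(pad_mat S A *v x) $ i = (if i \<in> S then \<Sum>j\<in>S. A i j * x $ j else x $ i)"
proof -
  have "(\<Sum>j\<in>UNIV. (if i \<in> S \<and> j \<in> S then A i j else of_bool (i = j)) * x $ j)
      = (\<Sum>j\<in>S. A i j * x $ j)" if "i \<in> S"
    using that by (intro sum.mono_neutral_cong_right) auto
  moreover have "(\<Sum>j\<in>UNIV. (if i \<in> S \<and> j \<in> S then A i j else of_bool (i = j)) * x $ j) = x $ i"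
    if "i \<notin> S"
    using that by (simp add: of_bool_def if_distrib[of "\<lambda>y. y * _"] cong: if_cong)
  ultimately show ?thesis
    by (auto simp: pad_mat_def matrix_vector_mult_def)
qed

lemma pad_mat_mult_pad_vec:
  "pad_mat S A *v pad_vec S v = pad_vec S (\<lambda>i. \<Sum>j\<in>S. A i j * v j)"
  by (simp add: vec_eq_iff pad_mat_mult_component pad_vec_def)

lemma inner_pad_vec: "pad_vec S u \<bullet> x = (\<Sum>i\<in>S. u i * x $ i)"
  unfolding inner_vec_def pad_vec_def by (auto intro!: sum.mono_neutral_cong_right)

lemma norm_pad_vec: "norm (pad_vec S v) = L2_set v S"
proof -
  have "(norm (pad_vec S v))\<^sup>2 = (\<Sum>i\<in>S. (v i)\<^sup>2)"
    unfolding power2_norm_eq_inner inner_pad_vec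
    by (intro sum.cong) (auto simp: pad_vec_def power2_eq_square)
  then show ?thesis
    by (metis L2_set_def norm_ge_zero real_sqrt_unique)
qed

lemma bilin_on_pad: "bilin_on S u A v = pad_vec S u \<bullet> (pad_mat S A *v pad_vec S v)"
proof -
  have "pad_vec S u \<bullet> (pad_mat S A *v pad_vec S v) = (\<Sum>i\<in>S. u i * (\<Sum>j\<in>S. A i j * v j))"
    unfolding pad_mat_mult_pad_vec inner_pad_vec by (simp add: pad_vec_def)
  then show ?thesis
    by (simp add: bilin_on_def sum_distrib_left mult.assoc)
qed

lemma invertible_matrix_inv:
  fixes A :: "real ^ 'd::finite ^ 'd"
  assumes "invertible A"
  shows "A ** matrix_inv A = mat 1" and "matrix_inv A ** A = mat 1"
  using someI_ex[OF assms[unfolded invertible_def]] unfolding matrix_inv_def by auto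

text \<open>
  A kernel vector vanishes outside \<open>S\<close>, where the padded matrix is the identity; on \<open>S\<close> the quadratic
  form then vanishes at it, so definiteness applies.
\<close>

lemma invertible_pad_mat:
  assumes "sym_pos_def_on S C" shows "invertible (pad_mat S C)"
proof -
  have "x = 0" if "pad_mat S C *v x = 0" for x
  proof -
    have out: "x $ i = 0" if "i \<notin> S" for i
      using pad_mat_mult_component[of S C x i] \<open>pad_mat S C *v x = 0\<close> that by simp
    then have x: "x = pad_vec S (($) x)"
      by (simp add: pad_vec_def vec_eq_iff)
    then have "bilin_on S (($) x) C (($) x) = 0"
      using that by (simp add: bilin_on_pad flip: x)
    then have "\<forall>i\<in>S. x $ i = 0"
      using assms unfolding sym_pos_def_on_def by (metis less_irrefl)
    with out show ?thesis by (auto simp: vec_eq_iff)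
  qed
  then show ?thesis
    by (simp add: invertible_left_inverse matrix_left_invertible_ker)
qed

text \<open>
  The block of the full inverse of \<open>pad_mat S C\<close> is a witness for the choice made in \<open>inv_on\<close>.
\<close>

lemma inv_on_inverse:
  assumes "sym_pos_def_on S C"
  shows "pad_mat S C ** pad_mat S (inv_on S C) = mat 1"
proof -
  let ?C = "pad_mat S C"
  define B where "B i j = matrix_inv ?C $ i $ j" for i j
  have inv: "?C ** matrix_inv ?C = mat 1" "matrix_inv ?C ** ?C = mat 1"
    using invertible_pad_mat[OF assms] by (auto simp: invertible_matrix_inv)
  have 1: "(\<Sum>l\<in>S. C i l * B l j) = of_bool (i = j)" if "i \<in> S" "j \<in> S" for i j
  proof -
    have "(\<Sum>l\<in>S. C i l * B l j) = (?C ** matrix_inv ?C) $ i $ j"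
      unfolding matrix_matrix_mult_def using that
      by (auto simp: pad_mat_def B_def intro!: sum.mono_neutral_cong_left)
    then show ?thesis unfolding inv by (simp add: mat_def)
  qed
  have 2: "(\<Sum>l\<in>S. B i l * C l j) = of_bool (i = j)" if "i \<in> S" "j \<in> S" for i j
  proof -
    have "(\<Sum>l\<in>S. B i l * C l j) = (matrix_inv ?C ** ?C) $ i $ j"
      unfolding matrix_matrix_mult_def using that
      by (auto simp: pad_mat_def B_def intro!: sum.mono_neutral_cong_left)
    then show ?thesis unfolding inv by (simp add: mat_def)
  qed
  have "\<forall>i\<in>S. \<forall>j\<in>S. (\<Sum>l\<in>S. C i l * inv_on S C l j) = of_bool (i = j) \<and>
      (\<Sum>l\<in>S. inv_on S C i l * C l j) = of_bool (i = j)"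
    unfolding inv_on_def by (rule someI[of _ B]) (simp add: 1 2)
  then have "pad_mat S (\<lambda>i j. \<Sum>l\<in>S. C i l * inv_on S C l j) = pad_mat S (\<lambda>i j. of_bool (i = j))"
    by (intro pad_mat_cong) auto
  then show ?thesis by (simp add: pad_mat_mult pad_mat_one)
qed

definition factor_on :: "'d set \<Rightarrow> ('d \<Rightarrow> 'd \<Rightarrow> real) \<Rightarrow> ('d \<Rightarrow> 'd \<Rightarrow> real) \<Rightarrow> bool" where
  "factor_on S A C \<longleftrightarrow> (\<forall>i\<in>S. \<forall>j\<in>S. (\<Sum>l\<in>S. A i l * A j l) = C i j)"

lemma factor_on_pad:
  "factor_on S A C \<Longrightarrow> pad_mat S A ** transpose (pad_mat S A) = pad_mat S C"
  by (auto simp: factor_on_def transpose_pad_mat pad_mat_mult intro!: pad_mat_cong)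

text \<open>
  In the coordinates \<open>whiten S A\<close> a Gaussian vector with covariance \<open>A A\<^sup>T\<close> has identity covariance.
\<close>

definition whiten :: "'d set \<Rightarrow> ('d \<Rightarrow> 'd \<Rightarrow> real) \<Rightarrow> ('d \<Rightarrow> real) \<Rightarrow> real ^ 'd::finite" where
  "whiten S A v = matrix_inv (pad_mat S A) *v pad_vec S v"

lemma factor_on_invertible:
  assumes "sym_pos_def_on S C" "factor_on S A C"
  shows "pad_mat S A ** matrix_inv (pad_mat S A) = mat 1"
    and "matrix_inv (pad_mat S A) ** pad_mat S A = mat 1"
proof -
  obtain B where "pad_mat S C ** B = mat 1"
    using invertible_pad_mat[OF assms(1)] unfolding invertible_def by blast
  then have "pad_mat S A ** (transpose (pad_mat S A) ** B) = mat 1"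
    by (simp add: matrix_mul_assoc factor_on_pad[OF assms(2)])
  then have "invertible (pad_mat S A)"
    using invertible_right_inverse by blast
  then show "pad_mat S A ** matrix_inv (pad_mat S A) = mat 1"
    and "matrix_inv (pad_mat S A) ** pad_mat S A = mat 1"
    by (auto simp: invertible_matrix_inv)
qed

text \<open>
  If \<open>C = A A\<^sup>T\<close> and \<open>W\<close> is the inverse of \<open>A\<close>, then the inverse of \<open>C\<close> is \<open>W\<^sup>T W\<close>.
\<close>

lemma pad_inv_on_factor:
  assumes C: "sym_pos_def_on S C" and A: "factor_on S A C"
  shows "pad_mat S (inv_on S C) = transpose (matrix_inv (pad_mat S A)) ** matrix_inv (pad_mat S A)"
proof -
  let ?A = "pad_mat S A" and ?Q = "pad_mat S (inv_on S C)"
  let ?W = "matrix_inv ?A"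
  have "?A ** (transpose ?A ** ?Q) = mat 1"
    by (simp add: matrix_mul_assoc factor_on_pad[OF A] inv_on_inverse[OF C])
  then have "?W ** (?A ** (transpose ?A ** ?Q)) = ?W" by simp
  then have "transpose ?A ** ?Q = ?W"
    by (simp add: matrix_mul_assoc factor_on_invertible[OF C A])
  then have "transpose ?W ** (transpose ?A ** ?Q) = transpose ?W ** ?W" by simp
  moreover have "transpose ?W ** transpose ?A = mat 1"
    by (simp add: factor_on_invertible[OF C A] flip: matrix_transpose_mul)
  ultimately show ?thesis by (simp add: matrix_mul_assoc)
qed

lemma inner_transpose_mult: "u \<bullet> (transpose W *v z) = (W *v u) \<bullet> (z :: real ^ 'd::finite)"
  by (metis dot_lmul_matrix vector_transpose_matrix)

lemma bilin_inv_whiten: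
  assumes C: "sym_pos_def_on S C" and A: "factor_on S A C"
  shows "bilin_on S u (inv_on S C) v = whiten S A u \<bullet> whiten S A v"
  unfolding bilin_on_pad pad_inv_on_factor[OF C A] whiten_def matrix_vector_mul_assoc[symmetric]
    inner_transpose_mult ..

lemma pad_mat_mult_whiten:
  assumes C: "sym_pos_def_on S C" and A: "factor_on S A C"
  shows "pad_mat S A *v whiten S A v = pad_vec S v"
  by (simp add: whiten_def matrix_vector_mul_assoc factor_on_invertible[OF C A])

lemma whiten_outside:
  assumes C: "sym_pos_def_on S C" and A: "factor_on S A C" and "i \<notin> S"
  shows "whiten S A v $ i = 0"
proof -
  have "(pad_mat S A *v whiten S A v) $ i = 0"
    using assms by (simp add: pad_mat_mult_whiten pad_vec_def)
  then show ?thesis using \<open>i \<notin> S\<close> by (simp add: pad_mat_mult_component)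
qed

lemma whiten_component:
  "whiten S A v $ l = (\<Sum>j\<in>S. matrix_inv (pad_mat S A) $ l $ j * v j)"
  unfolding whiten_def matrix_vector_mult_def pad_vec_def
  by (simp add: if_distrib cong: if_cong) (intro sum.mono_neutral_cong_right, auto)

lemma norm_whiten:
  assumes "sym_pos_def_on S C" "factor_on S A C"
  shows "norm (whiten S A v) = L2_set (\<lambda>l. whiten S A v $ l) S"
proof -
  have "norm (whiten S A v) = sqrt (\<Sum>l\<in>UNIV. (whiten S A v $ l)\<^sup>2)"
    by (simp add: norm_vec_def L2_set_def)
  also have "(\<Sum>l\<in>UNIV. (whiten S A v $ l)\<^sup>2) = (\<Sum>l\<in>S. (whiten S A v $ l)\<^sup>2)"
    by (intro sum.mono_neutral_right) (auto simp: whiten_outside[OF assms])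
  finally show ?thesis by (simp add: L2_set_def)
qed

lemma pad_vec_diff: "pad_vec S (\<lambda>i. u i - v i) = pad_vec S u - pad_vec S v"
  and pad_vec_add: "pad_vec S (\<lambda>i. u i + v i) = pad_vec S u + pad_vec S v"
  and pad_vec_scale: "pad_vec S (\<lambda>i. c * v i) = c *\<^sub>R pad_vec S v"
  by (simp_all add: pad_vec_def vec_eq_iff)

lemma whiten_diff: "whiten S A (\<lambda>i. u i - v i) = whiten S A u - whiten S A v"
  and whiten_add: "whiten S A (\<lambda>i. u i + v i) = whiten S A u + whiten S A v"
  and whiten_scale: "whiten S A (\<lambda>i. c * v i) = c *\<^sub>R whiten S A v"
  by (simp_all add: whiten_def pad_vec_diff pad_vec_add pad_vec_scale matrix_vector_mult_diff_distrib
      matrix_vector_right_distrib scaleR_matrix_vector_assoc matrix_scaleR_vector_ac)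

text \<open>
  Near \<open>t = 0\<close> the linear term dominates and changes sign; \<open>t = -g/(\<bar>h\<bar> + 1)\<close> is small enough.
\<close>

lemma linear_term_vanishes:
  fixes g h :: real
  assumes "\<And>t. 0 \<le> 2 * t * g + t\<^sup>2 * h" shows "g = 0"
proof (rule ccontr)
  assume "g \<noteq> 0"
  define s where "s = 1 / (\<bar>h\<bar> + 1)"
  have s: "s > 0" "s * h < 1" by (auto simp: s_def field_simps)
  have "0 \<le> 2 * (- g * s) * g + (- g * s)\<^sup>2 * h" by (rule assms)
  also have "\<dots> = g\<^sup>2 * s * (s * h - 2)" by (simp add: power2_eq_square algebra_simps)
  also have "\<dots> < 0" using s \<open>g \<noteq> 0\<close> by (intro mult_pos_neg) auto
  finally show False by simp
qed

text \<open>
  The quadratic form attains its minimum \<open>l\<close> on the unit sphere of the vectors supported on \<open>S\<close>.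
  By homogeneity, \<open>l\<close> times the squared norm is a lower bound for the form everywhere, so the difference is
  stationary at the minimiser, which makes the minimiser an eigenvector for \<open>l\<close>.
  Every eigenvalue is the value of the Rayleigh quotient at its eigenvector and so is at least \<open>l\<close>.
  In particular the least eigenvalue exists.
\<close>

lemma lambda_min_on_rayleigh:
  fixes C :: "'d::finite \<Rightarrow> 'd \<Rightarrow> real"
  assumes C: "sym_pos_def_on S C" and S: "S \<noteq> {}"
  shows "lambda_min_on S C > 0"
    and "lambda_min_on S C * (\<Sum>i\<in>S. (v i)\<^sup>2) \<le> bilin_on S v C v"
proof -
  have sym: "C i j = C j i" if "i \<in> S" "j \<in> S" for i j
    using C that by (simp add: sym_pos_def_on_def)
  define q where "q x = bilin_on S (($) x) C (($) x)" for x :: "real ^ 'd"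
  define K where "K = {x :: real ^ 'd. norm x = 1 \<and> (\<forall>i. i \<notin> S \<longrightarrow> x $ i = 0)}"
  have "K = sphere 0 1 \<inter> (\<Inter>i\<in>-S. {x. x $ i = 0})"
    by (auto simp: K_def)
  moreover have "closed (\<Inter>i\<in>-S. {x :: real ^ 'd. x $ i = 0})"
    by (intro closed_INT ballI closed_Collect_eq continuous_intros)
  ultimately have "compact K"
    by (metis compact_Int_closed compact_sphere)
  moreover obtain s where "s \<in> S" using S by blast
  then have "axis s 1 \<in> K"
    by (auto simp: K_def) (auto simp: axis_def)
  moreover have "continuous_on K q"
    unfolding q_def bilin_on_def by (intro continuous_intros)
  ultimately obtain x0 where x0: "x0 \<in> K" and min: "\<And>x. x \<in> K \<Longrightarrow> q x0 \<le> q x"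
    using continuous_attains_inf[of K q] by blast
  define l where "l = q x0"
  have ray: "l * (\<Sum>i\<in>S. (v i)\<^sup>2) \<le> bilin_on S v C v" for v
  proof (cases "\<forall>i\<in>S. v i = 0")
    case True
    then show ?thesis by (simp add: bilin_on_def)
  next
    case False
    define r where "r = norm (pad_vec S v)"
    have r2: "r\<^sup>2 = (\<Sum>i\<in>S. (v i)\<^sup>2)"
      by (simp add: r_def norm_pad_vec L2_set_def sum_nonneg)
    have "pad_vec S v \<noteq> 0" using False by (auto simp: pad_vec_def vec_eq_iff)
    then have r: "r > 0" by (simp add: r_def)
    have "(1 / r) *\<^sub>R pad_vec S v \<in> K"
      using r by (auto simp: K_def pad_vec_def simp flip: r_def[unfolded pad_vec_def])
    then have "l \<le> q ((1 / r) *\<^sub>R pad_vec S v)" unfolding l_def by (rule min)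
    also have "\<dots> = bilin_on S v C v / r\<^sup>2"
      unfolding q_def bilin_on_def sum_divide_distrib
      by (auto intro!: sum.cong simp: pad_vec_def power2_eq_square)
    finally show ?thesis
      using r by (simp add: r2[symmetric] field_simps)
  qed
  have nz: "\<exists>i\<in>S. x0 $ i \<noteq> 0"
  proof (rule ccontr)
    assume "\<not> ?thesis"
    then have "x0 = 0" using x0 by (auto simp: K_def vec_eq_iff)
    then show False using x0 by (simp add: K_def)
  qed
  have norm1: "(\<Sum>i\<in>S. (x0 $ i)\<^sup>2) = 1"
  proof -
    have "pad_vec S (($) x0) = x0" using x0 by (auto simp: K_def pad_vec_def vec_eq_iff)
    then have "L2_set (($) x0) S = 1" using norm_pad_vec[of S "($) x0"] x0 by (simp add: K_def)
    then show ?thesis by (simp add: L2_set_def)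
  qed
  have "l > 0"
    using C nz unfolding l_def q_def sym_pos_def_on_def by blast
  \<comment> \<open>The residual of the eigenvalue equation is used as direction of variation.\<close>
  define w where "w i = (\<Sum>j\<in>S. C i j * x0 $ j) - l * x0 $ i" for i
  have "0 \<le> 2 * t * (\<Sum>i\<in>S. (w i)\<^sup>2) + t\<^sup>2 * (bilin_on S w C w - l * (\<Sum>i\<in>S. (w i)\<^sup>2))" for t
  proof -
    have cross: "bilin_on S (($) x0) C w = bilin_on S w C (($) x0)"
      unfolding bilin_on_def
      by (subst sum.swap) (auto intro!: sum.cong simp: sym)
    have b: "bilin_on S (\<lambda>i. x0 $ i + t * w i) C (\<lambda>i. x0 $ i + t * w i)
        = l + 2 * t * bilin_on S w C (($) x0) + t\<^sup>2 * bilin_on S w C w"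
    proof -
      have "bilin_on S (\<lambda>i. x0 $ i + t * w i) C (\<lambda>i. x0 $ i + t * w i)
          = bilin_on S (($) x0) C (($) x0) + t * bilin_on S (($) x0) C w
            + t * bilin_on S w C (($) x0) + t\<^sup>2 * bilin_on S w C w"
        unfolding bilin_on_def
        by (simp add: algebra_simps sum.distrib sum_distrib_left power2_eq_square)
      then show ?thesis by (simp add: cross l_def q_def)
    qed
    have s: "(\<Sum>i\<in>S. (x0 $ i + t * w i)\<^sup>2)
        = 1 + 2 * t * (\<Sum>i\<in>S. w i * x0 $ i) + t\<^sup>2 * (\<Sum>i\<in>S. (w i)\<^sup>2)"
      unfolding norm1[symmetric]
      by (simp add: algebra_simps sum.distrib sum_distrib_left power2_eq_square)
    have d: "bilin_on S w C (($) x0) - l * (\<Sum>i\<in>S. w i * x0 $ i) = (\<Sum>i\<in>S. (w i)\<^sup>2)"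
    proof -
      have "bilin_on S w C (($) x0) = (\<Sum>i\<in>S. w i * (\<Sum>j\<in>S. C i j * x0 $ j))"
        unfolding bilin_on_def sum_distrib_left by (simp add: mult.assoc)
      then have "bilin_on S w C (($) x0) - l * (\<Sum>i\<in>S. w i * x0 $ i)
          = (\<Sum>i\<in>S. w i * ((\<Sum>j\<in>S. C i j * x0 $ j) - l * x0 $ i))"
        by (simp only: right_diff_distrib sum_subtractf sum_distrib_left mult.left_commute)
      then show ?thesis
        by (simp add: power2_eq_square flip: w_def)
    qed
    have "0 \<le> bilin_on S (\<lambda>i. x0 $ i + t * w i) C (\<lambda>i. x0 $ i + t * w i) - l * (\<Sum>i\<in>S. (x0 $ i + t * w i)\<^sup>2)"
      using ray[of "\<lambda>i. x0 $ i + t * w i"] by simp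
    also have "\<dots> = 2 * t * (bilin_on S w C (($) x0) - l * (\<Sum>i\<in>S. w i * x0 $ i))
        + t\<^sup>2 * (bilin_on S w C w - l * (\<Sum>i\<in>S. (w i)\<^sup>2))"
      unfolding b s by (simp add: algebra_simps)
    finally show ?thesis unfolding d .
  qed
  then have "(\<Sum>i\<in>S. (w i)\<^sup>2) = 0" by (rule linear_term_vanishes)
  then have "w i = 0" if "i \<in> S" for i
    using that by (simp add: sum_nonneg_eq_0_iff)
  then have ev: "\<forall>i\<in>S. (\<Sum>j\<in>S. C i j * x0 $ j) = l * x0 $ i"
    by (simp add: w_def)
  have eig: "eigenvalue_on S C l"
    unfolding eigenvalue_on_def by (intro exI[of _ "($) x0"] conjI nz ev)
  have least: "l \<le> l'" if ev': "eigenvalue_on S C l'" for l'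
  proof -
    obtain u where u: "\<exists>i\<in>S. u i \<noteq> 0" "\<forall>i\<in>S. (\<Sum>j\<in>S. C i j * u j) = l' * u i"
      using ev' unfolding eigenvalue_on_def by blast
    have "bilin_on S u C u = (\<Sum>i\<in>S. u i * (\<Sum>j\<in>S. C i j * u j))"
      unfolding bilin_on_def sum_distrib_left by (simp add: mult.assoc)
    also have "\<dots> = (\<Sum>i\<in>S. u i * (l' * u i))"
      using u(2) by (intro sum.cong) auto
    also have "\<dots> = l' * (\<Sum>i\<in>S. (u i)\<^sup>2)"
      by (simp add: sum_distrib_left power2_eq_square mult.left_commute)
    finally have "l * (\<Sum>i\<in>S. (u i)\<^sup>2) \<le> l' * (\<Sum>i\<in>S. (u i)\<^sup>2)"
      using ray[of u] by simp
    moreover have "(\<Sum>i\<in>S. (u i)\<^sup>2) > 0"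
    proof -
      obtain i where "i \<in> S" "u i \<noteq> 0" using u(1) by blast
      then show ?thesis by (intro sum_pos2[of S i]) auto
    qed
    ultimately show ?thesis by simp
  qed
  have "lambda_min_on S C = l"
    unfolding lambda_min_on_def by (intro Least_equality eig least)
  with \<open>l > 0\<close> ray[of v] show "lambda_min_on S C > 0"
    and "lambda_min_on S C * (\<Sum>i\<in>S. (v i)\<^sup>2) \<le> bilin_on S v C v"
    by simp_all
qed

text \<open>
  Write \<open>y\<close> for the whitened \<open>v\<close> and \<open>w\<close> for the inverse of \<open>C\<close> applied to \<open>v\<close>. The squared norm of
  \<open>y\<close> equals both the form of \<open>C\<close> at \<open>w\<close>, which is at least \<open>\<lambda> |w|\<^sup>2\<close>, and the inner product of \<open>v\<close> and \<open>w\<close>,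
  which is at most \<open>|v| |w|\<close>. Eliminating \<open>|w|\<close> gives the bound.
  For empty \<open>S\<close> both sides are \<open>0\<close>, whatever the value of \<open>lambda_min_on\<close>.
\<close>

lemma norm_whiten_le:
  assumes C: "sym_pos_def_on S C" and A: "factor_on S A C"
  shows "norm (whiten S A v) \<le> L2_set v S / sqrt (lambda_min_on S C)"
proof (cases "S = {}")
  case True
  then show ?thesis by (simp add: whiten_def pad_vec_def zero_vec_def[symmetric])
next
  case False
  let ?A = "pad_mat S A" and ?l = "lambda_min_on S C"
  let ?W = "matrix_inv ?A"
  define y where "y = whiten S A v"
  define w where "w = transpose ?W *v y"
  have l: "?l > 0" by (rule lambda_min_on_rayleigh[OF C False])
  have w: "w = pad_mat S (inv_on S C) *v pad_vec S v"
    by (simp add: w_def y_def whiten_def pad_inv_on_factor[OF C A] matrix_vector_mul_assoc)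
  define u where "u = (\<lambda>i. \<Sum>j\<in>S. inv_on S C i j * v j)"
  have wu: "w = pad_vec S u"
    unfolding w u_def by (rule pad_mat_mult_pad_vec)
  have "transpose ?A *v w = y"
    unfolding w_def matrix_vector_mul_assoc matrix_transpose_mul[symmetric] factor_on_invertible[OF C A]
    by (simp add: transpose_mat)
  then have "bilin_on S u C u = (norm y)\<^sup>2"
    unfolding bilin_on_pad wu[symmetric] factor_on_pad[OF A, symmetric] matrix_vector_mul_assoc[symmetric]
    by (metis inner_transpose_mult power2_norm_eq_inner transpose_transpose)
  moreover have "(\<Sum>i\<in>S. (u i)\<^sup>2) = (norm w)\<^sup>2"
    by (simp add: wu norm_pad_vec L2_set_def sum_nonneg)
  ultimately have "?l * (norm w)\<^sup>2 \<le> (norm y)\<^sup>2"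
    using lambda_min_on_rayleigh(2)[OF C False, of u] by simp
  then have "sqrt (?l * (norm w)\<^sup>2) \<le> sqrt ((norm y)\<^sup>2)" by (rule real_sqrt_le_mono)
  then have wy: "sqrt ?l * norm w \<le> norm y"
    by (simp add: real_sqrt_mult)
  have "(norm y)\<^sup>2 = pad_vec S v \<bullet> w"
    unfolding w_def inner_transpose_mult by (simp add: y_def whiten_def power2_norm_eq_inner)
  also have "\<dots> \<le> L2_set v S * norm w"
    using norm_cauchy_schwarz[of "pad_vec S v" w] by (simp add: norm_pad_vec)
  finally have "sqrt ?l * (norm y)\<^sup>2 \<le> L2_set v S * (sqrt ?l * norm w)"
    using l mult_left_mono[of "(norm y)\<^sup>2" _ "sqrt ?l"] by (simp add: algebra_simps)
  also have "\<dots> \<le> L2_set v S * norm y"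
    using wy by (rule mult_left_mono) simp
  finally have "norm y * (sqrt ?l * norm y) \<le> norm y * L2_set v S"
    by (simp add: power2_eq_square algebra_simps)
  then have "sqrt ?l * norm y \<le> L2_set v S"
    by (cases "norm y = 0") (auto simp: mult_le_cancel_left)
  then show ?thesis
    using l by (simp add: y_def field_simps)
qed

section \<open>Testing and linear discriminant analysis for standard Gaussians\<close>

definition Phi :: "real \<Rightarrow> real" where
  "Phi t = measure std_normal_distribution {..t}"

lemma emeasure_std_normal_le:
  assumes "a \<le> b"
  shows "emeasure std_normal_distribution {a<..b} \<le> ennreal ((b - a) / sqrt (2 * pi))"
proof -
  have "emeasure std_normal_distribution {a<..b}
      = (\<integral>\<^sup>+x. ennreal (std_normal_density x) * indicator {a<..b} x \<partial>lborel)"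
    by (subst emeasure_density) auto
  also have "\<dots> \<le> (\<integral>\<^sup>+x. ennreal (1 / sqrt (2 * pi)) * indicator {a<..b} x \<partial>lborel)"
    by (intro nn_integral_mono mult_right_mono ennreal_leI) (auto simp: std_normal_density_def divide_right_mono)
  also have "\<dots> = ennreal (1 / sqrt (2 * pi)) * ennreal (b - a)"
    using assms by (subst nn_integral_cmult_indicator) auto
  also have "\<dots> = ennreal ((b - a) / sqrt (2 * pi))"
    using assms by (simp add: ennreal_mult'' [symmetric])
  finally show ?thesis .
qed

text \<open>
  The standard normal density never exceeds \<open>1/\<surd>(2\<pi>)\<close>.
\<close>

lemma Phi_lipschitz:
  assumes "s \<le> t + e" "e \<ge> 0"
  shows "Phi s \<le> Phi t + e / sqrt (2 * pi)"
proof -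
  interpret N: prob_space std_normal_distribution by (rule prob_space_std_normal)
  have "Phi s \<le> Phi (t + e)"
    unfolding Phi_def using assms by (intro N.finite_measure_mono) auto
  also have "{..t + e} = {..t} \<union> {t<..t + e}" using assms by auto
  then have "Phi (t + e) = Phi t + measure std_normal_distribution {t<..t + e}"
    unfolding Phi_def by (subst N.finite_measure_Union[symmetric]) auto
  also have "measure std_normal_distribution {t<..t + e} \<le> (t + e - t) / sqrt (2 * pi)"
    using emeasure_std_normal_le[of t "t + e"] assms
    by (simp add: N.emeasure_eq_measure)
  finally show ?thesis by simp
qed

lemma std_gauss_halfspace:
  fixes w :: "real ^ 'd::finite"
  assumes w: "w \<noteq> 0"
  shows "measure std_gauss {x. w \<bullet> x \<le> t} = Phi (t / norm w)"
    and "measure std_gauss {x. w \<bullet> x < t} = Phi (t / norm w)"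
    and "measure std_gauss {x. t \<le> w \<bullet> x} = Phi (- t / norm w)"
proof -
  have le: "measure std_gauss {x. w \<bullet> x \<le> t} = Phi (t / norm w)" if "w \<noteq> 0" for w :: "real ^ 'd" and t
  proof -
    let ?u = "(1 / norm w) *\<^sub>R w"
    have "{x. w \<bullet> x \<le> t} = (\<lambda>x. ?u \<bullet> x) -` {..t / norm w} \<inter> space std_gauss"
      using that by (auto simp: divide_right_mono divide_le_cancel)
    then have "measure std_gauss {x. w \<bullet> x \<le> t} = measure (distr std_gauss borel (\<lambda>x. ?u \<bullet> x)) {..t / norm w}"
      by (subst measure_distr) (auto simp del: inner_scaleR_left)
    then show ?thesis
      using std_gauss_projection[of ?u] that by (simp add: Phi_def)
  qed
  show "measure std_gauss {x. w \<bullet> x \<le> t} = Phi (t / norm w)" by (rule le[OF w])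
  have "{x. t \<le> w \<bullet> x} = {x. (- w) \<bullet> x \<le> - t}" by auto
  then show "measure std_gauss {x. t \<le> w \<bullet> x} = Phi (- t / norm w)"
    using le[of "- w" "- t"] w by simp
  \<comment> \<open>The boundary carries no mass: by the Lipschitz bound, slightly smaller closed half-spaces almost exhaust the mass.\<close>
  have sub: "Phi s \<le> measure std_gauss {x. w \<bullet> x < t} + e" if "s = t / norm w" "e > 0" for s e
  proof -
    define r where "r = norm w * e * sqrt (2 * pi)"
    have "r > 0" using w that by (simp add: r_def)
    have "Phi s \<le> Phi ((t - r) / norm w) + (r / norm w) / sqrt (2 * pi)"
      using w \<open>r > 0\<close> by (intro Phi_lipschitz) (auto simp: that diff_divide_distrib)
    also have "Phi ((t - r) / norm w) = measure std_gauss {x. w \<bullet> x \<le> t - r}"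
      by (rule le[OF w, symmetric])
    also have "\<dots> \<le> measure std_gauss {x. w \<bullet> x < t}"
      using \<open>r > 0\<close> by (intro std_gauss.finite_measure_mono) auto
    also have "(r / norm w) / sqrt (2 * pi) = e" using w by (simp add: r_def)
    finally show ?thesis by simp
  qed
  have "measure std_gauss {x. w \<bullet> x < t} \<le> measure std_gauss {x. w \<bullet> x \<le> t}"
    by (intro std_gauss.finite_measure_mono) auto
  moreover have "Phi (t / norm w) \<le> measure std_gauss {x. w \<bullet> x < t}"
    by (rule field_le_epsilon) (rule sub[OF refl])
  ultimately show "measure std_gauss {x. w \<bullet> x < t} = Phi (t / norm w)"
    by (simp add: le[OF w])
qed

lemma Phi_0: "Phi 0 = 1 / 2"
proof -
  let ?w = "axis undefined 1 :: real ^ 1"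
  have w: "?w \<noteq> 0" by (simp add: axis_eq_0_iff)
  have "{x. 0 \<le> ?w \<bullet> x} = space std_gauss - {x. ?w \<bullet> x < 0}" by auto
  then have "measure std_gauss {x. 0 \<le> ?w \<bullet> x} = 1 - measure std_gauss {x. ?w \<bullet> x < 0}"
    using std_gauss.prob_compl[of "{x. ?w \<bullet> x < 0}"] by simp
  then show ?thesis
    unfolding std_gauss_halfspace[OF w] by simp
qed

text \<open>
  The Neyman-Pearson argument for the centres \<open>0\<close> and \<open>\<theta>\<close>: the sum of the two error probabilities integrates
  the density around \<open>0\<close> over \<open>T\<close> and the density around \<open>\<theta>\<close> over the complement. It is smallest if
  \<open>T\<close> is the set where the former is the smaller one, which for \<open>\<theta> \<noteq> 0\<close> is the half-space \<open>H\<close> of the points that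
  are no farther from \<open>\<theta>\<close> than from \<open>0\<close>.
\<close>

lemma std_gauss_testing:
  fixes \<theta> :: "real ^ 'd::finite"
  assumes [measurable]: "T \<in> sets borel"
  shows "2 * Phi (- norm \<theta> / 2) \<le> measure std_gauss T + measure std_gauss {x. \<theta> + x \<notin> T}"
proof -
  let ?g = "\<lambda>x::real ^ 'd. ennreal (std_gauss_density x)"
  define e where "e B = (\<integral>\<^sup>+x. ?g x * indicator B x + ?g (- \<theta> + x) * indicator (- B) x \<partial>lborel)" for B
  have e: "e B = ennreal (measure std_gauss B + measure std_gauss {x. \<theta> + x \<notin> B})"
    if [measurable]: "B \<in> sets borel" for B
  proof -
    have "e B = (\<integral>\<^sup>+x. ?g x * indicator B x \<partial>lborel) + (\<integral>\<^sup>+x. ?g (- \<theta> + x) * indicator (- B) x \<partial>lborel)"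
      unfolding e_def by (rule nn_integral_add) measurable
    also have "(\<integral>\<^sup>+x. ?g (- \<theta> + x) * indicator (- B) x \<partial>lborel)
        = (\<integral>\<^sup>+x. ?g (- \<theta> + (\<theta> + x)) * indicator (- B) (\<theta> + x) \<partial>lborel)"
      by (rule nn_integral_lborel_translate[symmetric]) measurable
    also have "\<dots> = (\<integral>\<^sup>+x. ?g x * indicator {x. \<theta> + x \<notin> B} x \<partial>lborel)"
      by (intro nn_integral_cong) (auto simp: indicator_def)
    also have "\<dots> = emeasure std_gauss {x. \<theta> + x \<notin> B}"
      unfolding std_gauss_def by (subst emeasure_density) auto
    also have "(\<integral>\<^sup>+x. ?g x * indicator B x \<partial>lborel) = emeasure std_gauss B"
      unfolding std_gauss_def by (subst emeasure_density) auto
    finally show ?thesis by (simp add: std_gauss.emeasure_eq_measure)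
  qed
  define H where "H = {x. (norm \<theta>)\<^sup>2 / 2 \<le> \<theta> \<bullet> x}"
  have [measurable]: "H \<in> sets borel" unfolding H_def by measurable
  have H: "x \<in> H \<longleftrightarrow> std_gauss_density x \<le> std_gauss_density (- \<theta> + x)" for x
  proof -
    have "(norm (- \<theta> + x))\<^sup>2 = (norm x)\<^sup>2 - 2 * (\<theta> \<bullet> x) + (norm \<theta>)\<^sup>2"
      by (simp add: power2_norm_eq_inner inner_commute algebra_simps)
    then show ?thesis by (auto simp: H_def std_gauss_density_norm)
  qed
  have "e H \<le> e T"
    unfolding e_def
  proof (rule nn_integral_mono)
    fix x
    show "?g x * indicator H x + ?g (- \<theta> + x) * indicator (- H) x
        \<le> ?g x * indicator T x + ?g (- \<theta> + x) * indicator (- T) x"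
      using H[of x] by (cases "x \<in> H"; cases "x \<in> T") (auto intro: ennreal_leI)
  qed
  then have HT: "measure std_gauss H + measure std_gauss {x. \<theta> + x \<notin> H}
      \<le> measure std_gauss T + measure std_gauss {x. \<theta> + x \<notin> T}"
    by (simp add: e del: ennreal_plus)
  have "measure std_gauss H + measure std_gauss {x. \<theta> + x \<notin> H} = 2 * Phi (- norm \<theta> / 2)"
  proof (cases "\<theta> = 0")
    case True
    then show ?thesis using std_gauss.prob_space by (simp add: H_def Phi_0)
  next
    case False
    have "{x. \<theta> + x \<notin> H} = {x. \<theta> \<bullet> x < - (norm \<theta>)\<^sup>2 / 2}"
      by (auto simp: H_def inner_add_right power2_norm_eq_inner)
    then have "measure std_gauss {x. \<theta> + x \<notin> H} = Phi (- (norm \<theta>)\<^sup>2 / 2 / norm \<theta>)"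
      by (simp only: std_gauss_halfspace[OF False])
    moreover have "measure std_gauss H = Phi (- ((norm \<theta>)\<^sup>2 / 2) / norm \<theta>)"
      unfolding H_def by (simp only: std_gauss_halfspace[OF False])
    ultimately show ?thesis
      using False by (simp add: power2_eq_square)
  qed
  with HT show ?thesis by simp
qed

text \<open>
  Both error events are half-spaces with normal \<open>u\<close>. If the estimates \<open>a\<close>, \<open>b\<close> were the true centres,
  both would have mass \<open>\<Phi>(-|u|/2)\<close>. Replacing the centre \<open>\<alpha>\<close> or \<open>\<beta>\<close> by its estimate shifts the
  corresponding margin by at most its error, and \<open>|u|\<close> differs from \<open>|\<alpha> - \<beta>|\<close> by at most
  the sum of the two errors. For \<open>u = 0\<close> the rule is constant and the errors add up to \<open>1 = 2 \<Phi>(0)\<close>.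
\<close>

lemma std_gauss_lda:
  fixes \<alpha> \<beta> a b :: "real ^ 'd::finite"
  defines "u \<equiv> a - b" and "c \<equiv> (1 / 2) *\<^sub>R (a + b)"
  shows "measure std_gauss {x. u \<bullet> (\<alpha> + x - c) < 0} + measure std_gauss {x. 0 \<le> u \<bullet> (\<beta> + x - c)}
    \<le> 2 * Phi (- norm (\<alpha> - \<beta>) / 2) + 2 * (norm (a - \<alpha>) + norm (b - \<beta>)) / sqrt (2 * pi)"
proof -
  define ea where "ea = norm (a - \<alpha>)"
  define eb where "eb = norm (b - \<beta>)"
  define \<delta> where "\<delta> = norm (\<alpha> - \<beta>)"
  have eq: "\<alpha> - \<beta> = u + (b - \<beta>) - (a - \<alpha>)" by (simp add: u_def)
  have \<delta>: "\<delta> \<le> norm u + eb + ea"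
    using norm_triangle_ineq4[of "u + (b - \<beta>)" "a - \<alpha>"] norm_triangle_ineq[of u "b - \<beta>"]
    unfolding \<delta>_def ea_def eb_def eq by linarith
  have nn: "ea \<ge> 0" "eb \<ge> 0" by (simp_all add: ea_def eb_def)
  show ?thesis
  proof (cases "u = 0")
    case True
    have "Phi 0 \<le> Phi (- \<delta> / 2) + ((ea + eb) / 2) / sqrt (2 * pi)"
      using \<delta> nn True by (intro Phi_lipschitz) auto
    moreover have "((ea + eb) / 2) / sqrt (2 * pi) = (ea + eb) / sqrt (2 * pi) / 2"
      by simp
    moreover have "(ea + eb) / sqrt (2 * pi) \<ge> 0"
      using nn by simp
    ultimately have "1 \<le> 2 * Phi (- \<delta> / 2) + 2 * ((ea + eb) / sqrt (2 * pi))"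
      unfolding Phi_0 by linarith
    then have "1 \<le> 2 * Phi (- \<delta> / 2) + 2 * (ea + eb) / sqrt (2 * pi)"
      by (simp only: times_divide_eq_right)
    moreover have "measure std_gauss {x. u \<bullet> (\<alpha> + x - c) < 0}
        + measure std_gauss {x. 0 \<le> u \<bullet> (\<beta> + x - c)} = 1"
      using True std_gauss.prob_space by simp
    ultimately show ?thesis
      by (simp only: \<delta>_def ea_def eb_def)
  next
    case False
    then have u: "norm u > 0" by simp
    have *: "\<bar>u \<bullet> (a - \<alpha>)\<bar> \<le> norm u * ea" "\<bar>u \<bullet> (b - \<beta>)\<bar> \<le> norm u * eb"
      unfolding ea_def eb_def by (rule Cauchy_Schwarz_ineq2)+
    have "a - c = (1 / 2) *\<^sub>R u" "b - c = - (1 / 2) *\<^sub>R u"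
      by (simp_all add: c_def u_def vec_eq_iff field_simps)
    then have **: "u \<bullet> (a - c) = norm u * norm u / 2" "u \<bullet> (b - c) = - (norm u * norm u / 2)"
      by (simp_all add: norm_eq_square power2_norm_eq_inner[symmetric] power2_eq_square)
    have "{x. u \<bullet> (\<alpha> + x - c) < 0} = {x. u \<bullet> x < - (u \<bullet> (\<alpha> - c))}"
      by (auto simp: algebra_simps)
    then have "measure std_gauss {x. u \<bullet> (\<alpha> + x - c) < 0} = Phi (- (u \<bullet> (\<alpha> - c)) / norm u)"
      by (simp only: std_gauss_halfspace[OF False])
    also have "\<dots> \<le> Phi (- \<delta> / 2) + ((ea + eb) / 2 + ea) / sqrt (2 * pi)"
    proof (intro Phi_lipschitz)
      have "u \<bullet> (\<alpha> - c) = u \<bullet> (a - c) - u \<bullet> (a - \<alpha>)" by (simp add: inner_diff_right)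
      then have "- (u \<bullet> (\<alpha> - c)) \<le> norm u * (ea - norm u / 2)"
        using * ** by (simp add: algebra_simps)
      then have "- (u \<bullet> (\<alpha> - c)) / norm u \<le> ea - norm u / 2"
        using u by (simp add: field_simps)
      then show "- (u \<bullet> (\<alpha> - c)) / norm u \<le> - \<delta> / 2 + ((ea + eb) / 2 + ea)"
        using \<delta> by argo
    qed (use nn in simp)
    finally have 1: "measure std_gauss {x. u \<bullet> (\<alpha> + x - c) < 0}
        \<le> Phi (- \<delta> / 2) + ((ea + eb) / 2 + ea) / sqrt (2 * pi)" .
    have "{x. 0 \<le> u \<bullet> (\<beta> + x - c)} = {x. - (u \<bullet> (\<beta> - c)) \<le> u \<bullet> x}"
      by (auto simp: algebra_simps)
    then have "measure std_gauss {x. 0 \<le> u \<bullet> (\<beta> + x - c)} = Phi (- (- (u \<bullet> (\<beta> - c))) / norm u)"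
      by (simp only: std_gauss_halfspace[OF False])
    also have "\<dots> \<le> Phi (- \<delta> / 2) + ((ea + eb) / 2 + eb) / sqrt (2 * pi)"
    proof (intro Phi_lipschitz)
      have "u \<bullet> (\<beta> - c) = u \<bullet> (b - c) - u \<bullet> (b - \<beta>)" by (simp add: inner_diff_right)
      then have "u \<bullet> (\<beta> - c) \<le> norm u * (eb - norm u / 2)"
        using * ** by (simp add: algebra_simps)
      then have "u \<bullet> (\<beta> - c) / norm u \<le> eb - norm u / 2"
        using u by (simp add: field_simps)
      then show "- (- (u \<bullet> (\<beta> - c))) / norm u \<le> - \<delta> / 2 + ((ea + eb) / 2 + eb)"
        using \<delta> by argo
    qed (use nn in simp)
    finally have 2: "measure std_gauss {x. 0 \<le> u \<bullet> (\<beta> + x - c)}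
        \<le> Phi (- \<delta> / 2) + ((ea + eb) / 2 + eb) / sqrt (2 * pi)" .
    have "((ea + eb) / 2 + ea) / sqrt (2 * pi) + ((ea + eb) / 2 + eb) / sqrt (2 * pi)
        = 2 * (ea + eb) / sqrt (2 * pi)"
      by (simp add: add_divide_distrib[symmetric] field_simps)
    with 1 2 show ?thesis
      by (simp add: \<delta>_def ea_def eb_def)
  qed
qed

section \<open>Gaussian laws on a set of coordinates\<close>

definition gauss_map :: "'d set \<Rightarrow> ('d \<Rightarrow> 'd \<Rightarrow> real) \<Rightarrow> ('d \<Rightarrow> real) \<Rightarrow> real ^ 'd \<Rightarrow> ('d::finite \<Rightarrow> real)" where
  "gauss_map S A \<mu> \<xi> = (\<lambda>i\<in>S. \<mu> i + (pad_mat S A *v \<xi>) $ i)"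

definition gauss_law :: "'d set \<Rightarrow> ('d \<Rightarrow> 'd \<Rightarrow> real) \<Rightarrow> ('d \<Rightarrow> real) \<Rightarrow> ('d::finite \<Rightarrow> real) measure" where
  "gauss_law S A \<mu> = distr std_gauss (\<Pi>\<^sub>M i\<in>S. borel) (gauss_map S A \<mu>)"

lemma gauss_map_measurable [measurable]:
  "gauss_map S A \<mu> \<in> measurable borel (\<Pi>\<^sub>M i\<in>S. borel)"
proof -
  have [measurable]: "(\<lambda>\<xi>. (pad_mat S A *v \<xi>) $ i) \<in> borel_measurable borel" for i
    unfolding matrix_vector_mult_def by simp
  show ?thesis unfolding gauss_map_def[abs_def] by measurable
qed

text \<open>
  The coordinates of \<open>\<xi>\<close> outside \<open>S\<close> do not reach the coordinates in \<open>S\<close> through a padded matrix.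
\<close>

lemma is_gaussian_onE:
  assumes "is_gaussian_on S \<mu> C N"
  obtains A where "factor_on S A C" "N = gauss_law S A \<mu>"
proof -
  obtain A where A: "\<forall>i\<in>S. \<forall>j\<in>S. (\<Sum>l\<in>S. A i l * A j l) = C i j"
    and N: "N = distr (\<Pi>\<^sub>M l\<in>S. std_normal_distribution) (\<Pi>\<^sub>M i\<in>S. borel)
             (\<lambda>\<xi>. \<lambda>i\<in>S. \<mu> i + (\<Sum>l\<in>S. A i l * \<xi> l))"
    using assms unfolding is_gaussian_on_def by auto
  have "N = gauss_law S A \<mu>"
    unfolding N std_gauss_PiM gauss_law_def
    by (subst distr_distr) (auto intro!: distr_cong restrict_ext simp: gauss_map_def pad_mat_mult_component)
  with A that show ?thesis by (auto simp: factor_on_def)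
qed

text \<open>
  Two square roots of the same matrix differ by the orthogonal matrix \<open>Q\<close>, which preserves \<open>std_gauss\<close>.
  The two classes can therefore be described with a common root.
\<close>

lemma gauss_law_factor_independent:
  assumes C: "sym_pos_def_on S C" and A: "factor_on S A C" and A': "factor_on S A' C"
  shows "gauss_law S A' \<mu> = gauss_law S A \<mu>"
proof -
  let ?A = "pad_mat S A" and ?A' = "pad_mat S A'"
  define Q where "Q = matrix_inv ?A ** ?A'"
  have AQ: "?A ** Q = ?A'"
    by (simp add: Q_def matrix_mul_assoc factor_on_invertible[OF C A])
  have "Q ** transpose Q = matrix_inv ?A ** (?A' ** transpose ?A') ** transpose (matrix_inv ?A)"
    by (simp add: Q_def matrix_transpose_mul matrix_mul_assoc)
  also have "?A' ** transpose ?A' = ?A ** transpose ?A"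
    by (simp add: factor_on_pad[OF A] factor_on_pad[OF A'])
  also have "matrix_inv ?A ** (?A ** transpose ?A) ** transpose (matrix_inv ?A)
      = (matrix_inv ?A ** ?A) ** transpose (matrix_inv ?A ** ?A)"
    by (simp add: matrix_transpose_mul matrix_mul_assoc)
  also have "\<dots> = mat 1"
    by (simp add: factor_on_invertible[OF C A] transpose_mat)
  finally have "orthogonal_matrix Q"
    by (simp add: orthogonal_matrix matrix_left_right_inverse)
  then have T: "orthogonal_transformation ((*v) Q)"
    by (simp add: orthogonal_transformation_matrix)
  have [measurable]: "(*v) Q \<in> borel_measurable borel"
    by (rule orthogonal_transformation_measurable[OF T])
  have "gauss_map S A' \<mu> = gauss_map S A \<mu> \<circ> (*v) Q"
    by (auto simp: gauss_map_def fun_eq_iff matrix_vector_mul_assoc AQ)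
  then have "gauss_law S A' \<mu> = distr (distr std_gauss borel ((*v) Q)) (\<Pi>\<^sub>M i\<in>S. borel) (gauss_map S A \<mu>)"
    unfolding gauss_law_def by (subst distr_distr) auto
  then show ?thesis
    unfolding std_gauss_orthogonal[OF T] gauss_law_def .
qed

lemma whiten_gauss_map:
  assumes C: "sym_pos_def_on S C" and A: "factor_on S A C"
  shows "whiten S A (gauss_map S A \<mu> \<xi>) = whiten S A \<mu> + pad_vec S (($) \<xi>)"
proof -
  have "pad_vec S (gauss_map S A \<mu> \<xi>) = pad_vec S \<mu> + pad_mat S A *v pad_vec S (($) \<xi>)"
    by (simp add: pad_mat_mult_pad_vec gauss_map_def pad_vec_def vec_eq_iff pad_mat_mult_component)
  then show ?thesis
    by (simp add: whiten_def matrix_vector_right_distrib matrix_vector_mul_assoc factor_on_invertible[OF C A])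
qed

lemma space_gauss_law [simp]: "space (gauss_law S A \<mu>) = space (\<Pi>\<^sub>M i\<in>S. borel)"
  and sets_gauss_law [simp, measurable_cong]: "sets (gauss_law S A \<mu>) = sets (\<Pi>\<^sub>M i\<in>S. borel)"
  by (simp_all add: gauss_law_def)

lemma measure_gauss_law:
  assumes "T \<in> sets (\<Pi>\<^sub>M i\<in>S. borel)"
  shows "measure (gauss_law S A \<mu>) T = measure std_gauss {\<xi>. gauss_map S A \<mu> \<xi> \<in> T}"
  unfolding gauss_law_def using assms by (subst measure_distr) (auto simp: vimage_def)

lemma gauss_map_space: "gauss_map S A \<mu> \<xi> \<in> space (\<Pi>\<^sub>M i\<in>S. borel)"
  by (auto simp: gauss_map_def space_PiM)

text \<open>
  With a common root, a change of the mean is a translation of the underlying standard Gaussian vector.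
\<close>

lemma gauss_map_shift:
  assumes C: "sym_pos_def_on S C" and A: "factor_on S A C"
  shows "gauss_map S A \<nu> \<xi> = gauss_map S A \<mu> ((whiten S A \<nu> - whiten S A \<mu>) + \<xi>)"
proof -
  have "pad_mat S A *v (whiten S A \<nu> - whiten S A \<mu>) = pad_vec S \<nu> - pad_vec S \<mu>"
    by (simp add: matrix_vector_mult_diff_distrib pad_mat_mult_whiten[OF C A])
  then show ?thesis
    by (auto simp: gauss_map_def matrix_vector_right_distrib pad_vec_def fun_eq_iff)
qed

text \<open>
  This transports \<open>std_gauss_testing\<close> along \<open>gauss_map\<close>.
\<close>

lemma gauss_law_testing:
  assumes C: "sym_pos_def_on S C" and A: "factor_on S A C"
    and T: "T \<in> sets (\<Pi>\<^sub>M i\<in>S. borel)"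
  shows "2 * Phi (- norm (whiten S A \<mu> - whiten S A \<nu>) / 2)
    \<le> measure (gauss_law S A \<mu>) T + measure (gauss_law S A \<nu>) (space (\<Pi>\<^sub>M i\<in>S. borel) - T)"
proof -
  let ?\<theta> = "whiten S A \<nu> - whiten S A \<mu>"
  define B where "B = {\<xi>. gauss_map S A \<mu> \<xi> \<in> T}"
  have "gauss_map S A \<mu> -` T \<inter> space borel \<in> sets borel"
    using gauss_map_measurable T by (rule measurable_sets)
  then have "B \<in> sets borel"
    by (simp add: B_def vimage_def)
  then have "2 * Phi (- norm ?\<theta> / 2) \<le> measure std_gauss B + measure std_gauss {x. ?\<theta> + x \<notin> B}"
    by (rule std_gauss_testing)
  also have "measure std_gauss B = measure (gauss_law S A \<mu>) T"
    by (simp add: B_def measure_gauss_law[OF T])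
  also have "{x. ?\<theta> + x \<notin> B} = {x. gauss_map S A \<nu> x \<in> space (\<Pi>\<^sub>M i\<in>S. borel) - T}"
    by (auto simp: B_def gauss_map_shift[OF C A, of \<nu> _ \<mu>] gauss_map_space)
  also have "measure std_gauss \<dots> = measure (gauss_law S A \<nu>) (space (\<Pi>\<^sub>M i\<in>S. borel) - T)"
    using T by (subst measure_gauss_law) auto
  finally show ?thesis by (simp add: norm_minus_commute)
qed

text \<open>
  The argument \<open>B\<close> stands for the inverse covariance matrix, \<open>a\<close> and \<open>b\<close> for the estimated means of the
  classes \<open>1\<close> and \<open>-1\<close>.
\<close>

definition lda :: "'d set \<Rightarrow> ('d \<Rightarrow> 'd \<Rightarrow> real) \<Rightarrow> ('d \<Rightarrow> real) \<Rightarrow> ('d \<Rightarrow> real) \<Rightarrow> ('d \<Rightarrow> real) \<Rightarrow> real" where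
  "lda S B a b x = sign_pm (bilin_on S (\<lambda>i. a i - b i) B (\<lambda>j. x j - (a j + b j) / 2))"

lemma lda_measurable [measurable]: "lda S B a b \<in> borel_measurable (\<Pi>\<^sub>M i\<in>S. borel)"
  unfolding lda_def[abs_def] bilin_on_def sign_pm_def by measurable

text \<open>
  Whitening turns the rule into the one of \<open>std_gauss_lda\<close>, since it turns the form of the inverse
  covariance into the inner product.
\<close>

lemma gauss_law_lda:
  fixes a b :: "'d::finite \<Rightarrow> real"
  assumes C: "sym_pos_def_on S C" and A: "factor_on S A C"
  defines "h \<equiv> lda S (inv_on S C) a b"
  shows "measure (gauss_law S A \<mu>) {x \<in> space (\<Pi>\<^sub>M i\<in>S. borel). h x \<noteq> 1}
       + measure (gauss_law S A \<nu>) {x \<in> space (\<Pi>\<^sub>M i\<in>S. borel). h x \<noteq> -1}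
    \<le> 2 * Phi (- norm (whiten S A \<mu> - whiten S A \<nu>) / 2)
      + 2 * (norm (whiten S A (\<lambda>i. a i - \<mu> i)) + norm (whiten S A (\<lambda>i. b i - \<nu> i))) / sqrt (2 * pi)"
proof -
  have [measurable]: "h \<in> borel_measurable (\<Pi>\<^sub>M i\<in>S. borel)" unfolding h_def by measurable
  let ?w = "whiten S A"
  let ?u = "?w a - ?w b" and ?c = "(1 / 2) *\<^sub>R (?w a + ?w b)"
  have h: "h (gauss_map S A m \<xi>) = sign_pm (?u \<bullet> (?w m + \<xi> - ?c))" for m \<xi>
  proof -
    have mid: "?w (\<lambda>j. (a j + b j) / 2) = ?c"
      using whiten_scale[of S A "1 / 2" "\<lambda>j. a j + b j"] by (simp add: whiten_add)
    have "?u \<bullet> pad_vec S (($) \<xi>) = ?u \<bullet> \<xi>"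
      unfolding inner_vec_def
      by (intro sum.cong) (auto simp: pad_vec_def whiten_outside[OF C A])
    then show ?thesis
      by (simp add: h_def lda_def bilin_inv_whiten[OF C A] whiten_diff mid whiten_gauss_map[OF C A]
          inner_diff_right inner_add_right)
  qed
  have 1: "measure (gauss_law S A \<mu>) {x \<in> space (\<Pi>\<^sub>M i\<in>S. borel). h x \<noteq> 1}
      = measure std_gauss {\<xi>. ?u \<bullet> (?w \<mu> + \<xi> - ?c) < 0}"
    by (subst measure_gauss_law) (auto simp: gauss_map_space h sign_pm_def intro!: arg_cong[where f="measure _"])
  have 2: "measure (gauss_law S A \<nu>) {x \<in> space (\<Pi>\<^sub>M i\<in>S. borel). h x \<noteq> -1}
      = measure std_gauss {\<xi>. 0 \<le> ?u \<bullet> (?w \<nu> + \<xi> - ?c)}"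
    by (subst measure_gauss_law) (auto simp: gauss_map_space h sign_pm_def intro!: arg_cong[where f="measure _"])
  show ?thesis
    unfolding 1 2 whiten_diff by (rule std_gauss_lda)
qed

lemma std_gauss_moments:
  fixes l :: "'d::finite"
  shows "integrable std_gauss (\<lambda>x::real ^ 'd. (x $ l)\<^sup>2)" "integrable std_gauss (\<lambda>x::real ^ 'd. x $ l)"
    and "(\<integral>x. (x $ l)\<^sup>2 \<partial>(std_gauss :: (real ^ 'd) measure)) = 1"
    and "(\<integral>x. x $ l \<partial>(std_gauss :: (real ^ 'd) measure)) = 0"
proof -
  have m: "(\<lambda>x::real ^ 'd. x $ l) \<in> measurable std_gauss borel" by measurable
  have i: "integrable (distr std_gauss borel (\<lambda>x::real ^ 'd. x $ l)) (\<lambda>x. x ^ k)" for k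
    unfolding std_gauss_component by (rule integrable_std_normal_distribution_moment)
  then have i': "integrable std_gauss (\<lambda>x::real ^ 'd. (x $ l) ^ k)" for k
    by (subst (asm) integrable_distr_eq[OF m]) auto
  show "integrable std_gauss (\<lambda>x::real ^ 'd. (x $ l)\<^sup>2)" "integrable std_gauss (\<lambda>x::real ^ 'd. x $ l)"
    using i'[of 2] i'[of 1] by auto
  have e: "(\<integral>x. (x $ l) ^ k \<partial>(std_gauss :: (real ^ 'd) measure)) = (\<integral>x. x ^ k \<partial>std_normal_distribution)" for k
    unfolding std_gauss_component[symmetric, where 'a='d and j=l] by (subst integral_distr[OF m]) auto
  show "(\<integral>x. (x $ l)\<^sup>2 \<partial>(std_gauss :: (real ^ 'd) measure)) = 1"
    using e[of 2] std_normal_distribution_even_moments(1)[of 1] by simp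
  show "(\<integral>x. x $ l \<partial>(std_gauss :: (real ^ 'd) measure)) = 0"
    using e[of 1] integral_std_normal_distribution_moment_odd[of 1] by simp
qed

lemma gauss_law_moments:
  assumes C: "sym_pos_def_on S C" and A: "factor_on S A C" and l: "l \<in> S"
  shows "integrable (gauss_law S A \<mu>) (\<lambda>x. (whiten S A (\<lambda>i. x i - \<mu> i) $ l)\<^sup>2)"
    and "integrable (gauss_law S A \<mu>) (\<lambda>x. whiten S A (\<lambda>i. x i - \<mu> i) $ l)"
    and "(\<integral>x. (whiten S A (\<lambda>i. x i - \<mu> i) $ l)\<^sup>2 \<partial>gauss_law S A \<mu>) = 1"
    and "(\<integral>x. whiten S A (\<lambda>i. x i - \<mu> i) $ l \<partial>gauss_law S A \<mu>) = 0"
proof -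
  have m: "gauss_map S A \<mu> \<in> measurable std_gauss (\<Pi>\<^sub>M i\<in>S. borel)" by measurable
  have [measurable]: "(\<lambda>x. whiten S A (\<lambda>i. x i - \<mu> i) $ l) \<in> borel_measurable (\<Pi>\<^sub>M i\<in>S. borel)"
    unfolding whiten_component by measurable
  have w: "whiten S A (\<lambda>i. gauss_map S A \<mu> \<xi> i - \<mu> i) $ l = \<xi> $ l" for \<xi>
    using l by (simp add: whiten_diff whiten_gauss_map[OF C A] pad_vec_def)
  show "integrable (gauss_law S A \<mu>) (\<lambda>x. (whiten S A (\<lambda>i. x i - \<mu> i) $ l)\<^sup>2)"
    and "integrable (gauss_law S A \<mu>) (\<lambda>x. whiten S A (\<lambda>i. x i - \<mu> i) $ l)"
    unfolding gauss_law_def by (subst integrable_distr_eq[OF m]; simp add: w std_gauss_moments)+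
  show "(\<integral>x. (whiten S A (\<lambda>i. x i - \<mu> i) $ l)\<^sup>2 \<partial>gauss_law S A \<mu>) = 1"
    and "(\<integral>x. whiten S A (\<lambda>i. x i - \<mu> i) $ l \<partial>gauss_law S A \<mu>) = 0"
    unfolding gauss_law_def by (subst integral_distr[OF m]; simp add: w std_gauss_moments)+
qed

section \<open>Means over a random subsample\<close>

text \<open>
  The function \<open>b\<close> indicates the sample points that are selected, in the application those with a given mask and
  label; \<open>\<zeta> l\<close> is the \<open>l\<close>-th centred coordinate of a selected point and \<open>0\<close> on the others.
  The normalisation says that, given selection, the coordinates are centred with variance \<open>1\<close>.
\<close>

locale selected_sample = prob_space P for P :: "'o measure" +
  fixes N :: "'a measure" and D :: "nat \<Rightarrow> 'o \<Rightarrow> 'a" and n :: nat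
    and b :: "'a \<Rightarrow> real" and \<zeta> :: "'l \<Rightarrow> 'a \<Rightarrow> real" and L :: "'l set" and q :: real
  assumes indep: "indep_vars (\<lambda>_. N) D {1..n}"
    and b_meas [measurable]: "b \<in> borel_measurable N"
    and b_range: "\<And>a. b a \<in> {0, 1}"
    and b_mean: "\<And>i. i \<in> {1..n} \<Longrightarrow> expectation (\<lambda>\<omega>. b (D i \<omega>)) = q"
    and L: "finite L"
    and \<zeta>_meas [measurable]: "\<And>l. l \<in> L \<Longrightarrow> \<zeta> l \<in> borel_measurable N"
    and \<zeta>_zero: "\<And>l a. l \<in> L \<Longrightarrow> b a = 0 \<Longrightarrow> \<zeta> l a = 0"
    and \<zeta>_sq_int: "\<And>i l. i \<in> {1..n} \<Longrightarrow> l \<in> L \<Longrightarrow> integrable P (\<lambda>\<omega>. (\<zeta> l (D i \<omega>))\<^sup>2)"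
    and \<zeta>_mean: "\<And>i l. i \<in> {1..n} \<Longrightarrow> l \<in> L \<Longrightarrow> expectation (\<lambda>\<omega>. \<zeta> l (D i \<omega>)) = 0"
    and \<zeta>_sq: "\<And>i l. i \<in> {1..n} \<Longrightarrow> l \<in> L \<Longrightarrow> expectation (\<lambda>\<omega>. (\<zeta> l (D i \<omega>))\<^sup>2) = q"
begin

definition cnt :: "'o \<Rightarrow> real" where
  "cnt \<omega> = (\<Sum>j\<in>{1..n}. b (D j \<omega>))"

definition cnt_wo :: "nat \<Rightarrow> 'o \<Rightarrow> real" where
  "cnt_wo i \<omega> = (\<Sum>j\<in>{1..n} - {i}. b (D j \<omega>))"

lemma D_meas: "i \<in> {1..n} \<Longrightarrow> D i \<in> measurable P N"
  using indep by (auto simp: indep_vars_def)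

lemma b_D_meas [measurable]: "i \<in> {1..n} \<Longrightarrow> (\<lambda>\<omega>. b (D i \<omega>)) \<in> borel_measurable P"
  by (rule measurable_compose[OF D_meas b_meas])

lemma \<zeta>_D_meas [measurable]: "i \<in> {1..n} \<Longrightarrow> l \<in> L \<Longrightarrow> (\<lambda>\<omega>. \<zeta> l (D i \<omega>)) \<in> borel_measurable P"
  by (rule measurable_compose[OF D_meas \<zeta>_meas])

lemma cnt_meas [measurable]: "cnt \<in> borel_measurable P"
  unfolding cnt_def[abs_def] by measurable

lemma cnt_wo_meas [measurable]: "cnt_wo i \<in> borel_measurable P"
  unfolding cnt_wo_def[abs_def] by measurable

lemma b_01: "0 \<le> b a" "b a \<le> 1"
  using b_range[of a] by auto

lemma cnt_wo_nonneg: "cnt_wo i \<omega> \<ge> 0"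
  unfolding cnt_wo_def by (intro sum_nonneg) (simp add: b_01)

lemma cnt_nonneg: "cnt \<omega> \<ge> 0"
  unfolding cnt_def by (intro sum_nonneg) (simp add: b_01)

lemma cnt_le: "cnt \<omega> \<le> n"
  using sum_bounded_above[of "{1..n}" "\<lambda>j. b (D j \<omega>)" 1] unfolding cnt_def by (simp add: b_01)

lemma cnt_split: "i \<in> {1..n} \<Longrightarrow> cnt \<omega> = b (D i \<omega>) + cnt_wo i \<omega>"
  unfolding cnt_def cnt_wo_def by (subst sum.remove[of _ i]) auto

lemma \<zeta>_int: "i \<in> {1..n} \<Longrightarrow> l \<in> L \<Longrightarrow> integrable P (\<lambda>\<omega>. \<zeta> l (D i \<omega>))"
  by (rule square_integrable_imp_integrable[OF \<zeta>_D_meas \<zeta>_sq_int])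

lemma integrable_bounded:
  assumes [measurable]: "f \<in> borel_measurable P" and "\<And>\<omega>. \<bar>f \<omega>\<bar> \<le> (K::real)"
  shows "integrable P f"
  by (rule integrable_const_bound[of _ K]) (auto simp: assms)

text \<open>
  All expectations below are computed by separating one sample point from the others.
\<close>

lemma sample_factorization:
  fixes f :: "'a \<Rightarrow> real" and G :: "(nat \<Rightarrow> 'a) \<Rightarrow> real"
  assumes i: "i \<in> {1..n}" and f: "f \<in> borel_measurable N"
    and G: "G \<in> borel_measurable (\<Pi>\<^sub>M j\<in>{1..n} - {i}. N)"
    and fi: "integrable P (\<lambda>\<omega>. f (D i \<omega>))"
    and Gi: "integrable P (\<lambda>\<omega>. G (\<lambda>j\<in>{1..n} - {i}. D j \<omega>))"
  shows "integrable P (\<lambda>\<omega>. f (D i \<omega>) * G (\<lambda>j\<in>{1..n} - {i}. D j \<omega>))"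
    and "expectation (\<lambda>\<omega>. f (D i \<omega>) * G (\<lambda>j\<in>{1..n} - {i}. D j \<omega>))
       = expectation (\<lambda>\<omega>. f (D i \<omega>)) * expectation (\<lambda>\<omega>. G (\<lambda>j\<in>{1..n} - {i}. D j \<omega>))"
proof -
  have "indep_var (PiM {i} (\<lambda>_. N)) (\<lambda>\<omega>. \<lambda>j\<in>{i}. D j \<omega>)
      (PiM ({1..n} - {i}) (\<lambda>_. N)) (\<lambda>\<omega>. \<lambda>j\<in>{1..n} - {i}. D j \<omega>)"
    using i by (intro indep_var_restrict[OF indep]) auto
  moreover have "(\<lambda>x. f (x i)) \<in> borel_measurable (PiM {i} (\<lambda>_. N))"
    using f by measurable
  ultimately have "indep_var borel ((\<lambda>x. f (x i)) \<circ> (\<lambda>\<omega>. \<lambda>j\<in>{i}. D j \<omega>))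
      borel (G \<circ> (\<lambda>\<omega>. \<lambda>j\<in>{1..n} - {i}. D j \<omega>))"
    by (rule indep_var_compose[OF _ _ G])
  then have "indep_var borel (\<lambda>\<omega>. f (D i \<omega>)) borel (\<lambda>\<omega>. G (\<lambda>j\<in>{1..n} - {i}. D j \<omega>))"
    by (simp add: comp_def)
  then show "integrable P (\<lambda>\<omega>. f (D i \<omega>) * G (\<lambda>j\<in>{1..n} - {i}. D j \<omega>))"
    and "expectation (\<lambda>\<omega>. f (D i \<omega>) * G (\<lambda>j\<in>{1..n} - {i}. D j \<omega>))
       = expectation (\<lambda>\<omega>. f (D i \<omega>)) * expectation (\<lambda>\<omega>. G (\<lambda>j\<in>{1..n} - {i}. D j \<omega>))"
    using fi Gi by (auto intro: indep_var_lebesgue_integral indep_var_integrable)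
qed

lemma weight_factorization:
  assumes i: "i \<in> {1..n}" and f: "f \<in> borel_measurable N"
    and fi: "integrable P (\<lambda>\<omega>. f (D i \<omega>))"
    and g [measurable]: "g \<in> borel_measurable borel" and gK: "\<And>x. \<bar>g x\<bar> \<le> (K::real)"
  shows "integrable P (\<lambda>\<omega>. f (D i \<omega>) * g (1 + cnt_wo i \<omega>))"
    and "expectation (\<lambda>\<omega>. f (D i \<omega>) * g (1 + cnt_wo i \<omega>))
       = expectation (\<lambda>\<omega>. f (D i \<omega>)) * expectation (\<lambda>\<omega>. g (1 + cnt_wo i \<omega>))"
proof -
  define G where "G x = g (1 + (\<Sum>j\<in>{1..n} - {i}. b (x j)))" for x
  have G: "G \<in> borel_measurable (\<Pi>\<^sub>M j\<in>{1..n} - {i}. N)"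
    unfolding G_def by measurable
  have e: "G (\<lambda>j\<in>{1..n} - {i}. D j \<omega>) = g (1 + cnt_wo i \<omega>)" for \<omega>
    by (simp add: G_def cnt_wo_def)
  have "integrable P (\<lambda>\<omega>. g (1 + cnt_wo i \<omega>))"
    using gK by (intro integrable_bounded[of _ K]) auto
  then show "integrable P (\<lambda>\<omega>. f (D i \<omega>) * g (1 + cnt_wo i \<omega>))"
    and "expectation (\<lambda>\<omega>. f (D i \<omega>) * g (1 + cnt_wo i \<omega>))
       = expectation (\<lambda>\<omega>. f (D i \<omega>)) * expectation (\<lambda>\<omega>. g (1 + cnt_wo i \<omega>))"
    using sample_factorization[OF i f G fi, unfolded e] by auto
qed

lemma b_int: "i \<in> {1..n} \<Longrightarrow> integrable P (\<lambda>\<omega>. b (D i \<omega>))"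
  by (rule integrable_bounded[of _ 1]) (auto simp: b_01 abs_le_iff intro: order_trans[OF _ b_01(1)])

text \<open>
  On the event that point \<open>i\<close> is selected the count is \<open>1\<close> plus the count of the others, which is independent
  of point \<open>i\<close>.
\<close>

lemma leave_one_out:
  assumes i: "i \<in> {1..n}"
    and g [measurable]: "g \<in> borel_measurable borel" and gK: "\<And>x. \<bar>g x\<bar> \<le> (K::real)"
  shows "q * expectation (\<lambda>\<omega>. g (1 + cnt_wo i \<omega>)) = expectation (\<lambda>\<omega>. b (D i \<omega>) * g (cnt \<omega>))"
proof -
  have "b (D i \<omega>) * g (cnt \<omega>) = b (D i \<omega>) * g (1 + cnt_wo i \<omega>)" for \<omega>
    using b_range[of "D i \<omega>"] cnt_split[OF i] by auto
  then have "(\<lambda>\<omega>. b (D i \<omega>) * g (cnt \<omega>)) = (\<lambda>\<omega>. b (D i \<omega>) * g (1 + cnt_wo i \<omega>))"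
    by (rule ext)
  then show ?thesis
    using weight_factorization(2)[OF i b_meas b_int[OF i] g gK] by (simp add: b_mean[OF i])
qed

text \<open>
  Expand the square. In an off-diagonal term, freeze all points but \<open>i\<close>: where \<open>\<zeta> l\<close> does not vanish at
  point \<open>i\<close>, the weight is \<open>g (1 + cnt_wo i)\<close>, so the term factors through the mean \<open>0\<close> of \<open>\<zeta> l\<close>.
  A diagonal term has the same expectation as \<open>b\<close> at point \<open>i\<close> times the weight, because \<open>\<zeta>\<^sup>2\<close> and \<open>b\<close> both have
  mean \<open>q\<close>; these terms add up to the count times the weight.
\<close>

lemma weighted_square:
  assumes g [measurable]: "g \<in> borel_measurable borel" and gK: "\<And>x. \<bar>g x\<bar> \<le> (K::real)" and l: "l \<in> L"
  shows "integrable P (\<lambda>\<omega>. (\<Sum>i\<in>{1..n}. \<zeta> l (D i \<omega>))\<^sup>2 * g (cnt \<omega>))"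
    and "expectation (\<lambda>\<omega>. (\<Sum>i\<in>{1..n}. \<zeta> l (D i \<omega>))\<^sup>2 * g (cnt \<omega>)) = expectation (\<lambda>\<omega>. cnt \<omega> * g (cnt \<omega>))"
proof -
  note [measurable] = \<zeta>_meas[OF l] and \<zeta>_D_meas[OF _ l, measurable]
  define F where "F i j \<omega> = \<zeta> l (D i \<omega>) * \<zeta> l (D j \<omega>) * g (cnt \<omega>)" for i j \<omega>
  have diag: "integrable P (F i i)"
      "expectation (F i i) = expectation (\<lambda>\<omega>. b (D i \<omega>) * g (cnt \<omega>))" if i: "i \<in> {1..n}" for i
  proof -
    have F: "F i i = (\<lambda>\<omega>. (\<zeta> l (D i \<omega>))\<^sup>2 * g (1 + cnt_wo i \<omega>))"
    proof
      fix \<omega> show "F i i \<omega> = (\<zeta> l (D i \<omega>))\<^sup>2 * g (1 + cnt_wo i \<omega>)"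
        using b_range[of "D i \<omega>"] \<zeta>_zero[OF l] cnt_split[OF i]
        by (auto simp: F_def power2_eq_square)
    qed
    have m: "(\<lambda>a. (\<zeta> l a)\<^sup>2) \<in> borel_measurable N" by measurable
    note p = weight_factorization[OF i m \<zeta>_sq_int[OF i l] g gK]
    show "integrable P (F i i)" unfolding F by (rule p(1))
    show "expectation (F i i) = expectation (\<lambda>\<omega>. b (D i \<omega>) * g (cnt \<omega>))"
      unfolding F p(2) \<zeta>_sq[OF i l] by (rule leave_one_out[OF i g gK])
  qed
  have off: "integrable P (F i j)" "expectation (F i j) = 0"
    if i: "i \<in> {1..n}" and j: "j \<in> {1..n}" and ij: "i \<noteq> j" for i j
  proof -
    have F: "F i j = (\<lambda>\<omega>. \<zeta> l (D i \<omega>) * (\<zeta> l (D j \<omega>) * g (1 + cnt_wo i \<omega>)))"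
    proof
      fix \<omega> show "F i j \<omega> = \<zeta> l (D i \<omega>) * (\<zeta> l (D j \<omega>) * g (1 + cnt_wo i \<omega>))"
        using b_range[of "D i \<omega>"] \<zeta>_zero[OF l] cnt_split[OF i] by (auto simp: F_def)
    qed
    have j': "j \<in> {1..n} - {i}" using j ij by auto
    define G where "G x = \<zeta> l (x j) * g (1 + (\<Sum>k\<in>{1..n} - {i}. b (x k)))" for x
    have [measurable]: "(\<lambda>x. x j) \<in> measurable (\<Pi>\<^sub>M j\<in>{1..n} - {i}. N) N"
      by (rule measurable_component_singleton[OF j'])
    have G: "G \<in> borel_measurable (\<Pi>\<^sub>M j\<in>{1..n} - {i}. N)"
      unfolding G_def by measurable
    have e: "G (\<lambda>j\<in>{1..n} - {i}. D j \<omega>) = \<zeta> l (D j \<omega>) * g (1 + cnt_wo i \<omega>)" for \<omega>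
      using j' by (simp add: G_def cnt_wo_def)
    have Gi: "integrable P (\<lambda>\<omega>. G (\<lambda>j\<in>{1..n} - {i}. D j \<omega>))"
      unfolding e
    proof (rule Bochner_Integration.integrable_bound)
      show "integrable P (\<lambda>\<omega>. K * \<zeta> l (D j \<omega>))" using \<zeta>_int[OF j l] by simp
      show "AE \<omega> in P. norm (\<zeta> l (D j \<omega>) * g (1 + cnt_wo i \<omega>)) \<le> norm (K * \<zeta> l (D j \<omega>))"
      proof (intro AE_I2)
        fix \<omega>
        have "\<bar>g (1 + cnt_wo i \<omega>)\<bar> \<le> \<bar>K\<bar>" by (rule order_trans[OF gK abs_ge_self])
        then show "norm (\<zeta> l (D j \<omega>) * g (1 + cnt_wo i \<omega>)) \<le> norm (K * \<zeta> l (D j \<omega>))"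
          unfolding real_norm_def abs_mult by (subst mult.commute) (rule mult_right_mono, auto)
      qed
    qed (use j in measurable)
    note p = sample_factorization[OF i \<zeta>_meas[OF l] G \<zeta>_int[OF i l] Gi, unfolded e \<zeta>_mean[OF i l]]
    show "integrable P (F i j)" unfolding F by (rule p(1))
    show "expectation (F i j) = 0" unfolding F using p(2) by simp
  qed
  have sq: "(\<lambda>\<omega>. (\<Sum>i\<in>{1..n}. \<zeta> l (D i \<omega>))\<^sup>2 * g (cnt \<omega>)) = (\<lambda>\<omega>. \<Sum>i\<in>{1..n}. \<Sum>j\<in>{1..n}. F i j \<omega>)"
  proof
    fix \<omega>
    have "(\<Sum>i\<in>{1..n}. \<zeta> l (D i \<omega>))\<^sup>2 = (\<Sum>i\<in>{1..n}. \<Sum>j\<in>{1..n}. \<zeta> l (D i \<omega>) * \<zeta> l (D j \<omega>))"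
      unfolding power2_eq_square by (rule sum_product)
    then show "(\<Sum>i\<in>{1..n}. \<zeta> l (D i \<omega>))\<^sup>2 * g (cnt \<omega>) = (\<Sum>i\<in>{1..n}. \<Sum>j\<in>{1..n}. F i j \<omega>)"
      by (simp only: F_def sum_distrib_right)
  qed
  have int: "integrable P (F i j)" if "i \<in> {1..n}" "j \<in> {1..n}" for i j
    using diag(1) off(1) that by metis
  show "integrable P (\<lambda>\<omega>. (\<Sum>i\<in>{1..n}. \<zeta> l (D i \<omega>))\<^sup>2 * g (cnt \<omega>))"
    unfolding sq by (intro Bochner_Integration.integrable_sum int)
  have "expectation (\<lambda>\<omega>. \<Sum>i\<in>{1..n}. \<Sum>j\<in>{1..n}. F i j \<omega>)
      = (\<Sum>i\<in>{1..n}. \<Sum>j\<in>{1..n}. expectation (F i j))"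
  proof -
    have "expectation (\<lambda>\<omega>. \<Sum>i\<in>{1..n}. \<Sum>j\<in>{1..n}. F i j \<omega>)
        = (\<Sum>i\<in>{1..n}. expectation (\<lambda>\<omega>. \<Sum>j\<in>{1..n}. F i j \<omega>))"
      by (rule Bochner_Integration.integral_sum) (intro Bochner_Integration.integrable_sum int)
    also have "\<dots> = (\<Sum>i\<in>{1..n}. \<Sum>j\<in>{1..n}. expectation (F i j))"
      by (intro sum.cong refl Bochner_Integration.integral_sum int)
    finally show ?thesis .
  qed
  also have "\<dots> = (\<Sum>i\<in>{1..n}. expectation (\<lambda>\<omega>. b (D i \<omega>) * g (cnt \<omega>)))"
  proof (intro sum.cong refl)
    fix i assume i: "i \<in> {1..n}"
    have "(\<Sum>j\<in>{1..n}. expectation (F i j)) = (\<Sum>j\<in>{i}. expectation (F i j))"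
      using i off(2) by (intro sum.mono_neutral_right) auto
    then show "(\<Sum>j\<in>{1..n}. expectation (F i j)) = expectation (\<lambda>\<omega>. b (D i \<omega>) * g (cnt \<omega>))"
      using diag(2)[OF i] by simp
  qed
  also have "\<dots> = expectation (\<lambda>\<omega>. \<Sum>i\<in>{1..n}. b (D i \<omega>) * g (cnt \<omega>))"
  proof (rule Bochner_Integration.integral_sum[symmetric])
    fix i assume i: "i \<in> {1..n}"
    have "\<bar>b (D i \<omega>) * g (cnt \<omega>)\<bar> \<le> K" for \<omega>
      using b_range[of "D i \<omega>"] gK[of "cnt \<omega>"] by auto
    then show "integrable P (\<lambda>\<omega>. b (D i \<omega>) * g (cnt \<omega>))"
      using i by (intro integrable_bounded[of _ K]) auto
  qed
  also have "\<dots> = expectation (\<lambda>\<omega>. cnt \<omega> * g (cnt \<omega>))"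
    by (simp add: cnt_def sum_distrib_right)
  finally show "expectation (\<lambda>\<omega>. (\<Sum>i\<in>{1..n}. \<zeta> l (D i \<omega>))\<^sup>2 * g (cnt \<omega>))
      = expectation (\<lambda>\<omega>. cnt \<omega> * g (cnt \<omega>))"
    unfolding sq .
qed

lemma integrable_inverse_count: "integrable P (\<lambda>\<omega>. 1 / (1 + cnt \<omega>))"
  by (rule integrable_bounded[of _ 1])
     (use cnt_nonneg in \<open>auto simp: abs_le_iff divide_le_eq add_nonneg_nonneg intro: order_trans\<close>)

text \<open>
  Summing \<open>leave_one_out\<close> for the weight \<open>1/N\<close> over all points gives the probability that the count
  \<open>N\<close> is positive, which is at most \<open>1\<close>; and leaving a point out only increases \<open>1/(1 + N)\<close>.
\<close>

lemma expectation_inverse_count: "n * q * expectation (\<lambda>\<omega>. 1 / (1 + cnt \<omega>)) \<le> 1"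
proof -
  \<comment> \<open>The maximum keeps the weight bounded; it is \<open>1/x\<close> at every positive count.\<close>
  define g :: "real \<Rightarrow> real" where "g x = 1 / max 1 x" for x
  have [measurable]: "g \<in> borel_measurable borel" unfolding g_def by measurable
  have gK: "\<bar>g x\<bar> \<le> 1" for x by (simp add: g_def)
  have q: "q \<ge> 0" if "i \<in> {1..n}" for i
    unfolding b_mean[OF that, symmetric] by (intro integral_nonneg_AE) (simp add: b_01)
  note i1 = integrable_inverse_count
  have "n * q * expectation (\<lambda>\<omega>. 1 / (1 + cnt \<omega>)) = (\<Sum>i\<in>{1..n}. q * expectation (\<lambda>\<omega>. 1 / (1 + cnt \<omega>)))"
    by simp
  also have "\<dots> \<le> (\<Sum>i\<in>{1..n}. expectation (\<lambda>\<omega>. b (D i \<omega>) * g (cnt \<omega>)))"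
  proof (rule sum_mono)
    fix i assume i: "i \<in> {1..n}"
    have "expectation (\<lambda>\<omega>. 1 / (1 + cnt \<omega>)) \<le> expectation (\<lambda>\<omega>. g (1 + cnt_wo i \<omega>))"
    proof (rule integral_mono[OF i1])
      show "integrable P (\<lambda>\<omega>. g (1 + cnt_wo i \<omega>))"
        by (rule integrable_bounded[OF _ gK]) measurable
      show "1 / (1 + cnt \<omega>) \<le> g (1 + cnt_wo i \<omega>)" for \<omega>
        using cnt_split[OF i] b_01 cnt_wo_nonneg[of i \<omega>] by (simp add: g_def frac_le)
    qed
    then show "q * expectation (\<lambda>\<omega>. 1 / (1 + cnt \<omega>)) \<le> expectation (\<lambda>\<omega>. b (D i \<omega>) * g (cnt \<omega>))"
      using q[OF i] by (subst leave_one_out[OF i _ gK, symmetric]) (auto intro: mult_left_mono)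
  qed
  also have "\<dots> = expectation (\<lambda>\<omega>. \<Sum>i\<in>{1..n}. b (D i \<omega>) * g (cnt \<omega>))"
  proof (rule Bochner_Integration.integral_sum[symmetric])
    fix i assume i: "i \<in> {1..n}"
    have "\<bar>b (D i \<omega>) * g (cnt \<omega>)\<bar> \<le> 1" for \<omega>
      using b_range[of "D i \<omega>"] gK[of "cnt \<omega>"] by auto
    then show "integrable P (\<lambda>\<omega>. b (D i \<omega>) * g (cnt \<omega>))"
      using i by (intro integrable_bounded[of _ 1]) auto
  qed
  also have "\<dots> = expectation (\<lambda>\<omega>. cnt \<omega> * g (cnt \<omega>))"
    by (simp add: cnt_def sum_distrib_right)
  also have "\<dots> \<le> expectation (\<lambda>_. 1)"
  proof (rule integral_mono')
    show "cnt \<omega> * g (cnt \<omega>) \<le> 1" for \<omega> by (simp add: g_def max_def)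
  qed auto
  also have "\<dots> = 1" by (simp add: prob_space)
  finally show ?thesis .
qed

text \<open>
  \<open>R\<close> is the norm of the mean of the selected centred vectors, set to \<open>0\<close> unless their number exceeds \<open>n\<tau>\<close>.
  Let \<open>W\<close> be the expectation of \<open>1/N\<close> on the event that the count \<open>N\<close> exceeds \<open>n\<tau>\<close>.
  By Jensen's inequality and \<open>weighted_square\<close>, the squared expectation of \<open>R\<close> is at most \<open>c W\<close>. The two
  bounds \<open>W \<le> 1/(n\<tau>)\<close> and \<open>q W \<le> 2/n\<close> yield the two halves of the minimum, because \<open>c/n \<le> \<tau>\<^sup>2\<close>.
  The last claim combines the trivial bound of a probability by \<open>1\<close> with Markov's inequality for \<open>1/(1 + N)\<close>.
\<close>

lemma thresholded_mean_bounds: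
  fixes \<tau> c :: real
  assumes n: "n \<ge> 1" and q: "0 \<le> q" "2 * q \<le> 1" and c: "1 \<le> c" "card L \<le> c" and \<tau>: "sqrt (c / n) \<le> \<tau>"
  defines "R \<equiv> \<lambda>\<omega>. of_bool (cnt \<omega> / n > \<tau>) * (L2_set (\<lambda>l. \<Sum>i\<in>{1..n}. \<zeta> l (D i \<omega>)) L / cnt \<omega>)"
  shows "integrable P R"
    and "q * expectation R \<le> min \<tau> (2 * q)"
    and "q * prob {\<omega> \<in> space P. \<not> cnt \<omega> / n > \<tau>} \<le> 2 * min \<tau> (2 * q)"
proof -
  have n0: "real n > 0" using n by simp
  have "1 / real n \<le> sqrt (c / n)"
  proof (rule real_le_rsqrt)
    have "(1 / real n)\<^sup>2 \<le> 1 / n" using n by (simp add: power2_eq_square field_simps)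
    also have "\<dots> \<le> c / n" using c n0 by (intro divide_right_mono) auto
    finally show "(1 / real n)\<^sup>2 \<le> c / n" .
  qed
  with \<tau> have \<tau>n: "1 / n \<le> \<tau>" by simp
  then have \<tau>0: "\<tau> > 0" using n0 by (metis divide_pos_pos less_le_trans zero_less_one)
  have n\<tau>: "1 \<le> n * \<tau>" using \<tau>n n0 by (simp add: field_simps)
  have c\<tau>: "c / n \<le> \<tau>\<^sup>2"
    using \<tau> \<tau>0 by (metis real_sqrt_le_iff real_sqrt_unique less_imp_le)
  have thr: "cnt \<omega> / n > \<tau> \<longleftrightarrow> cnt \<omega> > n * \<tau>" for \<omega>
    using n0 by (simp add: field_simps)
  note i1 = integrable_inverse_count
  have Einv: "q * expectation (\<lambda>\<omega>. 1 / (1 + cnt \<omega>)) \<le> 1 / n"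
    using expectation_inverse_count n0 by (simp add: field_simps)
  show "q * prob {\<omega> \<in> space P. \<not> cnt \<omega> / n > \<tau>} \<le> 2 * min \<tau> (2 * q)"
  proof -
    let ?E = "{\<omega> \<in> space P. \<not> cnt \<omega> / n > \<tau>}"
    have "prob ?E = expectation (indicator ?E)" by simp
    also have "\<dots> \<le> expectation (\<lambda>\<omega>. (n * \<tau> + 1) * (1 / (1 + cnt \<omega>)))"
    proof (rule integral_mono)
      show "integrable P (indicator ?E :: _ \<Rightarrow> real)" by (simp add: integrable_indicator_iff emeasure_eq_measure)
      show "integrable P (\<lambda>\<omega>. (n * \<tau> + 1) * (1 / (1 + cnt \<omega>)))" using i1 by (rule integrable_mult_right)
      show "indicator ?E \<omega> \<le> (n * \<tau> + 1) * (1 / (1 + cnt \<omega>))" for \<omega>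
        using cnt_nonneg[of \<omega>] n\<tau> by (auto simp: indicator_def thr field_simps)
    qed
    also have "\<dots> = (n * \<tau> + 1) * expectation (\<lambda>\<omega>. 1 / (1 + cnt \<omega>))"
      by (rule integral_mult_right_zero)
    finally have "q * prob ?E \<le> (n * \<tau> + 1) * (q * expectation (\<lambda>\<omega>. 1 / (1 + cnt \<omega>)))"
      using q mult_left_mono by (fastforce simp: algebra_simps)
    also have "\<dots> \<le> (n * \<tau> + 1) * (1 / n)"
      using n\<tau> by (intro mult_left_mono Einv) auto
    also have "\<dots> = \<tau> + 1 / n" using n0 by (simp add: field_simps)
    also have "\<dots> \<le> 2 * \<tau>" using \<tau>n by simp
    finally have 1: "q * prob ?E \<le> 2 * \<tau>" .
    have "q * prob ?E \<le> q * 1" using q by (intro mult_left_mono) auto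
    with 1 q show ?thesis by (auto simp: min_def)
  qed
  define g :: "real \<Rightarrow> real" where "g x = of_bool (n * \<tau> < x) / x\<^sup>2" for x
  have [measurable]: "g \<in> borel_measurable borel" unfolding g_def by measurable
  have gK: "\<bar>g x\<bar> \<le> 1" for x
  proof (cases "n * \<tau> < x")
    case True
    then have "1 \<le> x" using n\<tau> by simp
    then have "1 \<le> x\<^sup>2" by (simp add: one_le_power)
    then show ?thesis by (simp add: g_def divide_le_eq)
  qed (simp add: g_def)
  have R2: "(R \<omega>)\<^sup>2 = (\<Sum>l\<in>L. (\<Sum>i\<in>{1..n}. \<zeta> l (D i \<omega>))\<^sup>2 * g (cnt \<omega>))" for \<omega>
    unfolding R_def thr g_def
    by (simp add: L2_set_def power_mult_distrib power_divide sum_nonneg sum_divide_distrib)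
  have R_meas [measurable]: "R \<in> borel_measurable P"
    unfolding R_def L2_set_def by measurable
  have R2_int: "integrable P (\<lambda>\<omega>. (R \<omega>)\<^sup>2)"
    unfolding R2 by (intro Bochner_Integration.integrable_sum weighted_square(1)[OF _ gK]) auto
  show R_int: "integrable P R"
    by (rule square_integrable_imp_integrable[OF R_meas R2_int])
  define W where "W = expectation (\<lambda>\<omega>. cnt \<omega> * g (cnt \<omega>))"
  have cg: "cnt \<omega> * g (cnt \<omega>) = of_bool (n * \<tau> < cnt \<omega>) / cnt \<omega>" for \<omega>
    by (simp add: g_def power2_eq_square)
  have cg_bound: "\<bar>cnt \<omega> * g (cnt \<omega>)\<bar> \<le> 1" for \<omega>
    unfolding cg using n\<tau> by (auto simp: divide_le_eq)
  have cg_int: "integrable P (\<lambda>\<omega>. cnt \<omega> * g (cnt \<omega>))"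
    by (rule integrable_bounded[OF _ cg_bound]) measurable
  have "expectation (\<lambda>\<omega>. (R \<omega>)\<^sup>2)
      = (\<Sum>l\<in>L. expectation (\<lambda>\<omega>. (\<Sum>i\<in>{1..n}. \<zeta> l (D i \<omega>))\<^sup>2 * g (cnt \<omega>)))"
    unfolding R2 by (rule Bochner_Integration.integral_sum) (rule weighted_square(1)[OF _ gK], measurable)
  also have "\<dots> = (\<Sum>l\<in>L. W)"
    unfolding W_def by (intro sum.cong weighted_square(2)[OF _ gK]) auto
  finally have ER2: "expectation (\<lambda>\<omega>. (R \<omega>)\<^sup>2) = card L * W" by simp
  have jensen: "(expectation R)\<^sup>2 \<le> expectation (\<lambda>\<omega>. (R \<omega>)\<^sup>2)"
    using variance_positive[of R] variance_eq[OF R_int R2_int] by simp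
  have W0: "W \<ge> 0"
    unfolding W_def cg by (intro integral_nonneg_AE) (simp add: cnt_nonneg)
  have V: "(expectation R)\<^sup>2 \<le> c * W"
    using jensen ER2 mult_right_mono[OF c(2) W0] by simp
  have W1: "W \<le> 1 / (n * \<tau>)"
  proof -
    have "W \<le> expectation (\<lambda>_. 1 / (n * \<tau>))"
      unfolding W_def
    proof (rule integral_mono[OF cg_int])
      show "cnt \<omega> * g (cnt \<omega>) \<le> 1 / (n * \<tau>)" for \<omega>
        unfolding cg using n\<tau> n0 \<tau>0 by (auto simp: frac_le)
    qed simp
    then show ?thesis by (simp add: prob_space)
  qed
  have W2: "q * W \<le> 2 / n"
  proof -
    have "W \<le> expectation (\<lambda>\<omega>. 2 * (1 / (1 + cnt \<omega>)))"
      unfolding W_def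
    proof (rule integral_mono[OF cg_int])
      show "integrable P (\<lambda>\<omega>. 2 * (1 / (1 + cnt \<omega>)))" using i1 by (rule integrable_mult_right)
      show "cnt \<omega> * g (cnt \<omega>) \<le> 2 * (1 / (1 + cnt \<omega>))" for \<omega>
        unfolding cg using n\<tau> cnt_nonneg[of \<omega>] by (auto simp: field_simps)
    qed
    also have "\<dots> = 2 * expectation (\<lambda>\<omega>. 1 / (1 + cnt \<omega>))" by (rule integral_mult_right_zero)
    finally have "q * W \<le> 2 * (q * expectation (\<lambda>\<omega>. 1 / (1 + cnt \<omega>)))"
      using q mult_left_mono by fastforce
    also have "\<dots> \<le> 2 * (1 / n)" by (intro mult_left_mono Einv) auto
    finally show ?thesis by simp
  qed
  have R0: "R \<omega> \<ge> 0" for \<omega>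
    by (simp add: R_def cnt_nonneg L2_set_nonneg)
  have V0: "expectation R \<ge> 0" by (intro integral_nonneg_AE) (simp add: R0)
  have "(q * expectation R)\<^sup>2 = q * (q * (expectation R)\<^sup>2)" by (simp add: power2_eq_square)
  also have "\<dots> \<le> q * (q * (c * W))" using V q by (intro mult_left_mono) auto
  also have "\<dots> = q * c * (q * W)" by simp
  also have "\<dots> \<le> q * c * (2 / n)" using W2 q c by (intro mult_left_mono) auto
  also have "\<dots> = (2 * q) * (c / n)" by simp
  also have "\<dots> \<le> 1 * \<tau>\<^sup>2" using q c\<tau> c n0 by (intro mult_mono) auto
  finally have "(q * expectation R)\<^sup>2 \<le> \<tau>\<^sup>2" by simp
  then have 1: "q * expectation R \<le> \<tau>"
    using \<tau>0 by (simp add: abs_le_square_iff[symmetric])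
  \<comment> \<open>If \<open>\<tau> > 1\<close>, the count never exceeds \<open>n\<tau>\<close> and \<open>R\<close> vanishes.\<close>
  have 2: "expectation R \<le> 1"
  proof (cases "\<tau> \<le> 1")
    case True
    have "(expectation R)\<^sup>2 \<le> c * (1 / (n * \<tau>))"
      using V W1 c by (meson mult_left_mono order_trans zero_le_one)
    also have "\<dots> = (c / n) / \<tau>" by simp
    also have "\<dots> \<le> \<tau>\<^sup>2 / \<tau>" using c\<tau> \<tau>0 by (intro divide_right_mono) auto
    also have "\<dots> \<le> 1" using True \<tau>0 by (simp add: power2_eq_square)
    finally show ?thesis using V0 by (simp add: abs_square_le_1)
  next
    case False
    have "R \<omega> = 0" for \<omega>
    proof -
      have "cnt \<omega> / n \<le> 1" using cnt_le n0 by (simp add: divide_le_eq)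
      then show ?thesis using False by (simp add: R_def)
    qed
    then have "R = (\<lambda>_. 0)" by (rule ext)
    then show ?thesis by simp
  qed
  have "q * expectation R \<le> 2 * q" using mult_left_mono[OF 2 q(1)] q by simp
  with 1 show "q * expectation R \<le> min \<tau> (2 * q)" by simp
qed

end

section \<open>Measurability of the estimates and of the classifier\<close>

lemma measurable_obs_mask [measurable]: "snd \<in> measurable obs_space (count_space UNIV)"
  unfolding obs_space_def by measurable

lemma measurable_obs_coord [measurable]: "(\<lambda>z. fst z j) \<in> borel_measurable obs_space"
  unfolding obs_space_def by measurable

lemma measurable_labelled [measurable]:
  "fst \<in> measurable labelled_space obs_space" "snd \<in> borel_measurable labelled_space"
  unfolding labelled_space_def by measurable

lemma space_labelled_space: "space labelled_space = UNIV"
  by (simp add: labelled_space_def obs_space_def space_pair_measure space_PiM)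

lemma measurable_obs_spaceI:
  assumes "\<And>j. (\<lambda>\<omega>. f \<omega> j) \<in> borel_measurable Q" and "g \<in> measurable Q (count_space UNIV)"
  shows "(\<lambda>\<omega>. (f \<omega>, g \<omega>)) \<in> measurable Q obs_space"
proof -
  have "f \<in> measurable Q (\<Pi>\<^sub>M j\<in>UNIV. borel)"
    by (rule measurable_PiM_single') (auto simp: assms)
  with assms(2) show ?thesis unfolding obs_space_def by simp
qed

lemma sign_pm_measurable [measurable]: "sign_pm \<in> borel_measurable borel"
  unfolding sign_pm_def[abs_def] by measurable

lemma mu_tilde_measurable:
  assumes D: "\<And>i. i \<in> {1..n} \<Longrightarrow> (\<lambda>\<omega>. d \<omega> i) \<in> measurable Q labelled_space"
  shows "(\<lambda>\<omega>. mu_tilde n \<tau> (d \<omega>) m k j) \<in> borel_measurable Q"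
proof -
  have [measurable]: "(\<lambda>\<omega>. fst (fst (d \<omega> i)) j) \<in> borel_measurable Q"
    "(\<lambda>\<omega>. snd (fst (d \<omega> i))) \<in> measurable Q (count_space UNIV)"
    "(\<lambda>\<omega>. snd (d \<omega> i)) \<in> borel_measurable Q" if "i \<in> {1..n}" for i
    using D[OF that] by measurable
  have [measurable]: "(\<lambda>\<omega>. real (count_mk n (d \<omega>) m k)) \<in> borel_measurable Q"
    unfolding count_mk_def of_nat_sum by measurable
  show ?thesis
    unfolding mu_tilde_def mu_hat_def by measurable
qed

lemma h_tilde_measurable:
  assumes D: "\<And>i. i \<in> {1..n} \<Longrightarrow> (\<lambda>\<omega>. d \<omega> i) \<in> measurable Q labelled_space"
    and z [measurable]: "z \<in> measurable Q obs_space"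
  shows "(\<lambda>\<omega>. h_tilde n \<tau> cov (d \<omega>) (z \<omega>)) \<in> borel_measurable Q"
proof -
  note [measurable] = mu_tilde_measurable[OF D]
  show ?thesis
    unfolding h_tilde_def h_tilde_pattern_def bilin_on_def by measurable
qed

lemma h_tilde_eq: "h_tilde n \<tau> cov d z = h_tilde_pattern n \<tau> cov d (snd z) (fst z)"
proof -
  have "h_tilde n \<tau> cov d z = (\<Sum>m\<in>UNIV. if m = snd z then h_tilde_pattern n \<tau> cov d m (fst z) else 0)"
    unfolding h_tilde_def by (intro sum.cong) auto
  then show ?thesis by simp
qed

lemma h_tilde_pattern_lda:
  "h_tilde_pattern n \<tau> cov d m x = lda (obs m) (inv_on (obs m) (cov m)) (mu_tilde n \<tau> d m 1) (mu_tilde n \<tau> d m (-1)) x"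
  by (simp add: h_tilde_pattern_def lda_def)

text \<open>
  The independence hypothesis speaks of the sample restricted to \<open>{1..n}\<close>, the classifier of the whole sequence.
\<close>

lemma h_tilde_cong:
  assumes "\<And>i. i \<in> {1..n} \<Longrightarrow> d i = d' i"
  shows "h_tilde n \<tau> cov d z = h_tilde n \<tau> cov d' z"
proof -
  have c: "count_mk n d m k = count_mk n d' m k" for m k
    unfolding count_mk_def by (intro sum.cong) (auto simp: assms)
  have "mu_hat n d m k j = mu_hat n d' m k j" for m k j
    unfolding mu_hat_def c by (intro arg_cong2[where f="(/)"] sum.cong) (auto simp: assms)
  then have "mu_tilde n \<tau> d = mu_tilde n \<tau> d'"
    by (simp add: mu_tilde_def c fun_eq_iff)
  then show ?thesis by (simp add: h_tilde_def h_tilde_pattern_def)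
qed

section \<open>The risk of a predictor in the Gaussian pattern model\<close>

locale missing_gaussian_model = prob_space P for P :: "'o measure" +
  fixes X :: "'o \<Rightarrow> real ^ ('d::finite)" and M :: "'o \<Rightarrow> bool ^ 'd" and Y :: "'o \<Rightarrow> real"
    and \<mu> :: "bool ^ 'd \<Rightarrow> real \<Rightarrow> 'd \<Rightarrow> real" and cov :: "bool ^ 'd \<Rightarrow> 'd \<Rightarrow> 'd \<Rightarrow> real"
  assumes X_meas [measurable]: "X \<in> measurable P borel"
    and M_meas [measurable]: "M \<in> measurable P (count_space UNIV)"
    and Y_meas [measurable]: "Y \<in> measurable P borel"
    and Y_range: "\<And>\<omega>. \<omega> \<in> space P \<Longrightarrow> Y \<omega> \<in> {-1, 1}"
    and cov_pd: "\<And>m. prob {\<omega> \<in> space P. M \<omega> = m} > 0 \<Longrightarrow> sym_pos_def_on (obs m) (cov m)"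
    and gaussian: "\<And>m k. prob {\<omega> \<in> space P. M \<omega> = m} > 0 \<Longrightarrow> k \<in> {-1, 1} \<Longrightarrow>
          is_gaussian_on (obs m) (\<mu> m k) (cov m)
            (distr (uniform_measure P {\<omega> \<in> space P. M \<omega> = m \<and> Y \<omega> = k})
               (\<Pi>\<^sub>M j\<in>obs m. borel) (\<lambda>\<omega>. subvec (X \<omega>) (obs m)))"
    and balanced: "\<And>m. prob {\<omega> \<in> space P. Y \<omega> = 1 \<and> M \<omega> = m} = prob {\<omega> \<in> space P. Y \<omega> = -1 \<and> M \<omega> = m}"
begin

definition p :: "bool ^ 'd \<Rightarrow> real" where
  "p m = prob {\<omega> \<in> space P. M \<omega> = m}"

definition Z :: "'o \<Rightarrow> 'd observation" where
  "Z \<omega> = observe (X \<omega>) (M \<omega>)"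

definition stratum :: "bool ^ 'd \<Rightarrow> real \<Rightarrow> 'o set" where
  "stratum m k = {\<omega> \<in> space P. M \<omega> = m \<and> Y \<omega> = k}"

lemma stratum_sets [measurable]: "stratum m k \<in> events"
  unfolding stratum_def by measurable

lemma prob_stratum:
  assumes "k \<in> {-1, 1}" shows "prob (stratum m k) = p m / 2"
proof -
  have "{\<omega> \<in> space P. M \<omega> = m} = stratum m 1 \<union> stratum m (-1)"
    using Y_range by (auto simp: stratum_def)
  moreover have "stratum m 1 \<inter> stratum m (-1) = {}" by (auto simp: stratum_def)
  ultimately have "p m = prob (stratum m 1) + prob (stratum m (-1))"
    by (simp add: p_def finite_measure_Union)
  moreover have "prob (stratum m 1) = prob (stratum m (-1))"
    using balanced[of m] by (simp add: stratum_def conj_commute)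
  ultimately show ?thesis using assms by auto
qed

lemma p_nonneg: "p m \<ge> 0" and p_le_1: "p m \<le> 1"
  by (simp_all add: p_def)

lemma X_component [measurable]: "(\<lambda>\<omega>. X \<omega> $ j) \<in> borel_measurable P"
  by (rule measurable_compose[OF X_meas]) measurable

lemma Z_meas [measurable]: "Z \<in> measurable P obs_space"
proof -
  have "(\<lambda>\<omega>. subvec (X \<omega>) (obs (M \<omega>)) j) \<in> borel_measurable P" for j
  proof -
    have "(\<lambda>\<omega>. subvec (X \<omega>) (obs (M \<omega>)) j) = (\<lambda>\<omega>. if j \<in> obs (M \<omega>) then X \<omega> $ j else undefined)"
      by (auto simp: subvec_def)
    also have "\<dots> \<in> borel_measurable P" by measurable
    finally show ?thesis .
  qed
  then show ?thesis
    unfolding Z_def[abs_def] observe_def by (intro measurable_obs_spaceI M_meas)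
qed

lemma subvec_meas [measurable]: "(\<lambda>\<omega>. subvec (X \<omega>) S) \<in> measurable P (\<Pi>\<^sub>M j\<in>S. borel)"
  unfolding subvec_def by measurable

lemma Z_stratum: "\<omega> \<in> stratum m k \<Longrightarrow> Z \<omega> = (subvec (X \<omega>) (obs m), m)"
  by (simp add: stratum_def Z_def observe_def)

text \<open>
  A root of the covariance matrix that depends on the mask only, hence is common to both classes.
\<close>

definition fac :: "bool ^ 'd \<Rightarrow> 'd \<Rightarrow> 'd \<Rightarrow> real" where
  "fac m = (SOME A. factor_on (obs m) A (cov m))"

abbreviation law :: "bool ^ 'd \<Rightarrow> real \<Rightarrow> ('d \<Rightarrow> real) measure" where
  "law m k \<equiv> gauss_law (obs m) (fac m) (\<mu> m k)"

lemma cov_pos_def: "p m > 0 \<Longrightarrow> sym_pos_def_on (obs m) (cov m)"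
  using cov_pd by (simp add: p_def)

lemma factor:
  assumes "p m > 0" shows "factor_on (obs m) (fac m) (cov m)"
proof -
  have "is_gaussian_on (obs m) (\<mu> m 1) (cov m)
      (distr (uniform_measure P {\<omega> \<in> space P. M \<omega> = m \<and> Y \<omega> = 1})
        (\<Pi>\<^sub>M j\<in>obs m. borel) (\<lambda>\<omega>. subvec (X \<omega>) (obs m)))"
    using assms by (intro gaussian) (auto simp: p_def)
  then obtain A where "factor_on (obs m) A (cov m)" by (rule is_gaussian_onE)
  then show ?thesis unfolding fac_def by (rule someI[of "\<lambda>A. factor_on (obs m) A (cov m)"])
qed

lemma law:
  assumes m: "p m > 0" and k: "k \<in> {-1, 1}"
  shows "distr (uniform_measure P (stratum m k)) (\<Pi>\<^sub>M j\<in>obs m. borel) (\<lambda>\<omega>. subvec (X \<omega>) (obs m)) = law m k"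
proof -
  have "is_gaussian_on (obs m) (\<mu> m k) (cov m)
      (distr (uniform_measure P (stratum m k)) (\<Pi>\<^sub>M j\<in>obs m. borel) (\<lambda>\<omega>. subvec (X \<omega>) (obs m)))"
    unfolding stratum_def using m k by (intro gaussian) (auto simp: p_def)
  then obtain A where A: "factor_on (obs m) A (cov m)"
    "distr (uniform_measure P (stratum m k)) (\<Pi>\<^sub>M j\<in>obs m. borel) (\<lambda>\<omega>. subvec (X \<omega>) (obs m)) = gauss_law (obs m) A (\<mu> m k)"
    by (rule is_gaussian_onE)
  then show ?thesis
    using gauss_law_factor_independent[OF cov_pos_def[OF m] factor[OF m] A(1)] by simp
qed

lemma prob_stratum_subvec:
  assumes m: "p m > 0" and k: "k \<in> {-1, 1}" and T: "T \<in> sets (\<Pi>\<^sub>M j\<in>obs m. borel)"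
  shows "prob {\<omega> \<in> stratum m k. subvec (X \<omega>) (obs m) \<in> T} = p m / 2 * measure (law m k) T"
proof -
  let ?E = "(\<lambda>\<omega>. subvec (X \<omega>) (obs m)) -` T \<inter> space P"
  have E: "?E \<in> events" using subvec_meas T by (rule measurable_sets)
  have em: "(\<lambda>\<omega>. subvec (X \<omega>) (obs m)) \<in> measurable (uniform_measure P (stratum m k)) (\<Pi>\<^sub>M j\<in>obs m. borel)"
    by measurable
  have "measure (law m k) T = measure (uniform_measure P (stratum m k)) ?E"
    unfolding law[OF m k, symmetric] using em T by (subst measure_distr) auto
  also have "\<dots> = prob (stratum m k \<inter> ?E) / prob (stratum m k)"
    using m k E by (intro measure_uniform_measure) (auto simp: emeasure_eq_measure prob_stratum)
  finally have "prob (stratum m k \<inter> ?E) = p m / 2 * measure (law m k) T"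
    using m by (simp add: prob_stratum[OF k])
  moreover have "stratum m k \<inter> ?E = {\<omega> \<in> stratum m k. subvec (X \<omega>) (obs m) \<in> T}"
    by (auto simp: stratum_def)
  ultimately show ?thesis by simp
qed

text \<open>
  Undoing the conditioning on the mask and the label costs the factor \<open>p m / 2\<close>.
\<close>

lemma expectation_stratum:
  fixes f :: "('d \<Rightarrow> real) \<Rightarrow> real"
  assumes m: "p m > 0" and k: "k \<in> {-1, 1}" and f: "integrable (law m k) f"
  shows "integrable P (\<lambda>\<omega>. indicator (stratum m k) \<omega> * f (subvec (X \<omega>) (obs m)))"
    and "expectation (\<lambda>\<omega>. indicator (stratum m k) \<omega> * f (subvec (X \<omega>) (obs m))) = p m / 2 * integral\<^sup>L (law m k) f"
proof -
  let ?x = "\<lambda>\<omega>. subvec (X \<omega>) (obs m)" and ?U = "uniform_measure P (stratum m k)"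
  have fm [measurable]: "f \<in> borel_measurable (\<Pi>\<^sub>M j\<in>obs m. borel)"
    using borel_measurable_integrable[OF f] by simp
  have em: "?x \<in> measurable ?U (\<Pi>\<^sub>M j\<in>obs m. borel)" by measurable
  have U: "?U = density P (\<lambda>\<omega>. ennreal (indicator (stratum m k) \<omega> / (p m / 2)))"
    using m by (simp add: uniform_measure_def emeasure_eq_measure prob_stratum[OF k] ennreal_indicator[symmetric]
        divide_ennreal del: ennreal_indicator)
  have nn: "AE \<omega> in P. 0 \<le> indicator (stratum m k) \<omega> / (p m / 2)" using m by simp
  have "integrable ?U (\<lambda>\<omega>. f (?x \<omega>))"
    using f unfolding law[OF m k, symmetric] by (subst (asm) integrable_distr_eq[OF em fm])
  then have i: "integrable P (\<lambda>\<omega>. indicator (stratum m k) \<omega> / (p m / 2) * f (?x \<omega>))"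
    unfolding U by (subst (asm) integrable_density[OF _ _ nn]) auto
  have "integrable P (\<lambda>\<omega>. p m / 2 * (indicator (stratum m k) \<omega> / (p m / 2) * f (?x \<omega>)))"
    using i by (rule integrable_mult_right)
  then show "integrable P (\<lambda>\<omega>. indicator (stratum m k) \<omega> * f (?x \<omega>))"
    using m by simp
  have "integral\<^sup>L (law m k) f = (\<integral>\<omega>. f (?x \<omega>) \<partial>?U)"
    unfolding law[OF m k, symmetric] by (rule integral_distr[OF em fm])
  also have "\<dots> = expectation (\<lambda>\<omega>. indicator (stratum m k) \<omega> / (p m / 2) * f (?x \<omega>))"
    unfolding U by (subst integral_density[OF _ _ nn]) auto
  also have "\<dots> = expectation (\<lambda>\<omega>. inverse (p m / 2) * (indicator (stratum m k) \<omega> * f (?x \<omega>)))"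
    by (simp only: divide_inverse ac_simps)
  also have "\<dots> = inverse (p m / 2) * expectation (\<lambda>\<omega>. indicator (stratum m k) \<omega> * f (?x \<omega>))"
    by (rule integral_mult_right_zero)
  finally have "p m / 2 * integral\<^sup>L (law m k) f
      = p m / 2 * (inverse (p m / 2) * expectation (\<lambda>\<omega>. indicator (stratum m k) \<omega> * f (?x \<omega>)))"
    by (rule arg_cong)
  then show "expectation (\<lambda>\<omega>. indicator (stratum m k) \<omega> * f (?x \<omega>)) = p m / 2 * integral\<^sup>L (law m k) f"
    using m by (simp only: mult.assoc[symmetric]) simp
qed

text \<open>
  A vector on \<open>obs m\<close> is a total function with a fixed dummy value on the missing coordinates, so it can be
  inserted into an observation without changing it.
\<close>

lemma slice_measurable:
  fixes \<phi> :: "'d observation \<Rightarrow> real"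
  assumes "\<phi> \<in> borel_measurable obs_space"
  shows "(\<lambda>x. \<phi> (x, m)) \<in> borel_measurable (\<Pi>\<^sub>M j\<in>obs m. borel)"
proof -
  have "(\<lambda>x. x j :: real) \<in> borel_measurable (\<Pi>\<^sub>M j\<in>S. borel)" for j and S :: "'d set"
  proof (cases "j \<in> S")
    case False
    then have "x j = undefined" if "x \<in> space (\<Pi>\<^sub>M j\<in>S. (borel :: real measure))" for x
      using that by (auto simp: space_PiM)
    then show ?thesis by (subst measurable_cong[where g="\<lambda>_. undefined"]) auto
  qed measurable
  then have "(\<lambda>x. (x, m)) \<in> measurable (\<Pi>\<^sub>M j\<in>obs m. borel) obs_space"
    by (intro measurable_obs_spaceI) auto
  then show ?thesis using assms by (rule measurable_compose)
qed

text \<open>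
  The events with fixed mask and label partition the sample space, and on each of them the
  observation is determined by the subvector, whose conditional law is Gaussian.
\<close>

lemma risk_decomposition:
  assumes [measurable]: "\<phi> \<in> borel_measurable obs_space"
  shows "prob {\<omega> \<in> space P. Y \<omega> \<noteq> \<phi> (Z \<omega>)} = (\<Sum>m\<in>UNIV. p m / 2 *
    (measure (law m 1) {x \<in> space (\<Pi>\<^sub>M j\<in>obs m. borel). \<phi> (x, m) \<noteq> 1} +
     measure (law m (-1)) {x \<in> space (\<Pi>\<^sub>M j\<in>obs m. borel). \<phi> (x, m) \<noteq> -1}))"
proof -
  define E where "E m k = {\<omega> \<in> stratum m k. \<phi> (Z \<omega>) \<noteq> k}" for m k
  have [measurable]: "E m k \<in> events" for m k
  proof -
    have "E m k = stratum m k \<inter> {\<omega> \<in> space P. \<phi> (Z \<omega>) \<noteq> k}" by (auto simp: E_def stratum_def)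
    also have "\<dots> \<in> events" by measurable
    finally show ?thesis .
  qed
  have "{\<omega> \<in> space P. Y \<omega> \<noteq> \<phi> (Z \<omega>)} = (\<Union>m\<in>UNIV. E m 1 \<union> E m (-1))"
  proof (rule set_eqI)
    fix \<omega>
    have "\<omega> \<in> {\<omega> \<in> space P. Y \<omega> \<noteq> \<phi> (Z \<omega>)} \<longleftrightarrow>
        \<omega> \<in> space P \<and> (Y \<omega> = 1 \<and> \<phi> (Z \<omega>) \<noteq> 1 \<or> Y \<omega> = -1 \<and> \<phi> (Z \<omega>) \<noteq> -1)"
      using Y_range[of \<omega>] by auto
    also have "\<dots> \<longleftrightarrow> \<omega> \<in> (\<Union>m\<in>UNIV. E m 1 \<union> E m (-1))"
      by (auto simp: E_def stratum_def)
    finally show "\<omega> \<in> {\<omega> \<in> space P. Y \<omega> \<noteq> \<phi> (Z \<omega>)} \<longleftrightarrow> \<omega> \<in> (\<Union>m\<in>UNIV. E m 1 \<union> E m (-1))" .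
  qed
  also have "prob \<dots> = (\<Sum>m\<in>UNIV. prob (E m 1 \<union> E m (-1)))"
    by (intro finite_measure_finite_Union) (auto simp: disjoint_family_on_def E_def stratum_def)
  also have "\<dots> = (\<Sum>m\<in>UNIV. prob (E m 1) + prob (E m (-1)))"
    by (intro sum.cong finite_measure_Union) (auto simp: E_def stratum_def)
  also have "\<dots> = (\<Sum>m\<in>UNIV. p m / 2 *
    (measure (law m 1) {x \<in> space (\<Pi>\<^sub>M j\<in>obs m. borel). \<phi> (x, m) \<noteq> 1} +
     measure (law m (-1)) {x \<in> space (\<Pi>\<^sub>M j\<in>obs m. borel). \<phi> (x, m) \<noteq> -1}))"
  proof (intro sum.cong refl)
    fix m :: "bool ^ 'd"
    have E: "prob (E m k) = p m / 2 * measure (law m k) {x \<in> space (\<Pi>\<^sub>M j\<in>obs m. borel). \<phi> (x, m) \<noteq> k}"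
      if k: "k \<in> {-1, 1}" for k
    proof (cases "p m > 0")
      case True
      note [measurable] = slice_measurable[OF assms, of m]
      have "E m k = {\<omega> \<in> stratum m k. subvec (X \<omega>) (obs m) \<in> {x \<in> space (\<Pi>\<^sub>M j\<in>obs m. borel). \<phi> (x, m) \<noteq> k}}"
        by (auto simp: E_def Z_stratum space_PiM subvec_def)
      then show ?thesis by (subst prob_stratum_subvec[OF True k, symmetric]) auto
    next
      case False
      then have "p m = 0" using p_nonneg[of m] by simp
      moreover have "prob (E m k) \<le> prob (stratum m k)"
        by (intro finite_measure_mono) (auto simp: E_def)
      ultimately show ?thesis
        using prob_stratum[OF k, of m] by (simp add: measure_le_0_iff)
    qed
    show "prob (E m 1) + prob (E m (-1)) = p m / 2 *
      (measure (law m 1) {x \<in> space (\<Pi>\<^sub>M j\<in>obs m. borel). \<phi> (x, m) \<noteq> 1} +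
       measure (law m (-1)) {x \<in> space (\<Pi>\<^sub>M j\<in>obs m. borel). \<phi> (x, m) \<noteq> -1})"
      by (subst (1 2) E) (simp_all only: distrib_left insert_iff simp_thms)
  qed
  finally show ?thesis .
qed

abbreviation white :: "bool ^ 'd \<Rightarrow> ('d \<Rightarrow> real) \<Rightarrow> real ^ 'd" where
  "white m \<equiv> whiten (obs m) (fac m)"

text \<open>
  On a mask, \<open>2 \<Phi>(-|\<alpha> - \<beta>|/2)\<close> is the integral of the minimum of the two class densities with whitened
  centres \<open>\<alpha>\<close>, \<open>\<beta>\<close>, that is, their overlap; each class has the weight \<open>p m / 2\<close>.
\<close>

definition gaussian_overlap :: real where
  "gaussian_overlap = (\<Sum>m\<in>UNIV. p m * Phi (- norm (white m (\<mu> m 1) - white m (\<mu> m (-1))) / 2))"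

lemma risk_ge_overlap:
  assumes [measurable]: "\<phi> \<in> borel_measurable obs_space"
  shows "gaussian_overlap \<le> prob {\<omega> \<in> space P. Y \<omega> \<noteq> \<phi> (Z \<omega>)}"
  unfolding risk_decomposition[OF assms] gaussian_overlap_def
proof (rule sum_mono)
  fix m :: "bool ^ 'd"
  note [measurable] = slice_measurable[OF assms, of m]
  let ?sp = "space (\<Pi>\<^sub>M j\<in>obs m. (borel :: real measure))"
  let ?T = "{x \<in> ?sp. \<phi> (x, m) \<noteq> 1}" and ?T' = "{x \<in> ?sp. \<phi> (x, m) \<noteq> -1}"
  show "p m * Phi (- norm (white m (\<mu> m 1) - white m (\<mu> m (-1))) / 2)
      \<le> p m / 2 * (measure (law m 1) ?T + measure (law m (-1)) ?T')"
  proof (cases "p m > 0")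
    case True
    interpret N: prob_space "law m (-1)"
      unfolding gauss_law_def by (rule std_gauss.prob_space_distr) measurable
    have "2 * Phi (- norm (white m (\<mu> m 1) - white m (\<mu> m (-1))) / 2)
        \<le> measure (law m 1) ?T + measure (law m (-1)) (?sp - ?T)"
      by (rule gauss_law_testing[OF cov_pos_def[OF True] factor[OF True]]) measurable
    also have "measure (law m (-1)) (?sp - ?T) \<le> measure (law m (-1)) ?T'"
      by (rule N.finite_measure_mono) auto
    finally show ?thesis using True by (simp add: mult_left_mono)
  next
    case False
    then show ?thesis using p_nonneg[of m] by simp
  qed
qed

text \<open>
  A conditional expectation given \<open>Z\<close> is measurable with respect to \<open>Z\<close>, so the event on which the Bayes predictor is
  \<open>1\<close> has the form \<open>Z \<in> T\<close>.
\<close>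

lemma bayes_risk_ge_overlap: "gaussian_overlap \<le> risk_mis P Y (h_star P Z Y)"
proof -
  let ?F = "vimage_algebra (space P) Z obs_space"
  let ?c = "real_cond_exp P ?F Y"
  have [measurable]: "?c \<in> borel_measurable ?F" by measurable
  have "{\<omega> \<in> space ?F. 0 \<le> ?c \<omega>} \<in> sets ?F" by measurable
  moreover have "sets ?F = {Z -` A \<inter> space P | A. A \<in> sets obs_space}"
    by (rule sets_vimage_algebra2) (auto intro: measurable_space[OF Z_meas])
  ultimately have "{\<omega> \<in> space P. 0 \<le> ?c \<omega>} \<in> {Z -` A \<inter> space P | A. A \<in> sets obs_space}"
    by simp
  then obtain T where T: "T \<in> sets obs_space" "{\<omega> \<in> space P. 0 \<le> ?c \<omega>} = Z -` T \<inter> space P"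
    by blast
  define \<phi> where "\<phi> z = (if z \<in> T then 1 else - 1 :: real)" for z
  have [measurable]: "\<phi> \<in> borel_measurable obs_space"
    unfolding \<phi>_def[abs_def] using T(1) by measurable
  have "h_star P Z Y \<omega> = \<phi> (Z \<omega>)" if "\<omega> \<in> space P" for \<omega>
    using T(2) that by (auto simp: h_star_def sign_pm_def \<phi>_def)
  then have "risk_mis P Y (h_star P Z Y) = prob {\<omega> \<in> space P. Y \<omega> \<noteq> \<phi> (Z \<omega>)}"
    unfolding risk_mis_def by (intro arg_cong[where f=prob]) auto
  then show ?thesis using risk_ge_overlap[of \<phi>] by simp
qed

definition mean_error :: "nat \<Rightarrow> real \<Rightarrow> (nat \<Rightarrow> 'd observation \<times> real) \<Rightarrow> bool ^ 'd \<Rightarrow> real \<Rightarrow> real" where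
  "mean_error n \<tau> d m k = norm (white m (\<lambda>j. mu_tilde n \<tau> d m k j - \<mu> m k j))"

text \<open>
  The sample is frozen here; \<open>d\<close> is an arbitrary sequence of labelled observations.
\<close>

lemma plug_in_risk_le:
  "prob {\<omega> \<in> space P. Y \<omega> \<noteq> h_tilde n \<tau> cov d (Z \<omega>)}
    \<le> gaussian_overlap + (\<Sum>m\<in>UNIV. p m * (mean_error n \<tau> d m 1 + mean_error n \<tau> d m (-1))) / sqrt (2 * pi)"
proof -
  have [measurable]: "h_tilde n \<tau> cov d \<in> borel_measurable obs_space"
    by (rule h_tilde_measurable[of n "\<lambda>_. d", where z="\<lambda>z. z"]) (auto simp: space_labelled_space)
  show ?thesis
    unfolding risk_decomposition[of "h_tilde n \<tau> cov d", OF \<open>h_tilde n \<tau> cov d \<in> borel_measurable obs_space\<close>]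
      gaussian_overlap_def sum_divide_distrib sum.distrib[symmetric]
  proof (rule sum_mono)
    fix m :: "bool ^ 'd"
    let ?sp = "space (\<Pi>\<^sub>M j\<in>obs m. (borel :: real measure))"
    let ?d = "norm (white m (\<mu> m 1) - white m (\<mu> m (-1)))" and ?e = "mean_error n \<tau> d m 1 + mean_error n \<tau> d m (-1)"
    show "p m / 2 * (measure (law m 1) {x \<in> ?sp. h_tilde n \<tau> cov d (x, m) \<noteq> 1}
          + measure (law m (-1)) {x \<in> ?sp. h_tilde n \<tau> cov d (x, m) \<noteq> -1})
        \<le> p m * Phi (- ?d / 2) + p m * ?e / sqrt (2 * pi)"
    proof (cases "p m > 0")
      case True
      have "measure (law m 1) {x \<in> ?sp. h_tilde n \<tau> cov d (x, m) \<noteq> 1}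
          + measure (law m (-1)) {x \<in> ?sp. h_tilde n \<tau> cov d (x, m) \<noteq> -1}
          \<le> 2 * Phi (- ?d / 2) + 2 * ?e / sqrt (2 * pi)"
        unfolding h_tilde_eq fst_conv snd_conv h_tilde_pattern_lda mean_error_def
        by (rule gauss_law_lda[OF cov_pos_def[OF True] factor[OF True]])
      then have "p m / 2 * (measure (law m 1) {x \<in> ?sp. h_tilde n \<tau> cov d (x, m) \<noteq> 1}
          + measure (law m (-1)) {x \<in> ?sp. h_tilde n \<tau> cov d (x, m) \<noteq> -1})
          \<le> p m / 2 * (2 * Phi (- ?d / 2) + 2 * ?e / sqrt (2 * pi))"
        using True by (intro mult_left_mono) auto
      then show ?thesis by (simp add: distrib_left)
    next
      case False
      then show ?thesis using p_nonneg[of m] by simp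
    qed
  qed
qed

end

section \<open>Averaging over the sample\<close>

lemma L2_set_le_mu_norm: "k \<in> {-1, 1} \<Longrightarrow> L2_set (\<mu> m k) (obs m) \<le> mu_norm \<mu> m"
  unfolding mu_norm_def by (rule Max_ge) auto

lemma mu_norm_nonneg: "mu_norm \<mu> m \<ge> 0"
  by (rule order_trans[OF L2_set_nonneg L2_set_le_mu_norm[of 1]]) simp

lemma mu_norm_empty: "obs m = {} \<Longrightarrow> mu_norm \<mu> m = 0"
  by (simp add: mu_norm_def)

locale sampled_model = missing_gaussian_model P X M Y \<mu> cov
  for P :: "'o measure" and X :: "'o \<Rightarrow> real ^ ('d::finite)" and M Y \<mu> cov +
  fixes D :: "nat \<Rightarrow> 'o \<Rightarrow> 'd observation \<times> real" and n :: nat and \<tau> :: real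
  assumes sample_indep: "indep_vars (\<lambda>_. labelled_space) D {1..n}"
    and sample_distr: "\<And>i. i \<in> {1..n} \<Longrightarrow>
          distr P labelled_space (D i) = distr P labelled_space (\<lambda>\<omega>. (Z \<omega>, Y \<omega>))"
    and sample_test_indep: "indep_set
          (sets (vimage_algebra (space P) (\<lambda>\<omega>. \<lambda>i\<in>{1..n}. D i \<omega>) (\<Pi>\<^sub>M i\<in>{1..n}. labelled_space)))
          (sets (vimage_algebra (space P) (\<lambda>\<omega>. (Z \<omega>, Y \<omega>)) labelled_space))"
    and n: "n \<ge> 1"
    and \<tau>: "\<tau> \<ge> sqrt (real CARD('d) / real n)"
begin

lemma sample_meas: "i \<in> {1..n} \<Longrightarrow> D i \<in> measurable P labelled_space"
  using sample_indep by (auto simp: indep_vars_def)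

lemma ZY_meas [measurable]: "(\<lambda>\<omega>. (Z \<omega>, Y \<omega>)) \<in> measurable P labelled_space"
  unfolding labelled_space_def by measurable

lemma sample_transfer:
  fixes F :: "'d observation \<times> real \<Rightarrow> real"
  assumes i: "i \<in> {1..n}" and F: "F \<in> borel_measurable labelled_space"
  shows "expectation (\<lambda>\<omega>. F (D i \<omega>)) = expectation (\<lambda>\<omega>. F (Z \<omega>, Y \<omega>))"
    and "integrable P (\<lambda>\<omega>. F (D i \<omega>)) \<longleftrightarrow> integrable P (\<lambda>\<omega>. F (Z \<omega>, Y \<omega>))"
  using integral_distr[OF sample_meas[OF i] F] integral_distr[OF ZY_meas F]
    integrable_distr_eq[OF sample_meas[OF i] F] integrable_distr_eq[OF ZY_meas F] sample_distr[OF i]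
  by simp_all

definition ratio :: "bool ^ 'd \<Rightarrow> real" where
  "ratio m = mu_norm \<mu> m / sqrt (lambda_min_on (obs m) (cov m))"

lemma norm_white_le_ratio:
  assumes m: "p m > 0" and k: "k \<in> {-1, 1}"
  shows "norm (white m (\<mu> m k)) \<le> ratio m"
proof -
  have "norm (white m (\<mu> m k)) \<le> L2_set (\<mu> m k) (obs m) / sqrt (lambda_min_on (obs m) (cov m))"
    by (rule norm_whiten_le[OF cov_pos_def[OF m] factor[OF m]])
  also have "\<dots> \<le> ratio m"
  proof (cases "obs m = {}")
    case True
    then show ?thesis by (simp add: ratio_def mu_norm_empty)
  next
    case False
    have "lambda_min_on (obs m) (cov m) > 0"
      by (rule lambda_min_on_rayleigh(1)[OF cov_pos_def[OF m] False])
    then show ?thesis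
      unfolding ratio_def by (intro divide_right_mono L2_set_le_mu_norm k) auto
  qed
  finally show ?thesis .
qed

text \<open>
  The whitened centred observations with mask \<open>m\<close> and label \<open>k\<close> form a \<open>selected_sample\<close> with \<open>q = p m / 2\<close>.
  Above the threshold the error of the estimate is the norm of their mean; below it the estimate is \<open>0\<close> and
  the error is the norm of the whitened true mean.
\<close>

lemma mean_error_bound:
  assumes m: "p m > 0" and k: "k \<in> {-1, 1}"
  shows "integrable P (\<lambda>\<omega>. mean_error n \<tau> (\<lambda>i. D i \<omega>) m k)"
    and "p m * expectation (\<lambda>\<omega>. mean_error n \<tau> (\<lambda>i. D i \<omega>) m k) \<le> (2 + 4 * ratio m) * min \<tau> (p m)"
proof -
  note C = cov_pos_def[OF m] and A = factor[OF m]
  define b :: "'d observation \<times> real \<Rightarrow> real" where "b a = of_bool (snd (fst a) = m) * of_bool (snd a = k)" for a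
  define \<zeta> where "\<zeta> l a = b a * white m (\<lambda>j. fst (fst a) j - \<mu> m k j) $ l" for l and a :: "'d observation \<times> real"
  have [measurable]: "b \<in> borel_measurable labelled_space" unfolding b_def by measurable
  have [measurable]: "\<zeta> l \<in> borel_measurable labelled_space" for l
    unfolding \<zeta>_def whiten_component by measurable
  have b: "b (Z \<omega>, Y \<omega>) = indicator (stratum m k) \<omega>" if "\<omega> \<in> space P" for \<omega>
    using that by (auto simp: b_def Z_def observe_def stratum_def)
  have \<zeta>: "\<zeta> l (Z \<omega>, Y \<omega>) = indicator (stratum m k) \<omega> * (white m (\<lambda>j. subvec (X \<omega>) (obs m) j - \<mu> m k j) $ l)"
    if "\<omega> \<in> space P" for \<omega> l
    using that by (auto simp: \<zeta>_def b indicator_def Z_stratum)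
  have \<zeta>2: "(\<zeta> l (Z \<omega>, Y \<omega>))\<^sup>2 = indicator (stratum m k) \<omega> * (white m (\<lambda>j. subvec (X \<omega>) (obs m) j - \<mu> m k j) $ l)\<^sup>2"
    if "\<omega> \<in> space P" for \<omega> l
    using that by (auto simp: \<zeta> indicator_def)
  interpret selected_sample P labelled_space D n b \<zeta> "obs m" "p m / 2"
  proof
    show "indep_vars (\<lambda>_. labelled_space) D {1..n}" by (rule sample_indep)
    show "b a \<in> {0, 1}" for a by (simp add: b_def)
    show "\<zeta> l a = 0" if "b a = 0" for l a using that by (simp add: \<zeta>_def)
    fix i assume i: "i \<in> {1..n}"
    have "expectation (\<lambda>\<omega>. b (D i \<omega>)) = expectation (\<lambda>\<omega>. b (Z \<omega>, Y \<omega>))"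
      by (rule sample_transfer(1)[OF i]) measurable
    also have "\<dots> = expectation (indicator (stratum m k))"
      by (intro Bochner_Integration.integral_cong) (auto simp: b)
    also have "\<dots> = p m / 2" by (simp add: prob_stratum[OF k])
    finally show "expectation (\<lambda>\<omega>. b (D i \<omega>)) = p m / 2" .
    fix l assume l: "l \<in> obs m"
    note mom = gauss_law_moments[OF C A l, of "\<mu> m k"]
    have "integrable P (\<lambda>\<omega>. (\<zeta> l (Z \<omega>, Y \<omega>))\<^sup>2)"
      using expectation_stratum(1)[OF m k mom(1)]
      by (subst Bochner_Integration.integrable_cong[OF refl \<zeta>2]) auto
    then show "integrable P (\<lambda>\<omega>. (\<zeta> l (D i \<omega>))\<^sup>2)"
      by (subst sample_transfer(2)[OF i]) auto
    have "expectation (\<lambda>\<omega>. (\<zeta> l (D i \<omega>))\<^sup>2) = expectation (\<lambda>\<omega>. (\<zeta> l (Z \<omega>, Y \<omega>))\<^sup>2)"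
      by (rule sample_transfer(1)[OF i]) measurable
    also have "\<dots> = p m / 2"
      using expectation_stratum(2)[OF m k mom(1)] unfolding mom(3)
      by (subst Bochner_Integration.integral_cong[OF refl \<zeta>2]) auto
    finally show "expectation (\<lambda>\<omega>. (\<zeta> l (D i \<omega>))\<^sup>2) = p m / 2" .
    have "expectation (\<lambda>\<omega>. \<zeta> l (D i \<omega>)) = expectation (\<lambda>\<omega>. \<zeta> l (Z \<omega>, Y \<omega>))"
      by (rule sample_transfer(1)[OF i]) measurable
    also have "\<dots> = 0"
      using expectation_stratum(2)[OF m k mom(2)] unfolding mom(4)
      by (subst Bochner_Integration.integral_cong[OF refl \<zeta>]) auto
    finally show "expectation (\<lambda>\<omega>. \<zeta> l (D i \<omega>)) = 0" .
  qed auto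
  define R where "R \<omega> = of_bool (cnt \<omega> / n > \<tau>) * (L2_set (\<lambda>l. \<Sum>i\<in>{1..n}. \<zeta> l (D i \<omega>)) (obs m) / cnt \<omega>)" for \<omega>
  have "real (card (obs m)) \<le> real CARD('d)" by (simp add: card_mono)
  moreover have "0 < CARD('d)" by simp
  ultimately have bounds: "integrable P R" "p m / 2 * expectation R \<le> min \<tau> (p m)"
      "p m / 2 * prob {\<omega> \<in> space P. \<not> cnt \<omega> / n > \<tau>} \<le> 2 * min \<tau> (p m)"
    using thresholded_mean_bounds[where c="real CARD('d)" and \<tau>=\<tau>] n \<tau> p_nonneg[of m] p_le_1[of m]
    by (simp_all add: R_def[abs_def] Suc_leI)
  let ?F = "{\<omega> \<in> space P. \<not> cnt \<omega> / n > \<tau>}" and ?w = "norm (white m (\<mu> m k))"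
  have count: "real (count_mk n (\<lambda>i. D i \<omega>) m k) = cnt \<omega>" for \<omega>
    by (simp add: count_mk_def cnt_def b_def)
  have \<tau>0: "\<tau> \<ge> 0" using \<tau> by (rule order_trans[rotated]) simp
  have err: "mean_error n \<tau> (\<lambda>i. D i \<omega>) m k = R \<omega> + indicator ?F \<omega> * ?w" if "\<omega> \<in> space P" for \<omega>
  proof (cases "cnt \<omega> / n > \<tau>")
    case True
    then have c: "cnt \<omega> > 0"
      using \<tau>0 n by (metis divide_le_0_iff not_less of_nat_0_le_iff order_trans)
    have "white m (\<lambda>j. mu_tilde n \<tau> (\<lambda>i. D i \<omega>) m k j - \<mu> m k j) $ l = (\<Sum>i\<in>{1..n}. \<zeta> l (D i \<omega>)) / cnt \<omega>" for l
    proof -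
      have "mu_tilde n \<tau> (\<lambda>i. D i \<omega>) m k j - \<mu> m k j
          = (\<Sum>i\<in>{1..n}. b (D i \<omega>) * (fst (fst (D i \<omega>)) j - \<mu> m k j)) / cnt \<omega>" for j
      proof -
        have "mu_tilde n \<tau> (\<lambda>i. D i \<omega>) m k j = (\<Sum>i\<in>{1..n}. b (D i \<omega>) * fst (fst (D i \<omega>)) j) / cnt \<omega>"
          using True by (simp add: mu_tilde_def mu_hat_def count b_def ac_simps)
        moreover have \<mu>: "cnt \<omega> * \<mu> m k j = (\<Sum>i\<in>{1..n}. b (D i \<omega>) * \<mu> m k j)"
          unfolding cnt_def by (rule sum_distrib_right)
        have "(\<Sum>i\<in>{1..n}. b (D i \<omega>) * (fst (fst (D i \<omega>)) j - \<mu> m k j)) / cnt \<omega>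
            = (\<Sum>i\<in>{1..n}. b (D i \<omega>) * fst (fst (D i \<omega>)) j) / cnt \<omega> - cnt \<omega> * \<mu> m k j / cnt \<omega>"
          by (simp only: right_diff_distrib sum_subtractf diff_divide_distrib \<mu>)
        ultimately show ?thesis using c by simp
      qed
      then have "white m (\<lambda>j. mu_tilde n \<tau> (\<lambda>i. D i \<omega>) m k j - \<mu> m k j) $ l
          = (\<Sum>j\<in>obs m. \<Sum>i\<in>{1..n}. matrix_inv (pad_mat (obs m) (fac m)) $ l $ j
              * (b (D i \<omega>) * (fst (fst (D i \<omega>)) j - \<mu> m k j))) / cnt \<omega>"
        by (simp only: whiten_component sum_divide_distrib sum_distrib_left times_divide_eq_right)
      also have "\<dots> = (\<Sum>i\<in>{1..n}. \<zeta> l (D i \<omega>)) / cnt \<omega>"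
        by (subst sum.swap) (simp add: \<zeta>_def whiten_component sum_distrib_left mult.left_commute)
      finally show ?thesis .
    qed
    then have "mean_error n \<tau> (\<lambda>i. D i \<omega>) m k = L2_set (\<lambda>l. (\<Sum>i\<in>{1..n}. \<zeta> l (D i \<omega>)) / cnt \<omega>) (obs m)"
      by (simp add: mean_error_def norm_whiten[OF C A])
    also have "\<dots> = L2_set (\<lambda>l. \<Sum>i\<in>{1..n}. \<zeta> l (D i \<omega>)) (obs m) / cnt \<omega>"
      using c by (simp add: L2_set_def power_divide sum_divide_distrib[symmetric] real_sqrt_divide)
    finally show ?thesis using True by (simp add: R_def indicator_def)
  next
    case False
    have "mean_error n \<tau> (\<lambda>i. D i \<omega>) m k = norm (white m (\<lambda>j. 0 - \<mu> m k j))"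
      using False by (simp add: mean_error_def mu_tilde_def count)
    also have "\<dots> = ?w"
      unfolding whiten_diff by (simp add: whiten_def pad_vec_def zero_vec_def[symmetric])
    finally show ?thesis using False that by (simp add: R_def indicator_def)
  qed
  have F_int: "integrable P (\<lambda>\<omega>. indicator ?F \<omega> * ?w)"
    by (intro integrable_mult_left) (simp add: integrable_indicator_iff emeasure_eq_measure)
  show "integrable P (\<lambda>\<omega>. mean_error n \<tau> (\<lambda>i. D i \<omega>) m k)"
    using Bochner_Integration.integrable_add[OF bounds(1) F_int]
    by (subst Bochner_Integration.integrable_cong[OF refl err]) auto
  have "expectation (\<lambda>\<omega>. mean_error n \<tau> (\<lambda>i. D i \<omega>) m k) = expectation (\<lambda>\<omega>. R \<omega> + indicator ?F \<omega> * ?w)"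
    by (intro Bochner_Integration.integral_cong err) auto
  also have "\<dots> = expectation R + expectation (\<lambda>\<omega>. indicator ?F \<omega> * ?w)"
    by (rule Bochner_Integration.integral_add[OF bounds(1) F_int])
  also have "expectation (\<lambda>\<omega>. indicator ?F \<omega> * ?w) = prob ?F * ?w" by simp
  finally have "p m * expectation (\<lambda>\<omega>. mean_error n \<tau> (\<lambda>i. D i \<omega>) m k)
      = 2 * (p m / 2 * expectation R) + 2 * ?w * (p m / 2 * prob ?F)"
    by (simp add: algebra_simps)
  also have "\<dots> \<le> 2 * min \<tau> (p m) + 2 * ratio m * (2 * min \<tau> (p m))"
  proof (intro add_mono mult_left_mono)
    have "2 * ?w * (p m / 2 * prob ?F) \<le> 2 * ?w * (2 * min \<tau> (p m))"
      by (intro mult_left_mono bounds) auto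
    also have "\<dots> \<le> 2 * ratio m * (2 * min \<tau> (p m))"
      using norm_white_le_ratio[OF m k] \<tau>0 p_nonneg[of m] by (intro mult_right_mono) auto
    finally show "2 * ?w * (p m / 2 * prob ?F) \<le> 2 * ratio m * (2 * min \<tau> (p m))" .
  qed (use bounds in auto)
  finally show "p m * expectation (\<lambda>\<omega>. mean_error n \<tau> (\<lambda>i. D i \<omega>) m k) \<le> (2 + 4 * ratio m) * min \<tau> (p m)"
    by (simp add: algebra_simps)
qed

text \<open>
  Two random elements with values in different spaces: independence is used on rectangles,
  which determine the joint law.
\<close>

lemma joint_law:
  "distr P (\<Pi>\<^sub>M i\<in>{1..n}. labelled_space) (\<lambda>\<omega>. \<lambda>i\<in>{1..n}. D i \<omega>) \<Otimes>\<^sub>M distr P labelled_space (\<lambda>\<omega>. (Z \<omega>, Y \<omega>))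
   = distr P ((\<Pi>\<^sub>M i\<in>{1..n}. labelled_space) \<Otimes>\<^sub>M labelled_space) (\<lambda>\<omega>. (\<lambda>i\<in>{1..n}. D i \<omega>, (Z \<omega>, Y \<omega>)))"
proof (rule pair_measure_eqI)
  let ?S = "\<Pi>\<^sub>M i\<in>{1..n}. (labelled_space :: ('d observation \<times> real) measure)"
  let ?D = "\<lambda>\<omega>. \<lambda>i\<in>{1..n}. D i \<omega>" and ?V = "\<lambda>\<omega>. (Z \<omega>, Y \<omega>)"
  have Dm [measurable]: "?D \<in> measurable P ?S" by (rule measurable_restrict[OF sample_meas])
  show "sigma_finite_measure (distr P ?S ?D)" "sigma_finite_measure (distr P labelled_space ?V)"
    by (intro finite_measure.axioms(1) prob_space.axioms(1) prob_space_distr Dm ZY_meas)+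
  show "sets (distr P ?S ?D \<Otimes>\<^sub>M distr P labelled_space ?V)
      = sets (distr P (?S \<Otimes>\<^sub>M labelled_space) (\<lambda>\<omega>. (?D \<omega>, ?V \<omega>)))"
    by (simp cong: sets_pair_measure_cong)
  fix A B assume "A \<in> sets (distr P ?S ?D)" "B \<in> sets (distr P labelled_space ?V)"
  then have AB: "A \<in> sets ?S" "B \<in> sets labelled_space" by (simp_all only: sets_distr)
  have "?D -` A \<inter> space P \<in> sets (vimage_algebra (space P) ?D ?S)"
    "?V -` B \<inter> space P \<in> sets (vimage_algebra (space P) ?V labelled_space)"
    using AB by (auto intro: in_vimage_algebra)
  then have "prob ((?D -` A \<inter> space P) \<inter> (?V -` B \<inter> space P)) = prob (?D -` A \<inter> space P) * prob (?V -` B \<inter> space P)"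
    by (rule indep_setD[OF sample_test_indep])
  moreover have "(?D -` A \<inter> space P) \<inter> (?V -` B \<inter> space P) = (\<lambda>\<omega>. (?D \<omega>, ?V \<omega>)) -` (A \<times> B) \<inter> space P"
    by auto
  moreover have "A \<times> B \<in> sets (?S \<Otimes>\<^sub>M labelled_space)" using AB by simp
  moreover have "(\<lambda>\<omega>. (?D \<omega>, ?V \<omega>)) \<in> measurable P (?S \<Otimes>\<^sub>M labelled_space)" by measurable
  ultimately show "emeasure (distr P ?S ?D) A * emeasure (distr P labelled_space ?V) B
      = emeasure (distr P (?S \<Otimes>\<^sub>M labelled_space) (\<lambda>\<omega>. (?D \<omega>, ?V \<omega>))) (A \<times> B)"
    using AB by (simp only: emeasure_distr Dm ZY_meas emeasure_eq_measure ennreal_mult[symmetric] measure_nonneg)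
qed

text \<open>
  By independence, the risk over sample and test point is the average over the sample of the risk of
  the classifier with frozen sample.
\<close>

lemma plug_in_risk_average:
  "ennreal (risk_mis P Y (\<lambda>\<omega>. h_tilde n \<tau> cov (\<lambda>i. D i \<omega>) (Z \<omega>)))
   = (\<integral>\<^sup>+\<omega>. ennreal (prob {\<omega>' \<in> space P. Y \<omega>' \<noteq> h_tilde n \<tau> cov (\<lambda>i. D i \<omega>) (Z \<omega>')}) \<partial>P)"
proof -
  let ?S = "\<Pi>\<^sub>M i\<in>{1..n}. (labelled_space :: ('d observation \<times> real) measure)"
  let ?D = "\<lambda>\<omega>. \<lambda>i\<in>{1..n}. D i \<omega>" and ?V = "\<lambda>\<omega>. (Z \<omega>, Y \<omega>)"
  let ?Q = "distr P labelled_space ?V"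
  interpret Q: prob_space ?Q by (rule prob_space_distr) measurable
  have [measurable]: "?D \<in> measurable P ?S" by (rule measurable_restrict[OF sample_meas])
  define E where "E = {w \<in> space (?S \<Otimes>\<^sub>M labelled_space). snd (snd w) \<noteq> h_tilde n \<tau> cov (fst w) (fst (snd w))}"
  have [measurable]: "(\<lambda>w. h_tilde n \<tau> cov (fst w) (fst (snd w))) \<in> borel_measurable (?S \<Otimes>\<^sub>M labelled_space)"
    by (rule h_tilde_measurable) measurable
  have E [measurable]: "E \<in> sets (?S \<Otimes>\<^sub>M labelled_space)"
    unfolding E_def by measurable
  have spD: "?D \<omega> \<in> space ?S" if "\<omega> \<in> space P" for \<omega>
    using measurable_space[OF \<open>?D \<in> measurable P ?S\<close> that] .
  have h: "h_tilde n \<tau> cov (?D \<omega>) = h_tilde n \<tau> cov (\<lambda>i. D i \<omega>)" for \<omega>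
    by (intro ext h_tilde_cong) simp
  have "ennreal (risk_mis P Y (\<lambda>\<omega>. h_tilde n \<tau> cov (\<lambda>i. D i \<omega>) (Z \<omega>)))
      = emeasure P ((\<lambda>\<omega>. (?D \<omega>, ?V \<omega>)) -` E \<inter> space P)"
    unfolding risk_mis_def emeasure_eq_measure
    by (intro arg_cong[where f=ennreal] arg_cong[where f=prob])
       (auto simp: E_def space_pair_measure space_labelled_space spD h simp del: One_nat_def)
  also have "\<dots> = emeasure (distr P (?S \<Otimes>\<^sub>M labelled_space) (\<lambda>\<omega>. (?D \<omega>, ?V \<omega>))) E"
    by (rule emeasure_distr[symmetric]) measurable
  also have "\<dots> = emeasure (distr P ?S ?D \<Otimes>\<^sub>M ?Q) E"
    unfolding joint_law ..
  also have "\<dots> = (\<integral>\<^sup>+d. emeasure ?Q (Pair d -` E) \<partial>distr P ?S ?D)"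
    by (rule Q.emeasure_pair_measure_alt) (simp only: E sets_pair_measure_cong[OF sets_distr sets_distr])
  also have "\<dots> = (\<integral>\<^sup>+\<omega>. emeasure ?Q (Pair (?D \<omega>) -` E) \<partial>P)"
  proof (rule nn_integral_distr)
    have "(\<lambda>d. emeasure ?Q (Pair d -` E)) \<in> borel_measurable ?S"
      by (rule Q.measurable_emeasure_Pair) (simp only: E sets_pair_measure_cong[OF refl sets_distr])
    then show "(\<lambda>d. emeasure ?Q (Pair d -` E)) \<in> borel_measurable (distr P ?S ?D)"
      by (simp only: measurable_distr_eq1)
  qed measurable
  also have "\<dots> = (\<integral>\<^sup>+\<omega>. ennreal (prob {\<omega>' \<in> space P. Y \<omega>' \<noteq> h_tilde n \<tau> cov (\<lambda>i. D i \<omega>) (Z \<omega>')}) \<partial>P)"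
  proof (rule nn_integral_cong)
    fix \<omega> assume \<omega>: "\<omega> \<in> space P"
    have "Pair (?D \<omega>) -` E \<in> sets labelled_space"
      by (rule sets_Pair1[OF E])
    then have "emeasure ?Q (Pair (?D \<omega>) -` E) = emeasure P (?V -` (Pair (?D \<omega>) -` E) \<inter> space P)"
      by (intro emeasure_distr ZY_meas)
    also have "?V -` (Pair (?D \<omega>) -` E) \<inter> space P
        = {\<omega>' \<in> space P. Y \<omega>' \<noteq> h_tilde n \<tau> cov (\<lambda>i. D i \<omega>) (Z \<omega>')}"
      using spD[OF \<omega>] by (auto simp: E_def space_pair_measure space_labelled_space h simp del: One_nat_def)
    finally show "emeasure ?Q (Pair (?D \<omega>) -` E)
        = ennreal (prob {\<omega>' \<in> space P. Y \<omega>' \<noteq> h_tilde n \<tau> cov (\<lambda>i. D i \<omega>) (Z \<omega>')})"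
      by (simp only: emeasure_eq_measure)
  qed
  finally show ?thesis .
qed

lemma overlap_nonneg: "gaussian_overlap \<ge> 0"
  unfolding gaussian_overlap_def by (intro sum_nonneg mult_nonneg_nonneg p_nonneg) (simp add: Phi_def)

text \<open>
  The estimation errors are only controlled for masks of positive probability; the others have weight \<open>0\<close>.
\<close>

lemma sampled_risk_le:
  "risk_mis P Y (\<lambda>\<omega>. h_tilde n \<tau> cov (\<lambda>i. D i \<omega>) (Z \<omega>))
    \<le> gaussian_overlap + (\<Sum>m\<in>UNIV. (4 + 8 * ratio m) * min \<tau> (p m)) / sqrt (2 * pi)"
proof -
  define e where "e m \<omega> = p m * (mean_error n \<tau> (\<lambda>i. D i \<omega>) m 1 + mean_error n \<tau> (\<lambda>i. D i \<omega>) m (-1))" for m \<omega>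
  have e: "integrable P (e m) \<and> expectation (e m) \<le> (4 + 8 * ratio m) * min \<tau> (p m)" for m
  proof (cases "p m > 0")
    case True
    have i: "integrable P (\<lambda>\<omega>. mean_error n \<tau> (\<lambda>i. D i \<omega>) m 1)" "integrable P (\<lambda>\<omega>. mean_error n \<tau> (\<lambda>i. D i \<omega>) m (-1))"
      using mean_error_bound(1)[OF True] by auto
    have "expectation (e m) = p m * expectation (\<lambda>\<omega>. mean_error n \<tau> (\<lambda>i. D i \<omega>) m 1)
        + p m * expectation (\<lambda>\<omega>. mean_error n \<tau> (\<lambda>i. D i \<omega>) m (-1))"
      unfolding e_def using i by (simp add: distrib_left)
    also have "\<dots> \<le> (2 + 4 * ratio m) * min \<tau> (p m) + (2 + 4 * ratio m) * min \<tau> (p m)"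
      by (intro add_mono mean_error_bound(2)[OF True]) auto
    finally have "expectation (e m) \<le> (4 + 8 * ratio m) * min \<tau> (p m)"
      by (simp add: algebra_simps)
    moreover have "integrable P (e m)"
      unfolding e_def[abs_def] using i by (intro integrable_mult_right Bochner_Integration.integrable_add)
    ultimately show ?thesis by blast
  next
    case False
    then have "p m = 0" using p_nonneg[of m] by simp
    moreover have "\<tau> \<ge> 0" using \<tau> by (rule order_trans[rotated]) simp
    ultimately show ?thesis by (simp add: e_def[abs_def])
  qed
  have sum_int: "integrable P (\<lambda>\<omega>. \<Sum>m\<in>UNIV. e m \<omega>)"
    by (intro Bochner_Integration.integrable_sum) (use e in auto)
  then have int: "integrable P (\<lambda>\<omega>. gaussian_overlap + (\<Sum>m\<in>UNIV. e m \<omega>) / sqrt (2 * pi))"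
    by auto
  have nn: "0 \<le> gaussian_overlap + (\<Sum>m\<in>UNIV. e m \<omega>) / sqrt (2 * pi)" for \<omega>
    by (intro add_nonneg_nonneg overlap_nonneg divide_nonneg_nonneg sum_nonneg)
       (auto simp: e_def mean_error_def p_nonneg)
  have "ennreal (risk_mis P Y (\<lambda>\<omega>. h_tilde n \<tau> cov (\<lambda>i. D i \<omega>) (Z \<omega>)))
      \<le> (\<integral>\<^sup>+\<omega>. ennreal (gaussian_overlap + (\<Sum>m\<in>UNIV. e m \<omega>) / sqrt (2 * pi)) \<partial>P)"
    unfolding plug_in_risk_average e_def by (intro nn_integral_mono ennreal_leI plug_in_risk_le)
  also have "\<dots> = ennreal (expectation (\<lambda>\<omega>. gaussian_overlap + (\<Sum>m\<in>UNIV. e m \<omega>) / sqrt (2 * pi)))"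
    by (rule nn_integral_eq_integral[OF int]) (simp add: nn)
  finally have "risk_mis P Y (\<lambda>\<omega>. h_tilde n \<tau> cov (\<lambda>i. D i \<omega>) (Z \<omega>))
      \<le> expectation (\<lambda>\<omega>. gaussian_overlap + (\<Sum>m\<in>UNIV. e m \<omega>) / sqrt (2 * pi))"
    by (subst (asm) ennreal_le_iff) (auto intro: integral_nonneg_AE nn)
  also have "\<dots> = gaussian_overlap + (\<Sum>m\<in>UNIV. expectation (e m)) / sqrt (2 * pi)"
    using sum_int e by (simp add: prob_space Bochner_Integration.integral_sum)
  also have "\<dots> \<le> gaussian_overlap + (\<Sum>m\<in>UNIV. (4 + 8 * ratio m) * min \<tau> (p m)) / sqrt (2 * pi)"
    using e by (intro add_left_mono divide_right_mono sum_mono) auto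
  finally show ?thesis .
qed

end

section \<open>The excess risk bound\<close>

theorem theorem5p10:
  fixes P :: "'o measure"
    and X :: "'o \<Rightarrow> real ^ ('d::finite)"
    and M :: "'o \<Rightarrow> bool ^ 'd"
    and Y :: "'o \<Rightarrow> real"
    and D :: "nat \<Rightarrow> 'o \<Rightarrow> 'd observation \<times> real"
    and Z :: "'o \<Rightarrow> 'd observation"
    and p :: "bool ^ 'd \<Rightarrow> real"
    and \<pi> :: "bool ^ 'd \<Rightarrow> real \<Rightarrow> real"
    and \<mu> :: "bool ^ 'd \<Rightarrow> real \<Rightarrow> 'd \<Rightarrow> real"
    and cov :: "bool ^ 'd \<Rightarrow> 'd \<Rightarrow> 'd \<Rightarrow> real"
    and n :: nat and \<tau> :: real
  defines "Z \<equiv> (\<lambda>\<omega>. observe (X \<omega>) (M \<omega>))"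
    and "p \<equiv> (\<lambda>m. \<P>(\<omega> in P. M \<omega> = m))"
    and "\<pi> \<equiv> (\<lambda>m k. \<P>(\<omega> in P. Y \<omega> = k \<and> M \<omega> = m))"
  assumes "prob_space P"
    and X_meas: "X \<in> measurable P borel"
    and M_meas: "M \<in> measurable P (count_space UNIV)"
    and Y_meas: "Y \<in> measurable P borel"
    and Y_range: "\<And>\<omega>. \<omega> \<in> space P \<Longrightarrow> Y \<omega> \<in> {-1, 1}"
    and cov_pd: "\<And>m. p m > 0 \<Longrightarrow> sym_pos_def_on (obs m) (cov m)"
    and gaussian: "\<And>m k. p m > 0 \<Longrightarrow> k \<in> {-1, 1} \<Longrightarrow>
          is_gaussian_on (obs m) (\<mu> m k) (cov m)
            (distr (uniform_measure P {\<omega> \<in> space P. M \<omega> = m \<and> Y \<omega> = k})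
               (\<Pi>\<^sub>M j\<in>obs m. borel) (\<lambda>\<omega>. subvec (X \<omega>) (obs m)))"
    and balanced: "\<And>m. \<pi> m 1 = \<pi> m (-1)"
    and sample_indep: "prob_space.indep_vars P (\<lambda>_. labelled_space) D {1..n}"
    and sample_distr: "\<And>i. i \<in> {1..n} \<Longrightarrow>
          distr P labelled_space (D i) = distr P labelled_space (\<lambda>\<omega>. (Z \<omega>, Y \<omega>))"
    and sample_test_indep: "prob_space.indep_set P
          (sets (vimage_algebra (space P) (\<lambda>\<omega>. \<lambda>i\<in>{1..n}. D i \<omega>) (\<Pi>\<^sub>M i\<in>{1..n}. labelled_space)))
          (sets (vimage_algebra (space P) (\<lambda>\<omega>. (Z \<omega>, Y \<omega>)) labelled_space))"
    and "n \<ge> 1"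
    and "\<tau> \<ge> sqrt (real CARD('d) / real n)"
  shows "risk_mis P Y (\<lambda>\<omega>. h_tilde n \<tau> cov (\<lambda>i. D i \<omega>) (Z \<omega>)) - risk_mis P Y (h_star P Z Y)
    \<le> (\<Sum>m\<in>UNIV.
          (4 / sqrt (2 * pi) + 8 / sqrt pi * (mu_norm \<mu> m / sqrt (lambda_min_on (obs m) (cov m))))
            * min \<tau> (p m))
      + (\<Sum>m | p m \<ge> \<tau>.
          sqrt 2 * mu_norm \<mu> m / sqrt (pi * lambda_min_on (obs m) (cov m))
            * p m * (1 - p m) powr (real n / 2))"
proof -
  interpret model: missing_gaussian_model P X M Y \<mu> cov
  proof (rule missing_gaussian_model.intro)
    show "missing_gaussian_model_axioms P X M Y \<mu> cov"
      by (rule missing_gaussian_model_axioms.intro)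
         (fact X_meas M_meas Y_meas Y_range cov_pd[unfolded p_def] gaussian[unfolded p_def] balanced[unfolded \<pi>_def])+
  qed fact
  have Z: "Z = model.Z" by (simp add: Z_def model.Z_def fun_eq_iff)
  have p: "p = model.p" by (simp add: p_def model.p_def fun_eq_iff)
  interpret sampled_model P X M Y \<mu> cov D n \<tau>
  proof (rule sampled_model.intro)
    show "sampled_model_axioms P X M Y D n \<tau>"
      by (rule sampled_model_axioms.intro)
         (fact sample_indep sample_distr[unfolded Z] sample_test_indep[unfolded Z] \<open>n \<ge> 1\<close>
          \<open>\<tau> \<ge> sqrt (real CARD('d) / real n)\<close>)+
  qed unfold_locales
  let ?l = "\<lambda>m. lambda_min_on (obs m) (cov m)"
  have l: "mu_norm \<mu> m / sqrt (?l m) \<ge> 0 \<and> mu_norm \<mu> m / sqrt (pi * ?l m) \<ge> 0" if "p m > 0" for m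
  proof (cases "obs m = {}")
    case False
    have "?l m > 0" by (rule lambda_min_on_rayleigh(1)[OF cov_pd[OF that] False])
    then show ?thesis by (simp add: mu_norm_nonneg)
  qed (simp add: mu_norm_empty)
  have \<tau>0: "\<tau> > 0"
  proof -
    have "sqrt (real CARD('d) / real n) > 0" using \<open>n \<ge> 1\<close> by simp
    then show ?thesis using \<open>\<tau> \<ge> sqrt (real CARD('d) / real n)\<close> by linarith
  qed
  have "risk_mis P Y (\<lambda>\<omega>. h_tilde n \<tau> cov (\<lambda>i. D i \<omega>) (Z \<omega>)) - risk_mis P Y (h_star P Z Y)
      \<le> (\<Sum>m\<in>UNIV. (4 + 8 * ratio m) * min \<tau> (p m)) / sqrt (2 * pi)"
    using sampled_risk_le model.bayes_risk_ge_overlap unfolding Z p by linarith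
  also have "\<dots> \<le> (\<Sum>m\<in>UNIV. (4 / sqrt (2 * pi) + 8 / sqrt pi * (mu_norm \<mu> m / sqrt (?l m))) * min \<tau> (p m))"
    unfolding sum_divide_distrib
  proof (rule sum_mono)
    fix m :: "bool ^ 'd"
    show "(4 + 8 * ratio m) * min \<tau> (p m) / sqrt (2 * pi)
        \<le> (4 / sqrt (2 * pi) + 8 / sqrt pi * (mu_norm \<mu> m / sqrt (?l m))) * min \<tau> (p m)"
    proof (cases "p m > 0")
      case True
      have "8 / sqrt (2 * pi) \<le> 8 / sqrt pi"
        by (intro divide_left_mono) auto
      then have "8 / sqrt (2 * pi) * ratio m \<le> 8 / sqrt pi * ratio m"
        using l[OF True] unfolding ratio_def by (intro mult_right_mono) auto
      then have "(4 / sqrt (2 * pi) + 8 / sqrt (2 * pi) * ratio m) * min \<tau> (p m)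
          \<le> (4 / sqrt (2 * pi) + 8 / sqrt pi * ratio m) * min \<tau> (p m)"
        using \<tau>0 True by (intro mult_right_mono) auto
      moreover have "(4 + 8 * ratio m) * min \<tau> (p m) / sqrt (2 * pi)
          = (4 / sqrt (2 * pi) + 8 / sqrt (2 * pi) * ratio m) * min \<tau> (p m)"
        by (simp add: add_divide_distrib distrib_right)
      ultimately show ?thesis unfolding ratio_def by simp
    next
      case False
      then have "p m = 0" using model.p_nonneg[of m] p by simp
      then show ?thesis using \<tau>0 by simp
    qed
  qed
  also have "\<dots> \<le> \<dots> + (\<Sum>m | p m \<ge> \<tau>. sqrt 2 * mu_norm \<mu> m / sqrt (pi * ?l m) * p m * (1 - p m) powr (real n / 2))"
  proof -
    have "0 \<le> sqrt 2 * mu_norm \<mu> m / sqrt (pi * ?l m) * p m * (1 - p m) powr (real n / 2)" if "p m \<ge> \<tau>" for m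
    proof -
      have "p m > 0" using that \<tau>0 by simp
      then have "0 \<le> sqrt 2 * (mu_norm \<mu> m / sqrt (pi * ?l m)) * p m * (1 - p m) powr (real n / 2)"
        using l[of m] by (intro mult_nonneg_nonneg) auto
      then show ?thesis by simp
    qed
    then show ?thesis by (intro add_increasing2 sum_nonneg order_refl) (simp only: mem_Collect_eq)
  qed
  finally show ?thesis .
qed

end
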